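(* Let $\mathfrak{g}$ be a finite-dimensional real Lie algebra with radical $\mathfrak{r}$. Let $\mathfrak{a}$ be a finite-dimensional real abelian Lie algebra and let $\delta : H \mapsto \delta_H$ be a Lie algebra homomorphism from $\mathfrak{a}$ into the Lie algebra of derivations of $\mathfrak{g}$ such that, for every $H \in \mathfrak{a}$, the derivation $\delta_H$ is semisimple (so $\{\delta_H : H \in \mathfrak{a}\}$ is a commuting family of semisimple derivations of $\mathfrak{g}$). Then there exists a Levi subalgebra $\mathfrak{l}$ of $\mathfrak{g}$ such that $\delta_H \mathfrak{l} \subseteq \mathfrak{l}$ for all $H \in \mathfrak{a}$.
   Context: All Lie algebras are real and finite-dimensional. The radical $\mathfrak{r}$ of $\mathfrak{g}$ is its maximal solvable ideal. A Levi subalgebra of $\mathfrak{g}$ is a semisimple Lie subalgebra $\mathfrak{l}$ of $\mathfrak{g}$ such that $\mathfrak{g} = \mathfrak{l} \oplus \mathfrak{r}$ as vector spaces (the zero algebra is counted as semisimple). A derivation of $\mathfrak{g}$ is called semisimple if it is semisimple as a linear endomorphism of $\mathfrak{g}$, i.e. diagonalisable over $\mathbb{C}$ after complexification; it need not be diagonalisable over $\mathbb{R}$. *)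

theory Defs
  imports "HOL-Analysis.Analysis"
begin

definition finite_dim :: "'a::real_vector set \<Rightarrow> bool" where
  "finite_dim V \<longleftrightarrow> (\<exists>B. finite B \<and> V \<subseteq> span B)"

locale lie_algebra =
  fixes br :: "'a::real_vector \<Rightarrow> 'a \<Rightarrow> 'a"
  assumes bilinear_br: "bilinear br"
    and br_self: "br x x = 0"
    and jacobi: "br x (br y z) + br y (br z x) + br z (br x y) = 0"

definition lie_abelian :: "('a::real_vector \<Rightarrow> 'a \<Rightarrow> 'a) \<Rightarrow> bool" where
  "lie_abelian br \<longleftrightarrow> (\<forall>x y. br x y = 0)"

definition lie_subalgebra :: "('a::real_vector \<Rightarrow> 'a \<Rightarrow> 'a) \<Rightarrow> 'a set \<Rightarrow> bool" where
  "lie_subalgebra br L \<longleftrightarrow> subspace L \<and> (\<forall>x\<in>L. \<forall>y\<in>L. br x y \<in> L)"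

text \<open>
  The next notions are relative to a subalgebra \<open>L\<close>, regarded as a Lie algebra in its own
  right; the ambient Lie algebra is the case \<open>L = UNIV\<close>.
\<close>

definition lie_ideal :: "('a::real_vector \<Rightarrow> 'a \<Rightarrow> 'a) \<Rightarrow> 'a set \<Rightarrow> 'a set \<Rightarrow> bool" where
  "lie_ideal br L I \<longleftrightarrow> subspace I \<and> I \<subseteq> L \<and> (\<forall>x\<in>L. \<forall>y\<in>I. br x y \<in> I)"

primrec derived_series :: "('a::real_vector \<Rightarrow> 'a \<Rightarrow> 'a) \<Rightarrow> 'a set \<Rightarrow> nat \<Rightarrow> 'a set" where
  "derived_series br L 0 = L"
| "derived_series br L (Suc n) =
     span {br x y | x y. x \<in> derived_series br L n \<and> y \<in> derived_series br L n}"

definition lie_solvable :: "('a::real_vector \<Rightarrow> 'a \<Rightarrow> 'a) \<Rightarrow> 'a set \<Rightarrow> bool" where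
  "lie_solvable br L \<longleftrightarrow> (\<exists>n. derived_series br L n = {0})"

definition is_lie_radical :: "('a::real_vector \<Rightarrow> 'a \<Rightarrow> 'a) \<Rightarrow> 'a set \<Rightarrow> 'a set \<Rightarrow> bool" where
  "is_lie_radical br L R \<longleftrightarrow> lie_ideal br L R \<and> lie_solvable br R \<and>
     (\<forall>I. lie_ideal br L I \<and> lie_solvable br I \<longrightarrow> I \<subseteq> R)"

text \<open>The description is well defined in finite dimension: see \<open>lie_radical_is_radical\<close>.\<close>

definition lie_radical :: "('a::real_vector \<Rightarrow> 'a \<Rightarrow> 'a) \<Rightarrow> 'a set \<Rightarrow> 'a set" where
  "lie_radical br L = (THE R. is_lie_radical br L R)"

definition lie_semisimple :: "('a::real_vector \<Rightarrow> 'a \<Rightarrow> 'a) \<Rightarrow> 'a set \<Rightarrow> bool" where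
  "lie_semisimple br L \<longleftrightarrow> lie_radical br L = {0}"

definition levi_subalgebra :: "('a::real_vector \<Rightarrow> 'a \<Rightarrow> 'a) \<Rightarrow> 'a set \<Rightarrow> bool" where
  "levi_subalgebra br L \<longleftrightarrow> lie_subalgebra br L \<and> lie_semisimple br L \<and>
     L \<inter> lie_radical br UNIV = {0} \<and>
     {x + y | x y. x \<in> L \<and> y \<in> lie_radical br UNIV} = UNIV"

definition lie_derivation :: "('a::real_vector \<Rightarrow> 'a \<Rightarrow> 'a) \<Rightarrow> ('a \<Rightarrow> 'a) \<Rightarrow> bool" where
  "lie_derivation br D \<longleftrightarrow> linear D \<and> (\<forall>x y. D (br x y) = br (D x) y + br x (D y))"

text \<open>
  Lie algebra homomorphisms from a Lie algebra with bracket \<open>bra\<close> into the derivations of one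
  with bracket \<open>brg\<close>; the vector space structure on derivations is pointwise and their bracket
  is the commutator.
\<close>

definition lie_hom_into_derivations ::
  "('h::real_vector \<Rightarrow> 'h \<Rightarrow> 'h) \<Rightarrow> ('a::real_vector \<Rightarrow> 'a \<Rightarrow> 'a) \<Rightarrow> ('h \<Rightarrow> 'a \<Rightarrow> 'a) \<Rightarrow> bool" where
  "lie_hom_into_derivations bra brg \<delta> \<longleftrightarrow>
     (\<forall>H. lie_derivation brg (\<delta> H)) \<and>
     (\<forall>x. linear (\<lambda>H. \<delta> H x)) \<and>
     (\<forall>H K x. \<delta> (bra H K) x = \<delta> H (\<delta> K x) - \<delta> K (\<delta> H x))"

text \<open>
  The complexification of a real vector space is modelled on pairs, \<open>(x, y)\<close> standing for
  \<open>x + i y\<close>.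
\<close>

definition cplx_scale :: "complex \<Rightarrow> 'a::real_vector \<times> 'a \<Rightarrow> 'a \<times> 'a" where
  "cplx_scale c p = (Re c *\<^sub>R fst p - Im c *\<^sub>R snd p, Im c *\<^sub>R fst p + Re c *\<^sub>R snd p)"

global_interpretation cplx: vector_space "cplx_scale :: complex \<Rightarrow> 'a::real_vector \<times> 'a \<Rightarrow> 'a \<times> 'a"
  defines cplx_span = cplx.span
    and cplx_dependent = cplx.dependent
  by unfold_locales (auto simp: cplx_scale_def algebra_simps)

definition complexify :: "('a \<Rightarrow> 'a) \<Rightarrow> 'a \<times> 'a \<Rightarrow> 'a \<times> 'a" where
  "complexify T = map_prod T T"

definition cplx_diagonalisable :: "('a::real_vector \<times> 'a \<Rightarrow> 'a \<times> 'a) \<Rightarrow> bool" where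
  "cplx_diagonalisable T \<longleftrightarrow>
     (\<exists>B. \<not> cplx_dependent B \<and> cplx_span B = UNIV \<and> (\<forall>b\<in>B. \<exists>c. T b = cplx_scale c b))"

definition semisimple_endo :: "('a::real_vector \<Rightarrow> 'a) \<Rightarrow> bool" where
  "semisimple_endo T \<longleftrightarrow> linear T \<and> cplx_diagonalisable (complexify T)"

lemma finite_dim_lie_radical_exists:
  fixes br :: "'a::real_vector \<Rightarrow> 'a \<Rightarrow> 'a"
  assumes "lie_algebra br" and fin: "finite_dim (UNIV :: 'a set)" and L: "lie_subalgebra br L"
  shows "\<exists>R. is_lie_radical br L R"
proof -
  interpret lie_algebra br by fact
  have add_l: "br (x + y) z = br x z + br y z" and add_r: "br z (x + y) = br z x + br z y" for x y z
    using bilinear_br by (auto simp: bilinear_ladd bilinear_radd)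
  have zero: "br 0 x = 0" "br x 0 = 0" for x
    using bilinear_br by (auto simp: bilinear_lzero bilinear_rzero)
  have anti: "br x y = - br y x" for x y
  proof -
    have "br (x + y) (x + y) = br x y + br y x"
      unfolding add_l add_r by (simp add: br_self)
    then show ?thesis by (simp add: br_self eq_neg_iff_add_eq_0)
  qed
  have zero_ideal: "lie_ideal br L {0}"
    using L by (auto simp: lie_ideal_def lie_subalgebra_def zero subspace_0)
  have zero_solv: "lie_solvable br {0}"
    unfolding lie_solvable_def by (rule exI[of _ 0]) simp
  have ds_sub: "subspace (derived_series br I n)" if "subspace I" for I n
    using that by (cases n) auto
  have sum_ideal: "lie_ideal br L {x + y | x y. x \<in> I \<and> y \<in> J}"
    if I: "lie_ideal br L I" and J: "lie_ideal br L J" for I J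
  proof -
    have "subspace {x + y | x y. x \<in> I \<and> y \<in> J}"
      using I J by (intro subspace_sums) (auto simp: lie_ideal_def)
    moreover have "{x + y | x y. x \<in> I \<and> y \<in> J} \<subseteq> L"
      using I J L by (auto simp: lie_ideal_def lie_subalgebra_def intro!: subspace_add)
    moreover have "br z (x + y) \<in> {x + y | x y. x \<in> I \<and> y \<in> J}"
      if "z \<in> L" "x \<in> I" "y \<in> J" for x y z
      using I J that unfolding lie_ideal_def add_r by blast
    ultimately show ?thesis unfolding lie_ideal_def by blast
  qed
  have sum_solv: "lie_solvable br {x + y | x y. x \<in> I \<and> y \<in> J}"
    if I: "lie_ideal br L I" and J: "lie_ideal br L J"
      and sI: "lie_solvable br I" and sJ: "lie_solvable br J" for I J
  proof -
    let ?S = "{x + y | x y. x \<in> I \<and> y \<in> J}"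
    have subI: "subspace I" and subJ: "subspace J"
      using I J by (auto simp: lie_ideal_def)
    have JL: "br x y \<in> J" "br y x \<in> J" if "x \<in> L" "y \<in> J" for x y
      using J that anti[of y x] subspace_neg[OF subJ] by (auto simp: lie_ideal_def)
    have subS: "subspace ?S" using subI subJ by (rule subspace_sums)
    have dI: "derived_series br I k \<subseteq> I" for k
    proof (induction k)
      case (Suc k)
      have "br x y \<in> I" if "x \<in> derived_series br I k" "y \<in> derived_series br I k" for x y
        using that Suc I unfolding lie_ideal_def by blast
      then show ?case
        by (simp only: derived_series.simps(2)) (rule span_minimal[OF _ subI], blast)
    qed simp
    have step1: "derived_series br ?S k \<subseteq> {x + y | x y. x \<in> derived_series br I k \<and> y \<in> J}" for k
    proof (induction k)
      case (Suc k)
      let ?T = "{x + y | x y. x \<in> derived_series br I (Suc k) \<and> y \<in> J}"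
      have "subspace ?T" using ds_sub[OF subI] subJ by (rule subspace_sums)
      moreover have "br u v \<in> ?T"
        if uv: "u \<in> derived_series br ?S k" "v \<in> derived_series br ?S k" for u v
      proof -
        obtain x y where u: "u = x + y" "x \<in> derived_series br I k" "y \<in> J"
          using Suc uv(1) by blast
        obtain x' y' where v: "v = x' + y'" "x' \<in> derived_series br I k" "y' \<in> J"
          using Suc uv(2) by blast
        have xL: "x \<in> L" "x' \<in> L" and yL: "y \<in> L"
          using u v dI I J by (auto simp: lie_ideal_def)
        have "br x x' \<in> derived_series br I (Suc k)"
          using u v by (auto intro: span_base)
        moreover have "br x y' + (br y x' + br y y') \<in> J"
          using JL xL yL u v by (intro subspace_add[OF subJ]) auto
        moreover have "br u v = br x x' + (br x y' + (br y x' + br y y'))"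
          using u v by (simp add: add_l add_r)
        ultimately show ?thesis by blast
      qed
      ultimately show ?case
        unfolding derived_series.simps(2)[of br ?S] by (intro span_minimal) blast+
    qed simp
    obtain m n where m: "derived_series br I m = {0}" and n: "derived_series br J n = {0}"
      using sI sJ by (auto simp: lie_solvable_def)
    have step2: "derived_series br ?S (m + k) \<subseteq> derived_series br J k" for k
    proof (induction k)
      case 0
      then show ?case using step1[of m] m by auto
    next
      case (Suc k)
      then show ?case
        by (simp only: add_Suc_right derived_series.simps(2)) (rule span_mono, blast)
    qed
    have "derived_series br ?S (m + n) = {0}"
    proof
      show "derived_series br ?S (m + n) \<subseteq> {0}" using step2[of n] by (simp only: n)
      show "{0} \<subseteq> derived_series br ?S (m + n)"
        using subspace_0[OF ds_sub[OF subS, of "m + n"]] by (simp only: insert_subset empty_subsetI)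
    qed
    then show ?thesis by (auto simp: lie_solvable_def)
  qed
  obtain B0 where B0: "finite B0" "span B0 = (UNIV :: 'a set)"
    using fin by (auto simp: finite_dim_def)
  obtain B where B': "B \<subseteq> B0" "independent B" "B0 \<subseteq> span B"
    using maximal_independent_subset[of B0] by metis
  have B: "finite B" "independent B" "span B = (UNIV :: 'a set)"
    using B' B0 finite_subset[of B B0] span_minimal[of B0 "span B"] by auto
  interpret fd: finite_dimensional_vector_space scaleR B
    using B by unfold_locales (auto simp: dependent_raw_def span_raw_def)
  let ?P = "\<lambda>I. lie_ideal br L I \<and> lie_solvable br I"
  have P0: "?P {0}" using zero_ideal zero_solv by blast
  have bound: "\<forall>I. ?P I \<longrightarrow> dim I < Suc fd.dimension"
    using fd.dim_subset_UNIV by (simp add: less_Suc_eq_le dim_raw_def)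
  obtain R where R: "?P R" and max: "\<And>I. ?P I \<Longrightarrow> dim I \<le> dim R"
    using ex_has_greatest_nat[of ?P "{0}" dim, OF P0 bound] by blast
  have "I \<subseteq> R" if I: "?P I" for I
  proof -
    let ?S = "{x + y | x y. x \<in> R \<and> y \<in> I}"
    have S: "?P ?S" using sum_ideal sum_solv R I by blast
    have sub: "subspace R" "subspace I" "subspace ?S"
      using R I S by (simp_all only: lie_ideal_def)
    have RS: "R \<subseteq> ?S"
    proof
      fix x assume "x \<in> R"
      moreover have "x = x + 0" by simp
      ultimately show "x \<in> ?S" using subspace_0[OF sub(2)] by blast
    qed
    have IS: "I \<subseteq> ?S"
    proof
      fix x assume "x \<in> I"
      moreover have "x = 0 + x" by simp
      ultimately show "x \<in> ?S" using subspace_0[OF sub(1)] by blast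
    qed
    have "R = ?S"
      using sub RS max[OF S] fd.subspace_dim_equal[of R ?S]
      by (simp only: dim_raw_def subspace_raw_def)
    with IS show ?thesis by simp
  qed
  with R show ?thesis unfolding is_lie_radical_def by blast
qed

lemma lie_radical_is_radical:
  fixes br :: "'a::real_vector \<Rightarrow> 'a \<Rightarrow> 'a"
  assumes "lie_algebra br" and "finite_dim (UNIV :: 'a set)" and "lie_subalgebra br L"
  shows "is_lie_radical br L (lie_radical br L)"
proof -
  obtain R where R: "is_lie_radical br L R"
    using finite_dim_lie_radical_exists[OF assms] by blast
  show ?thesis unfolding lie_radical_def
    by (rule theI[where a = R]) (use R in \<open>unfold is_lie_radical_def, blast+\<close>)
qed

end

theory Submission
  imports Defs "HOL-Computational_Algebra.Computational_Algebra" "HOL-Computational_Algebra.Field_as_Ring"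
    "HOL-Library.Function_Algebras"
begin

text \<open>
  Levi's theorem is a descent through subalgebras \<open>H\<close> with
  \<open>H + rad = UNIV\<close>: one step replaces \<open>K = H \<inter> rad\<close> by a smaller ideal \<open>K'\<close> of \<open>H\<close> containing \<open>[K, K]\<close>, and
  amounts to a derivation \<open>p : H \<rightarrow> K / K'\<close> that is the identity on \<open>K / K'\<close>; the kernel of \<open>p\<close> is the next
  subalgebra. For irreducible \<open>K / K'\<close> such a \<open>p\<close> comes from a Casimir operator, whose existence rests on
  Cartan's criterion.

  For the equivariant version take \<open>K' = [K, K]\<close>, which is stable under derivations. The maps \<open>p\<close> that are
  derivations modulo \<open>K'\<close> and multiplication by some scalar \<open>c\<close> on \<open>K / K'\<close> form a vector space on which
  the commuting operators \<open>p \<mapsto> \<delta> p - p \<delta>\<close> act semisimply and kill the functional \<open>p \<mapsto> c\<close>. Hence there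
  is a \<open>p\<close> with \<open>c = 1\<close> commuting with all \<open>\<delta>\<close>, and its kernel is invariant.
\<close>

section \<open>Projections and traces\<close>

text \<open>An irreducible quotient of the kind that the Casimir argument needs may fail to be
  stable under the \<delta>, while the stable layer K / [K, K] may fail to be irreducible. The two
  demands are therefore separated: inside each stable \<open>H\<close> an ordinary Levi complement
  \<open>L\<close> is built by irreducible layers, the projection to \<open>K\<close> along
  \<open>L\<close> is a splitting of the stable layer, and only this one map is made equivariant.

  A semisimple \<delta> may have no real eigenvector. With T p = \<delta> p - p \<delta>, a real
  polynomial g with g(0) = 1 and T (g(T) p) = 0 replaces the projection to an eigenspace; as T p has
  scalar 0, g(T) p still has scalar 1. Complex numbers enter only in showing that T T p = 0 forces T
  p = 0, and in Cartan's argument, where conjugation takes the place of the usual rational-linear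
  functional on the eigenvalues.

  A quotient by \<open>S\<close> is represented by a linear \<open>q\<close> with kernel
  \<open>S\<close> and \<open>x - q x\<close> in \<open>S\<close>, or by congruences modulo
  \<open>S\<close>.\<close>

lemma projection_along:
  fixes S :: "'a::real_vector set"
  assumes "subspace S"
  shows "\<exists>q. linear q \<and> (\<forall>x\<in>S. q x = 0) \<and> (\<forall>x. x - q x \<in> S)"
proof -
  obtain B where B: "B \<subseteq> S" "independent B" "S \<subseteq> span B"
    using maximal_independent_subset[of S] by metis
  define B' where "B' = extend_basis B"
  have B': "B \<subseteq> B'" "independent B'" "span B' = UNIV"
    using B by (simp_all add: B'_def extend_basis_superset independent_extend_basis)
  obtain q where q: "linear q" "\<forall>x\<in>B'. q x = (if x \<in> B then 0 else x)"
    using linear_independent_extend[OF B'(2), of "\<lambda>x. if x \<in> B then 0 else x"] by auto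
  have "q x = 0" if "x \<in> S" for x
  proof -
    have "x \<in> span B" using that B by blast
    moreover have "q b = 0" if "b \<in> B" for b using that q B' by auto
    ultimately show ?thesis using linear_eq_0_on_span[OF q(1), of B x] by blast
  qed
  moreover have "x - q x \<in> S" for x
  proof -
    have "x \<in> span B'" using B' by simp
    then show ?thesis
    proof (induction rule: span_induct_alt)
      case base
      then show ?case using q assms by (simp add: linear_0 subspace_0)
    next
      case (step c x y)
      have "x - q x \<in> S" using q step B assms by (auto simp: subspace_0)
      then have "c *\<^sub>R (x - q x) + (y - q y) \<in> S"
        using step assms by (simp add: subspace_add subspace_scale)
      moreover have "c *\<^sub>R x + y - q (c *\<^sub>R x + y) = c *\<^sub>R (x - q x) + (y - q y)"
        using q by (simp add: linear_add linear_scale algebra_simps)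
      ultimately show ?case by (simp only:)
    qed
  qed
  ultimately show ?thesis using q by blast
qed

lemma projection_onto:
  fixes S :: "'a::real_vector set"
  assumes "subspace S"
  shows "\<exists>p. linear p \<and> (\<forall>x\<in>S. p x = x) \<and> (\<forall>x. p x \<in> S)"
proof -
  obtain q where q: "linear q" "\<forall>x\<in>S. q x = 0" "\<forall>x. x - q x \<in> S"
    using projection_along[OF assms] by blast
  show ?thesis
    by (rule exI[of _ "\<lambda>x. x - q x"]) (use q in \<open>auto intro!: linear_compose_sub linear_id[unfolded id_def]\<close>)
qed

lemma projection_onto_along:
  fixes S T :: "'a::real_vector set"
  assumes "subspace S" "subspace T" "S \<inter> T = {0}"
  shows "\<exists>p. linear p \<and> (\<forall>x\<in>S. p x = x) \<and> (\<forall>x\<in>T. p x = 0) \<and> (\<forall>x. p x \<in> S)"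
proof -
  obtain q where q: "linear q" "\<forall>x\<in>T. q x = 0" "\<forall>x. x - q x \<in> T"
    using projection_along[OF assms(2)] by blast
  have "inj_on q S"
  proof (rule inj_onI)
    fix x y assume xy: "x \<in> S" "y \<in> S" "q x = q y"
    have "q (x - y) = 0" using xy q by (simp add: linear_diff)
    then have "x - y \<in> T" using q(3) by (metis diff_0_right)
    moreover have "x - y \<in> S" using xy assms by (simp add: subspace_diff)
    ultimately have "x - y \<in> {0}" using assms(3) by blast
    then show "x = y" by simp
  qed
  then obtain g where g: "range g \<subseteq> S" "linear g" "\<forall>v\<in>S. g (q v) = v"
    using linear_exists_left_inverse_on[OF q(1) assms(1)] by blast
  show ?thesis
    by (rule exI[of _ "g \<circ> q"]) (use q g in \<open>auto simp: linear_0 intro: linear_compose\<close>)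
qed

text \<open>A linear section \<open>r\<close> of the quotient by \<open>R\<close> with values in
  \<open>H\<close> does everything except fix \<open>H\<close>. For \<open>x\<close> in
  \<open>H\<close> the error \<open>x - r x\<close> lies in \<open>H \<inter> R\<close>, so adding
  its projection \<open>w\<close> to that subspace repairs it and changes nothing modulo
  \<open>R\<close>.\<close>

lemma projection_onto_mod:
  fixes H R :: "'a::real_vector set"
  assumes H: "subspace H" and R: "subspace R" and sum: "\<And>x. \<exists>h\<in>H. x - h \<in> R"
  shows "\<exists>p. linear p \<and> (\<forall>x. p x \<in> H) \<and> (\<forall>x. x - p x \<in> R) \<and> (\<forall>x\<in>H. p x = x)"
proof -
  obtain q where q: "linear q" "\<forall>x\<in>R. q x = 0" "\<forall>x. x - q x \<in> R"
    using projection_along[OF R] by blast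
  obtain w where w: "linear w" "\<forall>x\<in>H \<inter> R. w x = x" "\<forall>x. w x \<in> H \<inter> R"
    using projection_onto[of "H \<inter> R"] H R by (meson subspace_inter)
  have q0: "x \<in> R" if "q x = 0" for x using q(3) that by (metis diff_0_right)
  obtain g where g: "range g \<subseteq> H" "linear g" "\<forall>v\<in>q ` H. q (g v) = v"
    using linear_exists_right_inverse_on[OF q(1) H] by blast
  define r where "r x = g (q x)" for x
  have linr: "linear r" using linear_compose[OF q(1) g(2)] by (simp add: r_def[abs_def] o_def)
  have rH: "r x \<in> H" for x using g(1) by (auto simp: r_def)
  have rR: "x - r x \<in> R" for x
  proof (rule q0)
    obtain h where h: "h \<in> H" "x - h \<in> R" using sum by blast
    then have "q x = q h" using q(1,2) by (metis eq_iff_diff_eq_0 linear_diff)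
    then show "q (x - r x) = 0" using g(3) h(1) by (simp add: r_def linear_diff[OF q(1)])
  qed
  show ?thesis
  proof (intro exI[of _ "\<lambda>x. r x + w (x - r x)"] conjI allI ballI)
    show "linear (\<lambda>x. r x + w (x - r x))"
      using linear_compose[OF linear_compose_sub[OF linear_id linr] w(1)] linr
      by (intro linear_compose_add) (simp_all add: o_def)
    show "r x + w (x - r x) \<in> H" for x using subspace_add[OF H rH] w(3) by blast
    show "x - (r x + w (x - r x)) \<in> R" for x
      using subspace_diff[OF R rR, of "w (x - r x)" x] w(3) by (simp add: diff_diff_eq)
    show "r x + w (x - r x) = x" if "x \<in> H" for x
      using w(2) rR subspace_diff[OF H that rH] by auto
  qed
qed

lemma fd_basis:
  assumes "finite_dim (UNIV :: 'a::real_vector set)"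
  shows "\<exists>B::'a set. finite B \<and> independent B \<and> span B = UNIV"
proof -
  obtain B0 where B0: "finite B0" "span B0 = (UNIV :: 'a set)"
    using assms by (auto simp: finite_dim_def)
  obtain B where B': "B \<subseteq> B0" "independent B" "B0 \<subseteq> span B"
    using maximal_independent_subset[of B0] by metis
  show ?thesis
    by (rule exI[of _ B]) (use B' B0 finite_subset[of B B0] span_minimal[of B0 "span B"] in auto)
qed

lemma dim_subset_fd:
  assumes "finite_dim (UNIV :: 'a::real_vector set)" "S \<subseteq> (T::'a set)"
  shows "dim S \<le> dim T"
proof -
  obtain B where B: "finite B" "independent B" "span B = (UNIV :: 'a set)"
    using fd_basis[OF assms(1)] by blast
  interpret fd: finite_dimensional_vector_space scaleR B
    using B by unfold_locales (auto simp: dependent_raw_def span_raw_def)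
  show ?thesis using fd.dim_subset[OF assms(2)] by (simp add: dim_raw_def)
qed

lemma subspace_dim_equal_fd:
  assumes "finite_dim (UNIV :: 'a::real_vector set)" "subspace (S::'a set)" "subspace T" "S \<subseteq> T" "dim T \<le> dim S"
  shows "S = T"
proof -
  obtain B where B: "finite B" "independent B" "span B = (UNIV :: 'a set)"
    using fd_basis[OF assms(1)] by blast
  interpret fd: finite_dimensional_vector_space scaleR B
    using B by unfold_locales (auto simp: dependent_raw_def span_raw_def)
  show ?thesis using fd.subspace_dim_equal[of S T] assms by (simp add: dim_raw_def subspace_raw_def)
qed

lemma subspace_dim_less_fd:
  assumes "finite_dim (UNIV :: 'a::real_vector set)" "subspace (S::'a set)" "subspace T" "S \<subset> T"
  shows "dim S < dim T"
proof (rule ccontr)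
  assume "\<not> dim S < dim T"
  then show False using subspace_dim_equal_fd[OF assms(1-3)] assms(4) by auto
qed

lemma finite_basis_subspace_fd:
  assumes "finite_dim (UNIV :: 'a::real_vector set)" "subspace (S::'a set)"
  shows "\<exists>B. finite B \<and> B \<subseteq> S \<and> independent B \<and> span B = S \<and> card B = dim S"
proof -
  obtain B where B: "B \<subseteq> S" "independent B" "S \<subseteq> span B" "card B = dim S"
    using basis_exists[of S] by metis
  obtain C where "finite C" "span C = (UNIV::'a set)" using fd_basis[OF assms(1)] by blast
  then have "finite B" using independent_span_bound[of C B] B by auto
  moreover have "span B = S" using B assms(2) by (simp add: span_minimal subset_antisym)
  ultimately show ?thesis using B by blast
qed

lemma exists_max_dim_fd:
  assumes "finite_dim (UNIV :: 'a::real_vector set)" "P S"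
  shows "\<exists>M::'a set. P M \<and> (\<forall>N. P N \<longrightarrow> dim N \<le> dim M)"
proof -
  have "\<forall>N. P N \<longrightarrow> dim N < Suc (dim (UNIV::'a set))"
    using dim_subset_fd[OF assms(1)] by (simp add: less_Suc_eq_le)
  then show ?thesis using ex_has_greatest_nat[of P S dim] assms(2) by blast
qed

section \<open>Traces\<close>

definition trace_of :: "('a::real_vector \<Rightarrow> 'a) \<Rightarrow> real" where
  "trace_of T = (let B = (SOME B. finite B \<and> independent B \<and> span B = UNIV)
     in \<Sum>b\<in>B. representation B (T b) b)"

text \<open>The expansion may use any vectors and functionals, not only dual bases. This makes
  \<open>trace_of\<close> independent of the chosen basis and lets traces be read off from whichever
  expansion is at hand.\<close>

lemma trace_finite_rank:
  assumes fd: "finite_dim (UNIV :: 'a::real_vector set)"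
    and T: "\<And>v::'a. T v = (\<Sum>i\<in>I. f i v *\<^sub>R w i)" and f: "\<And>i. i \<in> I \<Longrightarrow> linear (f i)"
  shows "trace_of T = (\<Sum>i\<in>I. f i (w i))"
proof -
  define B where "B = (SOME B::'a set. finite B \<and> independent B \<and> span B = UNIV)"
  have B: "finite B" "independent B" "span B = UNIV"
    using someI_ex[OF fd_basis[OF fd]] unfolding B_def by blast+
  have "trace_of T = (\<Sum>b\<in>B. representation B (\<Sum>i\<in>I. f i b *\<^sub>R w i) b)"
    unfolding trace_of_def Let_def B_def[symmetric] by (simp add: T)
  also have "\<dots> = (\<Sum>b\<in>B. \<Sum>i\<in>I. f i b * representation B (w i) b)"
    using B by (simp add: representation_sum representation_scale)
  also have "\<dots> = (\<Sum>i\<in>I. \<Sum>b\<in>B. f i b * representation B (w i) b)"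
    by (rule sum.swap)
  also have "\<dots> = (\<Sum>i\<in>I. f i (\<Sum>b\<in>B. representation B (w i) b *\<^sub>R b))"
    by (rule sum.cong) (auto simp: linear_sum[OF f] linear_scale[OF f] mult.commute)
  also have "\<dots> = (\<Sum>i\<in>I. f i (w i))"
    using B by (simp add: sum_representation_eq)
  finally show ?thesis .
qed

lemma basis_expansion_fd:
  assumes fd: "finite_dim (UNIV :: 'a::real_vector set)" and S: "subspace (S::'a set)"
  shows "\<exists>B \<phi>. finite B \<and> B \<subseteq> S \<and> independent B \<and> span B = S \<and> (\<forall>b. linear (\<phi> b)) \<and> (\<forall>v\<in>S. (\<Sum>b\<in>B. \<phi> b v *\<^sub>R b) = v)
    \<and> (\<forall>b\<in>B. \<forall>c\<in>B. \<phi> b c = (if b = c then 1 else 0::real)) \<and> card B = dim S"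
proof -
  obtain B where B: "finite B" "B \<subseteq> S" "independent B" "span B = S" "card B = dim S"
    using finite_basis_subspace_fd[OF assms] by blast
  have "\<forall>b. \<exists>g. linear g \<and> (\<forall>x\<in>B. g x = (if b = x then 1 else 0::real))"
    using linear_independent_extend[OF B(3), of "\<lambda>x. if _ = x then 1 else 0::real"] by blast
  from choice[OF this] obtain \<phi> where
    \<phi>: "\<And>b. linear (\<phi> b)" "\<And>b x. x \<in> B \<Longrightarrow> \<phi> b x = (if b = x then 1 else 0::real)"
    by auto
  have "(\<Sum>b\<in>B. \<phi> b v *\<^sub>R b) = v" if "v \<in> S" for v
  proof -
    have "v \<in> span B" using that B by simp
    then show ?thesis
    proof (induction rule: span_induct_alt)
      case base then show ?case using \<phi> by (simp add: linear_0)
    next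
      case (step c x y)
      have "(\<Sum>b\<in>B. \<phi> b x *\<^sub>R b) = (\<Sum>b\<in>B. if b = x then b else 0)"
        using step by (intro sum.cong) (auto simp: \<phi>)
      also have "\<dots> = x" using step B by simp
      finally have "(\<Sum>b\<in>B. \<phi> b (c *\<^sub>R x + y) *\<^sub>R b) = c *\<^sub>R x + (\<Sum>b\<in>B. \<phi> b y *\<^sub>R b)"
        by (simp add: linear_add[OF \<phi>(1)] linear_scale[OF \<phi>(1)] scaleR_add_left sum.distrib
            flip: scaleR_sum_right scaleR_scaleR)
      then show ?case using step by simp
    qed
  qed
  then show ?thesis using B \<phi> by (intro exI[of _ B] exI[of _ \<phi>]) simp
qed

lemma trace_comm:
  assumes fd: "finite_dim (UNIV :: 'a::real_vector set)" and S: "linear (S::'a\<Rightarrow>'a)" and T: "linear T"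
  shows "trace_of (\<lambda>v. S (T v)) = trace_of (\<lambda>v. T (S v))"
proof -
  obtain B \<phi> where B: "\<And>b. linear (\<phi> b)" "\<And>v::'a. (\<Sum>b\<in>B. \<phi> b v *\<^sub>R b) = v"
    using basis_expansion_fd[OF fd subspace_UNIV] by blast
  have "trace_of (\<lambda>v. S (T v)) = (\<Sum>b\<in>B. \<phi> b (T (S b)))"
  proof (rule trace_finite_rank[OF fd, where f = "\<lambda>b v. \<phi> b (T v)"])
    show "S (T v) = (\<Sum>b\<in>B. \<phi> b (T v) *\<^sub>R S b)" for v
      using arg_cong[OF B(2)[of "T v"], of S] by (simp add: linear_sum[OF S] linear_scale[OF S] del: B(2))
    show "linear (\<lambda>v. \<phi> b (T v))" for b using linear_compose[OF T B(1)] by (simp add: o_def)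
  qed
  moreover have "trace_of (\<lambda>v. T (S v)) = (\<Sum>b\<in>B. \<phi> b (T (S b)))"
  proof (rule trace_finite_rank[OF fd, where f = "\<lambda>b v. \<phi> b (T (S v))"])
    show "T (S v) = (\<Sum>b\<in>B. \<phi> b (T (S v)) *\<^sub>R b)" for v using B(2)[of "T (S v)"] by simp
    show "linear (\<lambda>v. \<phi> b (T (S v)))" for b
      using linear_compose[OF S linear_compose[OF T B(1)]] by (simp add: o_def)
  qed
  ultimately show ?thesis by simp
qed

lemma trace_add:
  assumes fd: "finite_dim (UNIV :: 'a::real_vector set)" and S: "linear (S::'a\<Rightarrow>'a)" and T: "linear T"
  shows "trace_of (\<lambda>v. S v + T v) = trace_of S + trace_of T"
proof -
  define B where "B = (SOME B::'a set. finite B \<and> independent B \<and> span B = UNIV)"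
  have B: "finite B" "independent B" "span B = UNIV"
    using someI_ex[OF fd_basis[OF fd]] unfolding B_def by blast+
  show ?thesis unfolding trace_of_def Let_def B_def[symmetric] using B
    by (simp add: representation_add sum.distrib)
qed

lemma trace_scale:
  assumes fd: "finite_dim (UNIV :: 'a::real_vector set)"
  shows "trace_of (\<lambda>v::'a. c *\<^sub>R T v) = c * trace_of T"
proof -
  define B where "B = (SOME B::'a set. finite B \<and> independent B \<and> span B = UNIV)"
  have B: "finite B" "independent B" "span B = UNIV"
    using someI_ex[OF fd_basis[OF fd]] unfolding B_def by blast+
  show ?thesis unfolding trace_of_def Let_def B_def[symmetric] using B
    by (simp add: representation_scale sum_distrib_left)
qed

lemma trace_zero:
  assumes fd: "finite_dim (UNIV :: 'a::real_vector set)"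
  shows "trace_of (\<lambda>v::'a. 0) = 0"
  using trace_scale[OF fd, of 0 "\<lambda>v. 0"] by simp

lemma trace_diff:
  assumes fd: "finite_dim (UNIV :: 'a::real_vector set)" and S: "linear (S::'a\<Rightarrow>'a)" and T: "linear T"
  shows "trace_of (\<lambda>v. S v - T v) = trace_of S - trace_of T"
proof -
  have "trace_of (\<lambda>v. S v + (- 1) *\<^sub>R T v) = trace_of S + trace_of (\<lambda>v. (-1) *\<^sub>R T v)"
    by (rule trace_add[OF fd S]) (use T in \<open>simp add: linear_compose_neg\<close>)
  then show ?thesis by (simp only: trace_scale[OF fd]) simp
qed

lemma trace_sum:
  assumes fd: "finite_dim (UNIV :: 'a::real_vector set)" and S: "\<And>i. i \<in> I \<Longrightarrow> linear (S i::'a\<Rightarrow>'a)"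
  shows "trace_of (\<lambda>v. \<Sum>i\<in>I. S i v) = (\<Sum>i\<in>I. trace_of (S i))"
  using S
proof (induction I rule: infinite_finite_induct)
  case (insert i I)
  then show ?case by (simp add: trace_add[OF fd _ linear_compose_sum] eta_contract_eq)
qed (simp_all add: trace_zero[OF fd])

lemma trace_idempotent:
  assumes fd: "finite_dim (UNIV :: 'a::real_vector set)" and E: "linear (E::'a\<Rightarrow>'a)" and idem: "\<And>v. E (E v) = E v"
  shows "trace_of E = real (dim (range E))"
proof -
  have "subspace (range E)" using E by (simp add: linear_subspace_image)
  then obtain B \<phi> where B: "finite B" "B \<subseteq> range E" "\<forall>b. linear (\<phi> b)"
      "\<forall>v\<in>range E. (\<Sum>b\<in>B. \<phi> b v *\<^sub>R b) = v"
      "\<forall>b\<in>B. \<forall>c\<in>B. \<phi> b c = (if b = c then 1 else 0::real)" "card B = dim (range E)"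
    using basis_expansion_fd[OF fd, of "range E"] by blast
  have "trace_of E = (\<Sum>b\<in>B. \<phi> b (E b))"
  proof (rule trace_finite_rank[OF fd, where f = "\<lambda>b v. \<phi> b (E v)"])
    show "E v = (\<Sum>b\<in>B. \<phi> b (E v) *\<^sub>R b)" for v using B by auto
    show "linear (\<lambda>v. \<phi> b (E v))" for b using linear_compose[OF E, of "\<phi> b"] B by (simp add: o_def)
  qed
  also have "\<dots> = (\<Sum>b\<in>B. 1)"
  proof (rule sum.cong)
    fix b assume "b \<in> B"
    then have "E b = b" using B idem by auto
    then show "\<phi> b (E b) = 1" using B \<open>b \<in> B\<close> by auto
  qed simp
  finally show ?thesis using B by simp
qed

text \<open>\<open>P k\<close> projects to the range of \<open>N ^^ k\<close>, which
  \<open>N\<close> maps into the next range. Hence N P_k = P_(k+1) N P_k, and cyclicity of the trace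
  turns this into N P_(k+1); after \<open>m\<close> steps the projection is zero.\<close>

lemma trace_nilpotent:
  assumes fd: "finite_dim (UNIV :: 'a::real_vector set)" and N: "linear (N::'a\<Rightarrow>'a)" and nil: "\<And>v. (N ^^ m) v = 0"
  shows "trace_of N = 0"
proof -
  have lin: "linear (N ^^ k)" for k 
  proof (induction k)
    case 0
    show ?case by (simp add: linear_id[unfolded id_def])
  next
    case (Suc k)
    then show ?case using linear_compose[OF Suc N] by (simp add: o_def)
  qed
  have sub: "subspace (range (N ^^ k))" for k using lin by (simp add: linear_subspace_image)
  have "\<forall>k. \<exists>p. linear p \<and> (\<forall>x\<in>range (N ^^ k). p x = x) \<and> (\<forall>x. p x \<in> range (N^^k))"
    using projection_onto[OF sub] by blast
  then obtain P where P: "\<And>k. linear (P k)" "\<And>k x. x\<in>range (N ^^ k) \<Longrightarrow> P k x = x" "\<And>k x. P k x \<in> range (N^^k)"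
    by metis
  have *: "trace_of N = trace_of (\<lambda>v. N (P k v))" for k
  proof (induction k)
    case 0
    then show ?case by (simp add: P(2))
  next
    case (Suc k)
    have 1: "N (P k v) = P (Suc k) (N (P k v))" for v
    proof -
      obtain w where "P k v = (N ^^ k) w" using P(3)[of k v] by auto
      then have "N (P k v) = (N ^^ Suc k) w" by simp
      then show ?thesis using P(2)[of "N (P k v)" "Suc k"] by (metis rangeI)
    qed
    have 2: "P k (P (Suc k) v) = P (Suc k) v" for v
    proof (rule P(2))
      obtain w where "P (Suc k) v = (N ^^ Suc k) w" using P(3)[of "Suc k" v] by auto
      then have "P (Suc k) v = (N ^^ k) (N w)" by (simp add: funpow_swap1)
      then show "P (Suc k) v \<in> range (N ^^ k)" by blast
    qed
    have "trace_of (\<lambda>v. N (P k v)) = trace_of (\<lambda>v. P (Suc k) (N (P k v)))" using 1 by simp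
    also have "\<dots> = trace_of (\<lambda>v. N (P k (P (Suc k) v)))"
      using trace_comm[OF fd P(1)[of "Suc k"] linear_compose[OF P(1)[of k] N]] by (simp add: o_def)
    finally show ?case using Suc 2 by simp
  qed
  have "P m v = 0" for v using P(3)[of m v] nil by auto
  then show ?thesis using *[of m] trace_zero[OF fd] by (simp add: linear_0[OF N])
qed

lemma linear_inj_on_surj_fd:
  assumes fd: "finite_dim (UNIV :: 'a::real_vector set)" and M: "subspace (M::'a set)"
    and f: "linear f" "f ` M \<subseteq> M" and inj: "\<And>x. x \<in> M \<Longrightarrow> f x = 0 \<Longrightarrow> x = 0"
  shows "\<exists>g. linear g \<and> (\<forall>x. g x \<in> M) \<and> (\<forall>x\<in>M. g (f x) = x \<and> f (g x) = x)"
proof -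
  have i: "inj_on f M"
    using inj M f by (intro inj_onI) (metis eq_iff_diff_eq_0 linear_diff subspace_diff)
  obtain B where B: "finite B" "B \<subseteq> M" "independent B" "span B = M" "card B = dim M"
    using finite_basis_subspace_fd[OF fd M] by blast
  have "independent (f ` B)"
    using linear_independent_injective_image[OF f(1) B(3)] i B by simp
  then have "dim (f ` M) = card (f ` B)"
    using dim_eq_card[of "f ` B" "f ` M"] B f by (metis linear_span_image span_span)
  moreover have "card (f ` B) = card B" using i B by (meson card_image inj_on_subset)
  ultimately have s: "f ` M = M"
    using subspace_dim_equal_fd[OF fd, of "f ` M" M] f M B by (simp add: linear_subspace_image)
  obtain g where g: "range g \<subseteq> M" "linear g" "\<forall>v\<in>M. g (f v) = v"
    using linear_exists_left_inverse_on[OF f(1) M i] by blast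
  have "f (g x) = x" if "x \<in> M" for x using that s g by (metis imageE)
  then show ?thesis using g by blast
qed

text \<open>\<open>\<Phi>\<close> records the values of \<open>\<beta>\<close> against a basis
  \<open>E\<close>. Nondegeneracy makes it injective, hence bijective on \<open>M\<close>, and
  \<open>f\<close> is its inverse.\<close>

lemma dual_basis_fd:
  assumes fd: "finite_dim (UNIV :: 'a::real_vector set)" and M: "subspace (M::'a set)"
    and \<beta>: "bilinear (\<beta> :: 'a \<Rightarrow> 'a \<Rightarrow> real)"
    and nondeg: "\<And>y. y \<in> M \<Longrightarrow> (\<And>x. x \<in> M \<Longrightarrow> \<beta> x y = 0) \<Longrightarrow> y = 0"
  shows "\<exists>E f. finite E \<and> E \<subseteq> M \<and> f ` E \<subseteq> M \<and> card E = dim M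
    \<and> (\<forall>d\<in>E. \<forall>e\<in>E. \<beta> d (f e) = (if d = e then 1 else 0))
    \<and> (\<forall>y\<in>M. y = (\<Sum>e\<in>E. \<beta> y (f e) *\<^sub>R e)) \<and> (\<forall>y\<in>M. y = (\<Sum>e\<in>E. \<beta> e y *\<^sub>R f e))"
proof -
  obtain E \<phi> where E: "finite E" "E \<subseteq> M" "span E = M" "\<forall>b. linear (\<phi> b)"
      "\<forall>v\<in>M. (\<Sum>b\<in>E. \<phi> b v *\<^sub>R b) = v"
      "\<forall>b\<in>E. \<forall>c\<in>E. \<phi> b c = (if b = c then 1 else 0::real)" "card E = dim M"
    using basis_expansion_fd[OF fd M] by blast
  define \<Phi> where "\<Phi> y = (\<Sum>e\<in>E. \<beta> e y *\<^sub>R e)" for y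
  have lin: "linear \<Phi>" unfolding \<Phi>_def
    by (rule linearI) (simp_all add: bilinear_radd[OF \<beta>] bilinear_rmul[OF \<beta>] scaleR_add_left sum.distrib scaleR_sum_right)
  have coef: "\<phi> d (\<Phi> y) = \<beta> d y" if "d \<in> E" for d y
  proof -
    have "\<phi> d (\<Phi> y) = (\<Sum>e\<in>E. \<beta> e y * \<phi> d e)"
      unfolding \<Phi>_def using E by (simp add: linear_sum linear_scale)
    also have "\<dots> = (\<Sum>e\<in>E. if d = e then \<beta> e y else 0)"
      using E that by (intro sum.cong) auto
    finally show ?thesis using that E by simp
  qed
  have \<Phi>M: "\<Phi> y \<in> M" for y unfolding \<Phi>_def using E M by (auto intro!: subspace_sum subspace_scale)
  have inj: "y = 0" if "y \<in> M" "\<Phi> y = 0" for y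
  proof (rule nondeg[OF that(1)])
    fix x assume "x \<in> M"
    have "\<beta> e y = 0" if "e \<in> E" for e
      using coef[OF that, of y] \<open>\<Phi> y = 0\<close> E by (simp add: linear_0)
    moreover have "\<beta> x y = (\<Sum>b\<in>E. \<phi> b x * \<beta> b y)"
    proof -
      have l: "linear (\<lambda>x. \<beta> x y)" using \<beta> by (simp add: bilinear_def)
      have "\<beta> x y = \<beta> (\<Sum>b\<in>E. \<phi> b x *\<^sub>R b) y" using E \<open>x \<in> M\<close> by simp
      then show ?thesis using linear_sum[OF l, of "\<lambda>b. \<phi> b x *\<^sub>R b" E]
        by (simp add: bilinear_lmul[OF \<beta>])
    qed
    ultimately show "\<beta> x y = 0" by simp
  qed
  obtain g where g: "linear g" "\<forall>x. g x \<in> M" "\<forall>x\<in>M. g (\<Phi> x) = x \<and> \<Phi> (g x) = x"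
    using linear_inj_on_surj_fd[OF fd M lin _ inj] \<Phi>M by blast
  have dual: "\<beta> d (g e) = (if d = e then 1 else 0)" if "d \<in> E" "e \<in> E" for d e
    using coef[OF that(1), of "g e"] g E that by (metis subsetD)
  have ex1: "y = (\<Sum>e\<in>E. \<beta> y (g e) *\<^sub>R e)" if "y \<in> M" for y
  proof -
    have "\<beta> y (g e) = \<phi> e y" if e: "e \<in> E" for e
    proof -
      have l: "linear (\<lambda>x. \<beta> x (g e))" using \<beta> by (simp add: bilinear_def)
      have "\<beta> y (g e) = \<beta> (\<Sum>b\<in>E. \<phi> b y *\<^sub>R b) (g e)" using E \<open>y \<in> M\<close> by simp
      also have "\<dots> = (\<Sum>b\<in>E. \<phi> b y * \<beta> b (g e))"
        using linear_sum[OF l, of "\<lambda>b. \<phi> b y *\<^sub>R b" E] by (simp add: bilinear_lmul[OF \<beta>])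
      also have "\<dots> = (\<Sum>b\<in>E. if b = e then \<phi> b y else 0)"
        using e dual by (intro sum.cong) auto
      finally show ?thesis using e E by simp
    qed
    then show ?thesis using E that by simp
  qed
  have ex2: "y = (\<Sum>e\<in>E. \<beta> e y *\<^sub>R g e)" if "y \<in> M" for y
  proof -
    have "y = g (\<Phi> y)" using g that by simp
    then show ?thesis unfolding \<Phi>_def by (simp add: linear_sum[OF g(1)] linear_scale[OF g(1)])
  qed
  show ?thesis
    by (rule exI[of _ E], rule exI[of _ g]) (use E g dual ex1 ex2 in auto)
qed

section \<open>Polynomials in an endomorphism\<close>

text \<open>Kept general in field and space because \<open>T\<close> is a complexified operator in
  one use, and in the others a commutator operator on a space of maps, complex or real.\<close>

locale vs_endomorphism = vector_space scale
  for scale :: "'k::field \<Rightarrow> 'b::ab_group_add \<Rightarrow> 'b" +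
  fixes T :: "'b \<Rightarrow> 'b"
  assumes T_add: "T (x + y) = T x + T y" and T_scale: "T (scale c x) = scale c (T x)"
begin

lemma T_zero [simp]: "T 0 = 0"
  using T_scale[of 0 0] by simp

definition pact :: "'k poly \<Rightarrow> 'b \<Rightarrow> 'b" where
  "pact p = fold_coeffs (\<lambda>a f v. scale a v + T (f v)) p (\<lambda>_. 0)"

lemma pact_0 [simp]: "pact 0 v = 0"
  by (simp add: pact_def)

lemma pact_pCons [simp]: "pact (pCons a p) v = scale a v + T (pact p v)"
  by (cases "p = 0 \<and> a = 0") (auto simp: pact_def)

lemma pact_1 [simp]: "pact 1 v = v"
  by (simp add: one_pCons)

lemma pact_add: "pact (p + q) v = pact p v + pact q v"
  by (induction p q rule: poly_induct2) (simp_all add: T_add algebra_simps)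

lemma pact_smult: "pact (smult c p) v = scale c (pact p v)"
  by (induction p) (simp_all add: T_scale algebra_simps)

lemma pact_T: "pact p (T v) = T (pact p v)"
  by (induction p) (simp_all add: T_scale T_add)

lemma pact_mult: "pact (p * q) v = pact p (pact q v)"
  by (induction p) (simp_all add: pact_add pact_smult)

lemma pact_add_right: "pact p (v + w) = pact p v + pact p w"
  by (induction p) (simp_all add: T_add algebra_simps)

lemma pact_zero_right [simp]: "pact p 0 = 0"
  by (induction p) simp_all

lemma pact_scale: "pact p (scale c v) = scale c (pact p v)"
  by (induction p) (simp_all add: T_scale algebra_simps)

lemma pact_sum_right: "pact p (\<Sum>i\<in>I. f i) = (\<Sum>i\<in>I. pact p (f i))"
  by (induction I rule: infinite_finite_induct) (simp_all add: pact_add_right)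

lemma pact_sum: "pact (\<Sum>i\<in>I. p i) v = (\<Sum>i\<in>I. pact (p i) v)"
  by (induction I rule: infinite_finite_induct) (simp_all add: pact_add)

lemma pact_diff: "pact (p - q) v = pact p v - pact q v"
  using pact_add[of "p - q" q v] by simp

lemma pact_monom: "pact (monom c n) v = scale c ((T ^^ n) v)"
  by (induction n) (simp_all add: monom_0 monom_Suc T_scale)

lemma pact_dvd_zero: "p dvd q \<Longrightarrow> pact p v = 0 \<Longrightarrow> pact q v = 0"
  by (auto simp: dvd_def pact_mult mult.commute[of p])

lemma pact_in_subspace:
  assumes "subspace L" "\<And>x. x \<in> L \<Longrightarrow> T x \<in> L" "v \<in> L"
  shows "pact p v \<in> L"
  using assms by (induction p) (auto intro: subspace_add subspace_scale subspace_0)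

lemma pact_linear_factor_power: "pact ([:- c, 1:] ^ n) v = ((\<lambda>x. T x - scale c x) ^^ n) v"
proof (induction n)
  case (Suc n)
  have "pact [:- c, 1:] w = T w - scale c w" for w by simp
  then show ?case using Suc by (simp only: power_Suc pact_mult) simp
qed simp

lemma exists_annihilating_poly:
  assumes fin: "finite S" and in_span: "\<And>i. (T ^^ i) v \<in> span S"
  shows "\<exists>p. p \<noteq> 0 \<and> pact p v = 0"
proof -
  define n where "n = card S"
  define f where "f i = (T ^^ i) v" for i
  show ?thesis
  proof (cases "inj_on f {..n}")
    \<comment> \<open>Dependence below is a property of the set of iterates, so a repeated iterate
      is treated apart; it is annihilated through X^i - X^j.\<close>
    case False
    then obtain i j where ij: "i \<noteq> j" "f i = f j" by (auto simp: inj_on_def)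
    have "pact (monom 1 i - monom 1 j) v = 0" using ij by (simp add: pact_diff pact_monom f_def)
    moreover have "coeff (monom 1 i - monom 1 j :: 'k poly) i = 1" using ij by simp
    ultimately show ?thesis by (metis coeff_0 zero_neq_one)
  next
    case True
    have "card (f ` {..n}) = Suc n" using True by (simp add: card_image)
    moreover have "f ` {..n} \<subseteq> span S" using in_span by (auto simp: f_def)
    ultimately have "dependent (f ` {..n})"
      using independent_span_bound[OF fin, of "f ` {..n}"] n_def by auto
    then obtain u where u: "\<exists>w\<in>f ` {..n}. u w \<noteq> 0" "(\<Sum>w\<in>f ` {..n}. scale (u w) w) = 0"
      using dependent_finite[of "f ` {..n}"] by auto
    define p where "p = (\<Sum>i\<le>n. monom (u (f i)) i)"
    have "pact p v = (\<Sum>i\<le>n. scale (u (f i)) (f i))"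
      by (simp add: p_def pact_sum pact_monom f_def)
    also have "\<dots> = 0" using u(2) True by (simp add: sum.reindex)
    finally have "pact p v = 0" .
    moreover obtain i where "i \<le> n" "u (f i) \<noteq> 0" using u(1) by auto
    then have "coeff p i \<noteq> 0" by (simp add: p_def coeff_sum)
    then have "p \<noteq> 0" by auto
    ultimately show ?thesis by blast
  qed
qed

lemma exists_annihilating_poly_all:
  assumes fin: "finite S" and S: "span S = UNIV"
  shows "\<exists>p. p \<noteq> 0 \<and> (\<forall>v. pact p v = 0)"
proof -
  have "\<forall>v. \<exists>p. p \<noteq> 0 \<and> pact p v = 0"
    using exists_annihilating_poly[OF fin] S by simp
  then obtain P where P: "\<And>v. P v \<noteq> 0" "\<And>v. pact (P v) v = 0" by metis
  define p where "p = (\<Prod>v\<in>S. P v)"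
  have "pact p v = 0" for v
  proof -
    have "v \<in> span S" using S by simp
    then show ?thesis
    proof (induction rule: span_induct_alt)
      case (step c x y)
      have "P x dvd p" unfolding p_def using step fin by (intro dvd_prodI) auto
      then have "pact p x = 0" using P(2) by (rule pact_dvd_zero)
      then show ?case using step by (simp add: pact_add_right pact_scale)
    qed simp
  qed
  moreover have "p \<noteq> 0" using fin P by (simp add: p_def)
  ultimately show ?thesis by blast
qed

end

lemma linear_factors_coprime:
  fixes a b :: complex
  assumes "a \<noteq> b"
  shows "coprime ([:- a, 1:] ^ m) ([:- b, 1:] ^ n)"
proof -
  have "coprime [:- a, 1:] [:- b, 1:]"
  proof (rule coprimeI)
    fix c assume c: "c dvd [:- a, 1:]" "c dvd [:- b, 1:]"
    have "c dvd [:- a, 1:] - [:- b, 1:]" using c by (rule dvd_diff)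
    then have "c dvd [:b - a:]" by simp
    moreover have "[:b - a:] dvd 1" using assms by (intro is_unit_triv) simp
    ultimately show "is_unit c" by (rule dvd_trans)
  qed
  then show ?thesis by simp
qed

lemma prod_linear_factors_dvd:
  fixes q :: "complex poly"
  assumes "finite \<Lambda>" "\<And>c. c \<in> \<Lambda> \<Longrightarrow> [:- c, 1:] ^ m dvd q"
  shows "(\<Prod>c\<in>\<Lambda>. [:- c, 1:] ^ m) dvd q"
  using assms
proof (induction \<Lambda> rule: finite_induct)
  case (insert c \<Lambda>)
  have "coprime ([:- c, 1:] ^ m) (\<Prod>c\<in>\<Lambda>. [:- c, 1:] ^ m)"
    using insert.hyps by (intro prod_coprime_right linear_factors_coprime) auto
  then show ?case using insert by (simp add: divides_mult)
qed simp

text \<open>Chinese remainders through Bezout. At an operator annihilated by the product of the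
  factors, \<open>r c\<close> evaluates to the projection onto the generalised eigenspace of
  \<open>c\<close>.\<close>

lemma poly_crt_idempotents:
  fixes \<Lambda> :: "complex set"
  assumes fin: "finite \<Lambda>"
  shows "\<exists>r. \<forall>c\<in>\<Lambda>. [:- c, 1:] ^ m dvd (1 - r c) \<and> (\<forall>d\<in>\<Lambda> - {c}. [:- d, 1:] ^ m dvd r c)"
proof -
  have "\<exists>r. [:- c, 1:] ^ m dvd (1 - r) \<and> (\<forall>d\<in>\<Lambda> - {c}. [:- d, 1:] ^ m dvd r)" for c
  proof -
    let ?a = "[:- c, 1:] ^ m" and ?b = "\<Prod>d\<in>\<Lambda> - {c}. [:- d, 1:] ^ m"
    have "coprime ?a ?b" by (intro prod_coprime_right linear_factors_coprime) auto
    then obtain x y where xy: "x * ?a + y * ?b = 1"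
      using bezout_coefficients_fst_snd[of ?a ?b] by (auto simp: coprime_iff_gcd_eq_1)
    have "1 - y * ?b = x * ?a" using xy by (metis add_diff_cancel_right')
    moreover have "[:- d, 1:] ^ m dvd y * ?b" if "d \<in> \<Lambda> - {c}" for d
      using that fin by (intro dvd_mult dvd_prodI) auto
    ultimately show ?thesis by (intro exI[of _ "y * ?b"]) auto
  qed
  then show ?thesis by metis
qed

context vs_endomorphism
begin

text \<open>Each generalised eigencomponent is thus a polynomial in \<open>T\<close> applied to the
  whole sum, and lies in every \<open>T\<close>-stable subspace that contains the sum.\<close>

lemma pact_complex_components:
  fixes \<Lambda> :: "'k set"
  assumes r: "\<forall>c\<in>\<Lambda>. [:- c, 1:] ^ m dvd (1 - r c) \<and> (\<forall>d\<in>\<Lambda> - {c}. [:- d, 1:] ^ m dvd r c)"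
    and fin: "finite \<Lambda>" and kill: "\<And>c. c \<in> \<Lambda> \<Longrightarrow> pact ([:- c, 1:] ^ m) (v c) = 0" and c: "c \<in> \<Lambda>"
  shows "pact (r c) (\<Sum>d\<in>\<Lambda>. v d) = v c"
proof -
  have "pact (r c) (v d) = (if d = c then v c else 0)" if "d \<in> \<Lambda>" for d
  proof (cases "d = c")
    case True
    have "pact (1 - r c) (v c) = 0" using r c kill[OF c] by (blast intro: pact_dvd_zero)
    then show ?thesis using True by (simp add: pact_diff)
  next
    case False
    then show ?thesis using r c kill[OF that] that by (auto intro: pact_dvd_zero)
  qed
  then have "pact (r c) (\<Sum>d\<in>\<Lambda>. v d) = (\<Sum>d\<in>\<Lambda>. if d = c then v c else 0)"
    unfolding pact_sum_right by (rule sum.cong[OF refl])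
  then show ?thesis using fin c by simp
qed

end

text \<open>By induction on \<open>a + b\<close>: \<open>A f\<close> needs one power of
  \<open>A\<close> fewer and \<open>B f\<close> one power of \<open>B\<close> fewer, so
  \<open>a + b - 1\<close> powers of the difference kill both, and hence kill
  \<open>A f - B f\<close>. Nilpotency is asked at the single vector \<open>f\<close> only.\<close>

lemma power_diff_commuting_nilpotent:
  fixes A B :: "'b::ab_group_add \<Rightarrow> 'b"
  assumes A: "\<And>x y. A (x + y) = A x + A y" and B: "\<And>x y. B (x + y) = B x + B y"
    and AB: "\<And>x. A (B x) = B (A x)"
    and "(A ^^ a) f = 0" "(B ^^ b) f = 0"
  shows "((\<lambda>x. A x - B x) ^^ (a + b)) f = 0"
  using assms(4,5)
proof (induction "a + b" arbitrary: a b f)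
  case 0
  then show ?case by simp
next
  case (Suc n)
  define C where "C = (\<lambda>x. A x - B x)"
  have A0: "A 0 = 0" and B0: "B 0 = 0" using A[of 0 0] B[of 0 0] by simp_all
  have Adiff: "A (x - y) = A x - A y" and Bdiff: "B (x - y) = B x - B y" for x y
    using A[of "x - y" y] B[of "x - y" y] by simp_all
  have Cdiff: "C (x - y) = C x - C y" for x y by (simp add: C_def Adiff Bdiff)
  have Cn: "(C ^^ k) (x - y) = (C ^^ k) x - (C ^^ k) y" for k x y
    by (induction k) (simp_all add: Cdiff)
  have C0: "(C ^^ k) 0 = 0" for k using Cn[of k 0 0] by simp
  have BA: "(B ^^ k) (A x) = A ((B ^^ k) x)" and AB': "(A ^^ k) (B x) = B ((A ^^ k) x)" for k x
    by (induction k) (simp_all add: AB)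
  show ?case
  proof (cases "a = 0 \<or> b = 0")
    case True
    then have "f = 0" using Suc.prems by auto
    then show ?thesis using C0 by (simp add: C_def)
  next
    case False
    then obtain a' b' where ab: "a = Suc a'" "b = Suc b'" by (meson not0_implies_Suc)
    have "(C ^^ n) (A f) = 0"
    proof -
      have "(B ^^ b) (A f) = 0" using BA[of b f] Suc.prems(2) A0 by simp
      moreover have "(A ^^ a') (A f) = 0" using Suc.prems(1) ab by (simp add: funpow_swap1)
      ultimately show ?thesis using Suc.hyps(1)[of a' b "A f"] Suc.hyps(2) ab by (simp add: C_def)
    qed
    moreover have "(C ^^ n) (B f) = 0"
    proof -
      have "(A ^^ a) (B f) = 0" using AB'[of a f] Suc.prems(1) B0 by simp
      moreover have "(B ^^ b') (B f) = 0" using Suc.prems(2) ab by (simp add: funpow_swap1)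
      ultimately show ?thesis using Suc.hyps(1)[of a b' "B f"] Suc.hyps(2) ab by (simp add: C_def)
    qed
    ultimately have "(C ^^ n) (C f) = 0" using Cn[of n "A f" "B f"] by (simp add: C_def)
    then have "(C ^^ Suc n) f = 0" by (simp add: funpow_swap1)
    then show ?thesis using Suc.hyps(2) by (simp add: C_def)
  qed
qed

section \<open>Complexified spaces and operators\<close>

lemma finite_dim_prod:
  assumes "finite_dim (UNIV :: 'v::real_vector set)"
  shows "finite_dim (UNIV :: ('v \<times> 'v) set)"
proof -
  obtain B :: "'v set" where B: "finite B" "span B = UNIV" using fd_basis[OF assms] by blast
  let ?C = "(\<lambda>b. (b, 0)) ` B \<union> (\<lambda>b. (0, b)) ` B"
  have l: "linear (\<lambda>b::'v. (b, 0::'v))" "linear (\<lambda>b::'v. (0::'v, b))"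
    by (auto intro!: linearI)
  have "(x, y) \<in> span ?C" for x y :: 'v
  proof -
    have "(x, 0::'v) \<in> span ((\<lambda>b. (b, 0)) ` B)" unfolding linear_span_image[OF l(1), of B] B by simp
    moreover have "(0::'v, y) \<in> span ((\<lambda>b. (0, b)) ` B)" unfolding linear_span_image[OF l(2), of B] B by simp
    ultimately have "(x, 0) + (0, y) \<in> span ?C"
      by (intro span_add) (meson span_mono subsetD sup_ge1 sup_ge2)+
    then show ?thesis by simp
  qed
  then show ?thesis unfolding finite_dim_def using B by (intro exI[of _ ?C]) auto
qed

text \<open>\<open>trace_of\<close> on pairs is the real trace, that is, twice the real part of the
  complex trace. The complexification of a real operator has real complex trace, so a factor \<i>
  makes the real trace vanish.\<close>

lemma trace_complexify:
  fixes T :: "'v::real_vector \<Rightarrow> 'v"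
  assumes fd: "finite_dim (UNIV :: 'v set)" and T: "linear T"
  shows "trace_of (complexify T) = 2 * trace_of T"
    and "trace_of (\<lambda>v. cplx_scale \<i> (complexify T v)) = 0"
proof -
  note fdw = finite_dim_prod[OF fd]
  obtain B \<phi> where B: "\<And>b. linear (\<phi> b)" "\<And>v::'v. (\<Sum>b\<in>B. \<phi> b v *\<^sub>R b) = v"
    using basis_expansion_fd[OF fd subspace_UNIV] by blast
  have Tv: "T v = (\<Sum>b\<in>B. \<phi> b v *\<^sub>R T b)" for v
    using arg_cong[OF B(2)[of v], of T] by (simp only: linear_sum[OF T] linear_scale[OF T])
  have trT: "trace_of T = (\<Sum>b\<in>B. \<phi> b (T b))"
    by (rule trace_finite_rank[OF fd Tv B(1)])
  have lfst: "linear (\<lambda>v::'v\<times>'v. \<phi> b (fst v))" and lsnd: "linear (\<lambda>v::'v\<times>'v. \<phi> b (snd v))" for b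
    using linear_compose[OF linear_fst B(1)] linear_compose[OF linear_snd B(1)] by (simp_all add: o_def)
  have lT: "linear (\<lambda>v::'v\<times>'v. T (fst v))" "linear (\<lambda>v::'v\<times>'v. T (snd v))"
    using linear_compose[OF linear_fst T] linear_compose[OF linear_snd T] by (simp_all add: o_def)
  have lp1: "linear (\<lambda>v. (g v, 0::'v))" and lp2: "linear (\<lambda>v. (0::'v, g v))" if "linear g" for g :: "'v \<times> 'v \<Rightarrow> 'v"
    by (rule linearI; simp only: linear_add[OF that] linear_scale[OF that]; simp)+
  have pair: "(\<Sum>b\<in>B. \<phi> b x *\<^sub>R (T b, 0::'v)) = (T x, 0)" "(\<Sum>b\<in>B. \<phi> b x *\<^sub>R (0::'v, T b)) = (0, T x)" for x
    by (simp_all add: Tv[of x, symmetric] sum_prod)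
  have t1: "trace_of (\<lambda>v. (T (fst v), 0::'v)) = trace_of T"
    using trace_finite_rank[OF fdw, of "\<lambda>v. (T (fst v), 0::'v)" "\<lambda>b v. \<phi> b (fst v)" "\<lambda>b. (T b, 0)" B] pair lfst trT by simp
  have t2: "trace_of (\<lambda>v. (0::'v, T (snd v))) = trace_of T"
    using trace_finite_rank[OF fdw, of "\<lambda>v. (0::'v, T (snd v))" "\<lambda>b v. \<phi> b (snd v)" "\<lambda>b. (0, T b)" B] pair lsnd trT by simp
  have t3: "trace_of (\<lambda>v. (T (snd v), 0::'v)) = 0"
    using trace_finite_rank[OF fdw, of "\<lambda>v. (T (snd v), 0::'v)" "\<lambda>b v. \<phi> b (snd v)" "\<lambda>b. (T b, 0)" B] pair lsnd by (simp add: linear_0[OF B(1)])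
  have t4: "trace_of (\<lambda>v. (0::'v, T (fst v))) = 0"
    using trace_finite_rank[OF fdw, of "\<lambda>v. (0::'v, T (fst v))" "\<lambda>b v. \<phi> b (fst v)" "\<lambda>b. (0, T b)" B] pair lfst by (simp add: linear_0[OF B(1)])
  have "complexify T = (\<lambda>v. (T (fst v), 0) + (0, T (snd v)))"
    by (auto simp: complexify_def map_prod_def)
  then show "trace_of (complexify T) = 2 * trace_of T"
    using trace_add[OF fdw lp1[OF lT(1)] lp2[OF lT(2)]] t1 t2 by simp
  have "(\<lambda>v. cplx_scale \<i> (complexify T v)) = (\<lambda>v. (0, T (fst v)) - (T (snd v), 0))"
    by (auto simp: complexify_def cplx_scale_def map_prod_def)
  then show "trace_of (\<lambda>v. cplx_scale \<i> (complexify T v)) = 0"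
    using trace_diff[OF fdw lp2[OF lT(1)] lp1[OF lT(2)]] t3 t4 by simp
qed

definition opscale :: "complex \<Rightarrow> ('v::real_vector \<times> 'v \<Rightarrow> 'v \<times> 'v) \<Rightarrow> ('v \<times> 'v \<Rightarrow> 'v \<times> 'v)" where
  "opscale c f = (\<lambda>v. cplx_scale c (f v))"

lemma vector_space_opscale: "vector_space (opscale :: complex \<Rightarrow> ('v::real_vector \<times> 'v \<Rightarrow> 'v \<times> 'v) \<Rightarrow> _)"
  by unfold_locales (auto simp: opscale_def fun_eq_iff cplx.scale_right_distrib cplx.scale_left_distrib)

lemma cplx_scale_of_real: "cplx_scale (complex_of_real a) v = a *\<^sub>R v"
  by (simp add: cplx_scale_def prod_eq_iff)

lemma linear_cplx_scale: "linear (cplx_scale c)"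
  by (rule linearI) (simp_all add: cplx_scale_def algebra_simps)

lemma complexify_cplx_scale: "linear T \<Longrightarrow> complexify T (cplx_scale c v) = cplx_scale c (complexify T v)"
  by (simp add: complexify_def cplx_scale_def linear_add linear_diff linear_scale map_prod_def split: prod.split)

lemma linear_complexify: "linear T \<Longrightarrow> linear (complexify T)"
  by (rule linearI) (simp_all add: complexify_def linear_add linear_scale map_prod_def split: prod.split)

lemma cplx_finite_span:
  assumes "finite_dim (UNIV :: 'v::real_vector set)"
  shows "\<exists>S::('v \<times> 'v) set. finite S \<and> cplx.span S = UNIV"
proof -
  obtain B :: "'v set" where B: "finite B" "span B = UNIV" using fd_basis[OF assms] by blast
  have 1: "(x, 0) \<in> cplx.span ((\<lambda>b. (b, 0)) ` B)" for x :: 'v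
  proof -
    have "x \<in> span B" using B by simp
    then show ?thesis
    proof (induction rule: span_induct_alt)
      case base
      then show ?case using cplx.span_zero[of "(\<lambda>b. (b, 0)) ` B"] by (simp add: zero_prod_def)
    next
      case (step c x y)
      have "cplx_scale (complex_of_real c) (x, 0) + (y, 0) \<in> cplx.span ((\<lambda>b. (b, 0)) ` B)"
        using step(1) by (intro cplx.span_add[OF cplx.span_scale[OF cplx.span_base] step(2)]) auto
      then show ?case by (simp add: cplx_scale_of_real)
    qed
  qed
  have "v \<in> cplx.span ((\<lambda>b. (b, 0)) ` B)" for v :: "'v \<times> 'v"
  proof -
    have "v = (fst v, 0) + cplx_scale \<i> (snd v, 0)" by (simp add: cplx_scale_def prod_eq_iff)
    then show ?thesis using 1 by (metis cplx.span_add cplx.span_scale)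
  qed
  then show ?thesis using B by (intro exI[of _ "(\<lambda>b. (b, 0)) ` B"]) auto
qed

text \<open>The degree bounds all multiplicities at once. The point 0 is included even where it is
  no root, so that an idempotent at 0 exists, which Cartan's argument will show to be the
  identity.\<close>

lemma complex_poly_dvd_linear_powers:
  fixes p :: "complex poly"
  assumes "p \<noteq> 0"
  shows "\<exists>\<Lambda> m. finite \<Lambda> \<and> 0 \<in> \<Lambda> \<and> p dvd (\<Prod>c\<in>\<Lambda>. [:- c, 1:] ^ Suc m)"
proof -
  let ?R = "{z. poly p z = 0}"
  have fin: "finite ?R" using assms by (rule poly_roots_finite)
  define q where "q = (\<Prod>c\<in>?R. [:- c, 1:] ^ order c p)"
  have p: "smult (lead_coeff p) q = p" unfolding q_def by (rule complex_poly_decompose)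
  have "q dvd (\<Prod>c\<in>?R. [:- c, 1:] ^ Suc (degree p))"
    unfolding q_def using order_degree[OF assms] by (intro prod_dvd_prod le_imp_power_dvd) (simp add: le_SucI)
  also have "\<dots> dvd (\<Prod>c\<in>insert 0 ?R. [:- c, 1:] ^ Suc (degree p))"
    using fin by (intro prod_dvd_prod_subset) auto
  finally have "q dvd (\<Prod>c\<in>insert 0 ?R. [:- c, 1:] ^ Suc (degree p))" .
  moreover have "p dvd q" using p assms by (metis dvd_refl leading_coeff_0_iff smult_dvd_iff)
  ultimately show ?thesis using fin by (intro exI[of _ "insert 0 ?R"] exI[of _ "degree p"]) (auto intro: dvd_trans)
qed

section \<open>Cartan's trace argument\<close>

text \<open>
  Complex-linear spectral idempotents \<open>e c\<close>, \<open>c \<in> \<Lambda>\<close>, of the complexification of \<open>X0\<close>; \<open>\<Lambda>\<close> may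
  be larger than the spectrum, so \<open>e c\<close> may vanish.
\<close>

definition spectral_family ::
  "('v::real_vector \<Rightarrow> 'v) \<Rightarrow> complex set \<Rightarrow> nat \<Rightarrow> (complex \<Rightarrow> 'v \<times> 'v \<Rightarrow> 'v \<times> 'v) \<Rightarrow> bool" where
  "spectral_family X0 \<Lambda> m e \<longleftrightarrow> finite \<Lambda> \<and>
    (\<forall>c. linear (e c) \<and> (\<forall>v. e c (complexify X0 v) = complexify X0 (e c v)) \<and>
      (\<forall>a v. e c (cplx_scale a v) = cplx_scale a (e c v))) \<and>
    (\<forall>v. (\<Sum>c\<in>\<Lambda>. e c v) = v) \<and> (\<forall>c\<in>\<Lambda>. \<forall>v. e c (e c v) = e c v) \<and>
    (\<forall>c\<in>\<Lambda>. \<forall>v. ((\<lambda>x. complexify X0 x - cplx_scale c x) ^^ m) (e c v) = 0)"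

lemma spectral_familyD:
  assumes "spectral_family X0 \<Lambda> m e"
  shows "finite \<Lambda>" and "linear (e c)" and "e c (complexify X0 v) = complexify X0 (e c v)"
    and "e c (cplx_scale a v) = cplx_scale a (e c v)" and "(\<Sum>c\<in>\<Lambda>. e c v) = v"
    and "c \<in> \<Lambda> \<Longrightarrow> e c (e c v) = e c v"
    and "c \<in> \<Lambda> \<Longrightarrow> ((\<lambda>x. complexify X0 x - cplx_scale c x) ^^ m) (e c v) = 0"
  using assms unfolding spectral_family_def by blast+

text \<open>\<open>e c\<close> is the remainder polynomial \<open>r c\<close> evaluated at the
  operator. Each required identity reduces to a polynomial being divisible by the annihilating
  product, which \<open>kill\<close> lets one check factor by factor.\<close>

lemma complexify_spectral_idempotents:
  fixes X0 :: "'v::real_vector \<Rightarrow> 'v"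
  assumes fd: "finite_dim (UNIV :: 'v set)" and X0: "linear X0"
  shows "\<exists>\<Lambda> m e. 0 \<in> \<Lambda> \<and> spectral_family X0 \<Lambda> m e"
proof -
  let ?X = "complexify X0"
  interpret V: vs_endomorphism cplx_scale ?X
    by unfold_locales (simp_all add: linear_add[OF linear_complexify[OF X0]] complexify_cplx_scale[OF X0]
        cplx.scale_right_distrib cplx.scale_left_distrib)
  obtain S :: "('v \<times> 'v) set" where "finite S" "cplx.span S = UNIV" using cplx_finite_span[OF fd] by blast
  then obtain p where p: "p \<noteq> 0" "\<And>v. V.pact p v = 0"
    using V.exists_annihilating_poly_all[of S] unfolding cplx_span_def by metis
  obtain \<Lambda> m' where \<Lambda>: "finite \<Lambda>" "0 \<in> \<Lambda>" "p dvd (\<Prod>c\<in>\<Lambda>. [:- c, 1:] ^ Suc m')"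
    using complex_poly_dvd_linear_powers[OF p(1)] by blast
  define m where "m = Suc m'"
  have kill: "V.pact q v = 0" if "\<And>c. c \<in> \<Lambda> \<Longrightarrow> [:- c, 1:] ^ m dvd q" for q v
  proof -
    have "(\<Prod>c\<in>\<Lambda>. [:- c, 1:] ^ m) dvd q" using prod_linear_factors_dvd[OF \<Lambda>(1)] that by blast
    then have "p dvd q" using \<Lambda>(3) m_def dvd_trans by blast
    then show ?thesis using p V.pact_dvd_zero by blast
  qed
  obtain r where r: "\<forall>c\<in>\<Lambda>. [:- c, 1:] ^ m dvd (1 - r c) \<and> (\<forall>d\<in>\<Lambda> - {c}. [:- d, 1:] ^ m dvd r c)"
    using poly_crt_idempotents[OF \<Lambda>(1), of m] by blast
  define e where "e c v = V.pact (r c) v" for c v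
  have lin: "linear (e c)" for c
    by (rule linearI) (simp_all add: e_def V.pact_add_right V.pact_scale flip: cplx_scale_of_real)
  have sum: "(\<Sum>c\<in>\<Lambda>. e c v) = v" for v
  proof -
    have "V.pact ((\<Sum>c\<in>\<Lambda>. r c) - 1) v = 0"
    proof (rule kill)
      fix d assume d: "d \<in> \<Lambda>"
      have "(\<Sum>c\<in>\<Lambda>. r c) - 1 = (\<Sum>c\<in>\<Lambda>-{d}. r c) - (1 - r d)"
        using \<Lambda>(1) d by (simp add: sum.remove[of \<Lambda> d])
      also have "[:- d, 1:] ^ m dvd \<dots>"
      proof (rule dvd_diff)
        show "[:- d, 1:] ^ m dvd (\<Sum>c\<in>\<Lambda>-{d}. r c)" using r d by (intro dvd_sum) auto
        show "[:- d, 1:] ^ m dvd 1 - r d" using r d by blast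
      qed
      finally show "[:- d, 1:] ^ m dvd (\<Sum>c\<in>\<Lambda>. r c) - 1" .
    qed
    then show ?thesis by (simp add: V.pact_diff V.pact_sum e_def)
  qed
  have idem: "e c (e c v) = e c v" if c: "c \<in> \<Lambda>" for c v
  proof -
    have "V.pact (r c * (1 - r c)) v = 0"
    proof (rule kill)
      fix d assume d: "d \<in> \<Lambda>"
      show "[:- d, 1:] ^ m dvd r c * (1 - r c)"
        using r c d by (cases "d = c") auto
    qed
    then have "V.pact (r c - r c * r c) v = 0" by (simp add: right_diff_distrib)
    then show ?thesis by (simp add: e_def V.pact_diff V.pact_mult)
  qed
  have nil: "((\<lambda>x. ?X x - cplx_scale c x) ^^ m) (e c v) = 0" if c: "c \<in> \<Lambda>" for c v
  proof -
    have "V.pact ([:- c, 1:] ^ m * r c) v = 0"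
    proof (rule kill)
      fix d assume "d \<in> \<Lambda>"
      then show "[:- d, 1:] ^ m dvd [:- c, 1:] ^ m * r c" using r c by (cases "d = c") auto
    qed
    then show ?thesis by (simp only: V.pact_mult V.pact_linear_factor_power e_def)
  qed
  have "spectral_family X0 \<Lambda> m e" unfolding spectral_family_def
    using \<Lambda>(1) lin sum idem nil by (auto simp: e_def V.pact_T V.pact_scale)
  then show ?thesis using \<Lambda>(2) by blast
qed

text \<open>On the range of \<open>e c\<close> the operator is \<open>c\<close> plus a nilpotent,
  and the inner sum is multiplication by \<open>cnj c\<close>. Their product is the scalar
  \<open>(cmod c)\<^sup>2\<close> plus a nilpotent \<open>N c\<close>, which has no trace. Trace and
  dimension are the real ones.\<close>

lemma trace_complexify_cnj_spectral:
  fixes X0 :: "'v::real_vector \<Rightarrow> 'v"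
  assumes fd: "finite_dim (UNIV :: 'v set)" and X0: "linear X0" and spectral: "spectral_family X0 \<Lambda> m e"
  shows "trace_of (\<lambda>v. complexify X0 (\<Sum>c\<in>\<Lambda>. cplx_scale (cnj c) (e c v))) = (\<Sum>c\<in>\<Lambda>. (cmod c)\<^sup>2 * dim (range (e c)))"
proof -
  let ?X = "complexify X0"
  note fdw = finite_dim_prod[OF fd] and lX = linear_complexify[OF X0]
    and e = spectral_familyD(2-4)[OF spectral] and idem = spectral_familyD(6)[OF spectral]
    and nil = spectral_familyD(7)[OF spectral]
  define N where "N c = (\<lambda>v. cplx_scale (cnj c) (?X (e c v) - cplx_scale c (e c v)))" for c
  have linN: "linear (N c)" for c
    unfolding N_def by (intro linear_compose[OF _ linear_cplx_scale, unfolded o_def] linear_compose_sub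
        linear_compose[OF e(1) lX, unfolded o_def] linear_compose[OF e(1) linear_cplx_scale, unfolded o_def])
  have linE: "linear (\<lambda>v. (cmod c)\<^sup>2 *\<^sub>R e c v)" for c using e by (simp add: linear_compose_scale_right)
  have split: "?X (\<Sum>c\<in>\<Lambda>. cplx_scale (cnj c) (e c v)) = (\<Sum>c\<in>\<Lambda>. (cmod c)\<^sup>2 *\<^sub>R e c v + N c v)" for v
  proof -
    have sq: "cplx_scale (cnj c * c) u = (cmod c)\<^sup>2 *\<^sub>R u" for c and u :: "'v \<times> 'v"
      by (metis complex_norm_square cplx_scale_of_real mult.commute)
    have "?X (cplx_scale (cnj c) (e c v)) = (cmod c)\<^sup>2 *\<^sub>R e c v + N c v" for c
      by (simp add: N_def complexify_cplx_scale[OF X0] cplx.scale_right_diff_distrib sq)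
    then show ?thesis by (simp add: linear_sum[OF lX])
  qed
  have trN: "trace_of (N c) = 0" if c: "c \<in> \<Lambda>" for c
  proof -
    \<comment> \<open>The formula starts at exponent 1, since the power 0 of \<open>N c\<close> is
      the identity and lacks the factor \<open>e c\<close>.\<close>
    have "(N c ^^ Suc k) v = cplx_scale (cnj c ^ Suc k) (((\<lambda>x. ?X x - cplx_scale c x) ^^ Suc k) (e c v))" for k v
    proof (induction k)
      case (Suc k)
      define Y where "Y = (\<lambda>x. ?X x - cplx_scale c x)"
      have eY: "e c (Y x) = Y (e c x)" for x using e by (simp add: Y_def linear_diff)
      have ek: "e c ((Y ^^ j) x) = (Y ^^ j) (e c x)" for j x by (induction j) (simp_all add: eY)
      have Ys: "Y (cplx_scale a x) = cplx_scale a (Y x)" for a x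
        by (simp add: Y_def complexify_cplx_scale[OF X0] cplx.scale_right_diff_distrib mult.commute)
      have "(N c ^^ Suc (Suc k)) v = N c (cplx_scale (cnj c ^ Suc k) ((Y ^^ Suc k) (e c v)))"
        using Suc by (simp add: Y_def)
      also have "\<dots> = cplx_scale (cnj c) (Y (e c (cplx_scale (cnj c ^ Suc k) ((Y ^^ Suc k) (e c v)))))"
        by (simp add: N_def Y_def)
      also have "\<dots> = cplx_scale (cnj c) (cplx_scale (cnj c ^ Suc k) (Y ((Y ^^ Suc k) (e c v))))"
        by (simp only: e(3) ek Ys idem[OF c])
      finally show ?case by (simp add: Y_def)
    qed (simp add: N_def)
    moreover have "((\<lambda>x. ?X x - cplx_scale c x) ^^ Suc m) (e c v) = 0" for v
      using nil[OF c, of v] linear_0[OF lX] by simp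
    ultimately have "(N c ^^ Suc m) v = 0" for v by (simp only: cplx.scale_zero_right)
    then show ?thesis using trace_nilpotent[OF fdw linN] by blast
  qed
  have "trace_of (\<lambda>v. ?X (\<Sum>c\<in>\<Lambda>. cplx_scale (cnj c) (e c v))) = (\<Sum>c\<in>\<Lambda>. trace_of (\<lambda>v. (cmod c)\<^sup>2 *\<^sub>R e c v + N c v))"
    unfolding split by (rule trace_sum[OF fdw]) (use linE linN in \<open>simp add: linear_compose_add\<close>)
  also have "\<dots> = (\<Sum>c\<in>\<Lambda>. (cmod c)\<^sup>2 * dim (range (e c)))"
  proof (rule sum.cong[OF refl])
    fix c assume c: "c \<in> \<Lambda>"
    show "trace_of (\<lambda>v. (cmod c)\<^sup>2 *\<^sub>R e c v + N c v) = (cmod c)\<^sup>2 * dim (range (e c))"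
      using trace_add[OF fdw linE linN] trN[OF c] trace_scale[OF fdw, of "(cmod c)\<^sup>2" "e c"]
        trace_idempotent[OF fdw e(1) idem[OF c]] by simp
  qed
  finally show ?thesis .
qed

lemma sum_fun_apply: "(\<Sum>i\<in>I. f i) x = (\<Sum>i\<in>I. f i x)"
  by (induction I rule: infinite_finite_induct) simp_all

text \<open>Cut \<open>Z\<close> into blocks e_c Z e_d. The commutator with the operator has the
  single generalised eigenvalue \<open>c - d\<close> on such a block, while the commutator with the
  conjugate sum multiplies it by \<open>cnj c - cnj d = cnj (c - d)\<close>. This scalar depends on
  the eigenvalue \<open>c - d\<close> alone, so the result is a combination of generalised
  eigencomponents of \<open>Z\<close>, and these lie in \<open>W\<close>.\<close>

lemma commutator_cnj_spectral_mem:
  fixes X0 :: "'v::real_vector \<Rightarrow> 'v" and W :: "('v \<times> 'v \<Rightarrow> 'v \<times> 'v) set"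
  assumes X0: "linear X0" and spectral: "spectral_family X0 \<Lambda> m e"
    and W: "module.subspace opscale W"
    and ad: "\<And>f. f \<in> W \<Longrightarrow> (\<lambda>v. complexify X0 (f v) - f (complexify X0 v)) \<in> W"
    and Z: "Z \<in> W" "linear Z" "\<And>a v. Z (cplx_scale a v) = cplx_scale a (Z v)"
  shows "(\<lambda>v. (\<Sum>c\<in>\<Lambda>. cplx_scale (cnj c) (e c (Z v))) - Z (\<Sum>c\<in>\<Lambda>. cplx_scale (cnj c) (e c v))) \<in> W"
proof -
  let ?X = "complexify X0"
  note lX = linear_complexify[OF X0] and fin = spectral_familyD(1)[OF spectral]
    and e = spectral_familyD(2-4)[OF spectral] and sum = spectral_familyD(5)[OF spectral]
    and nil = spectral_familyD(7)[OF spectral]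
  interpret O: vector_space "opscale :: complex \<Rightarrow> ('v \<times> 'v \<Rightarrow> 'v \<times> 'v) \<Rightarrow> _" by (rule vector_space_opscale)
  interpret D: vs_endomorphism opscale "\<lambda>f v. ?X (f v) - f (?X v)"
    by unfold_locales (simp_all add: fun_eq_iff opscale_def linear_add[OF lX] complexify_cplx_scale[OF X0] cplx.scale_right_diff_distrib)
  define Y where "Y c d = (\<lambda>v. e c (Z (e d v)))" for c d
  have killY: "D.pact ([:- (c - d), 1:] ^ (m + m)) (Y c d) = 0" if c: "c \<in> \<Lambda>" and d: "d \<in> \<Lambda>" for c d
  proof -
    \<comment> \<open>Left multiplication by X - c and right multiplication by X - d commute and are
      nilpotent at the block; their difference is the commutator with X minus \<open>c - d\<close>.
      This gives the exponent \<open>m + m\<close>.\<close>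
    define A where "A f = (\<lambda>v. ?X (f v) - cplx_scale c (f v))" for f :: "'v \<times> 'v \<Rightarrow> 'v \<times> 'v"
    define B where "B f = (\<lambda>v. f (?X v) - cplx_scale d (f v))" for f :: "'v \<times> 'v \<Rightarrow> 'v \<times> 'v"
    have "(A ^^ k) f = (\<lambda>v. ((\<lambda>x. ?X x - cplx_scale c x) ^^ k) (f v))" for k f
      by (induction k) (simp_all add: A_def)
    then have 1: "(A ^^ m) (Y c d) = 0" using nil[OF c] by (simp add: Y_def fun_eq_iff)
    have "(B ^^ k) (Y c d) = (\<lambda>v. e c (Z (((\<lambda>x. ?X x - cplx_scale d x) ^^ k) (e d v))))" for k
    proof (induction k)
      case (Suc k)
      define U where "U = (\<lambda>x. ?X x - cplx_scale d x)"
      have UX: "U (?X x) = ?X (U x)" for x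
        by (simp add: U_def linear_diff[OF lX] complexify_cplx_scale[OF X0])
      have Uk: "(U ^^ j) (?X x) = ?X ((U ^^ j) x)" for j x by (induction j) (simp_all add: UX)
      have "(B ^^ Suc k) (Y c d) = B (\<lambda>v. e c (Z ((U ^^ k) (e d v))))" using Suc by (simp add: U_def)
      also have "\<dots> = (\<lambda>v. e c (Z (U ((U ^^ k) (e d v)))))"
        by (rule ext, simp only: B_def e(2) Uk)
          (simp add: U_def linear_diff[OF Z(2)] linear_diff[OF e(1)] Z(3) e(3))
      finally show ?case by (simp add: U_def)
    qed (simp add: Y_def)
    then have 2: "(B ^^ m) (Y c d) = 0" using nil[OF d] by (simp add: fun_eq_iff linear_0[OF Z(2)] linear_0[OF e(1)])
    have "((\<lambda>x. A x - B x) ^^ (m + m)) (Y c d) = 0"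
      by (rule power_diff_commuting_nilpotent[OF _ _ _ 1 2])
        (simp_all add: A_def B_def fun_eq_iff linear_add[OF lX] linear_diff[OF lX] complexify_cplx_scale[OF X0]
          cplx.scale_right_distrib cplx.scale_right_diff_distrib mult.commute)
    moreover have "(\<lambda>x. A x - B x) = (\<lambda>f. (\<lambda>v. ?X (f v) - f (?X v)) - opscale (c - d) f)"
      by (simp add: A_def B_def fun_eq_iff opscale_def cplx.scale_left_diff_distrib)
    ultimately show ?thesis by (simp only: D.pact_linear_factor_power)
  qed
  define \<Delta> where "\<Delta> = (\<lambda>(c, d). c - d) ` (\<Lambda> \<times> \<Lambda>)"
  have fin\<Delta>: "finite \<Delta>" using fin by (simp add: \<Delta>_def)
  \<comment> \<open>Several pairs may share a difference. Only the sum of their blocks is an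
    eigencomponent of \<open>Z\<close>; a single block need not lie in \<open>W\<close>.\<close>
  define Q where "Q \<alpha> = (\<Sum>cd\<in>{cd \<in> \<Lambda> \<times> \<Lambda>. fst cd - snd cd = \<alpha>}. Y (fst cd) (snd cd))" for \<alpha>
  have killQ: "D.pact ([:- \<alpha>, 1:] ^ (m + m)) (Q \<alpha>) = 0" for \<alpha>
    unfolding Q_def D.pact_sum_right by (rule sum.neutral) (use killY in auto)
  have group: "(\<Sum>\<alpha>\<in>\<Delta>. opscale (g \<alpha>) (Q \<alpha>)) = (\<Sum>cd\<in>\<Lambda> \<times> \<Lambda>. opscale (g (fst cd - snd cd)) (Y (fst cd) (snd cd)))" for g
  proof -
    have "(\<Sum>\<alpha>\<in>\<Delta>. opscale (g \<alpha>) (Q \<alpha>)) =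
      (\<Sum>\<alpha>\<in>\<Delta>. \<Sum>cd\<in>{cd \<in> \<Lambda> \<times> \<Lambda>. fst cd - snd cd = \<alpha>}. opscale (g (fst cd - snd cd)) (Y (fst cd) (snd cd)))"
      by (auto simp: Q_def O.scale_sum_right intro!: sum.cong)
    also have "\<dots> = (\<Sum>cd\<in>\<Lambda> \<times> \<Lambda>. opscale (g (fst cd - snd cd)) (Y (fst cd) (snd cd)))"
      by (rule sum.group) (use fin fin\<Delta> in \<open>auto simp: \<Delta>_def\<close>)
    finally show ?thesis .
  qed
  have pair: "(\<Sum>cd\<in>\<Lambda> \<times> \<Lambda>. h (fst cd) (snd cd)) v = (\<Sum>c\<in>\<Lambda>. \<Sum>d\<in>\<Lambda>. h c d v)" for h :: "complex \<Rightarrow> complex \<Rightarrow> 'v \<times> 'v \<Rightarrow> 'v \<times> 'v" and v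
    by (simp add: sum_fun_apply sum.cartesian_product split_def)
  have Zv: "(\<Sum>d\<in>\<Lambda>. e c (Z (e d v))) = e c (Z v)" for c v
  proof -
    have "e c (Z v) = e c (Z (\<Sum>d\<in>\<Lambda>. e d v))" by (simp only: sum)
    then show ?thesis by (simp only: linear_sum[OF Z(2)] linear_sum[OF e(1)])
  qed
  have "Z = (\<Sum>\<alpha>\<in>\<Delta>. Q \<alpha>)"
  proof
    fix v
    have "(\<Sum>\<alpha>\<in>\<Delta>. Q \<alpha>) v = (\<Sum>\<alpha>\<in>\<Delta>. opscale 1 (Q \<alpha>)) v" by simp
    also have "\<dots> = (\<Sum>c\<in>\<Lambda>. \<Sum>d\<in>\<Lambda>. Y c d v)" unfolding group by (simp add: pair)
    also have "\<dots> = Z v" unfolding Y_def Zv using sum by simp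
    finally show "Z v = (\<Sum>\<alpha>\<in>\<Delta>. Q \<alpha>) v" by simp
  qed
  moreover obtain r where r: "\<forall>c\<in>\<Delta>. [:- c, 1:] ^ (m + m) dvd (1 - r c) \<and> (\<forall>d\<in>\<Delta> - {c}. [:- d, 1:] ^ (m + m) dvd r c)"
    using poly_crt_idempotents[OF fin\<Delta>, of "m + m"] by blast
  ultimately have pactQ: "D.pact (r \<alpha>) Z = Q \<alpha>" if "\<alpha> \<in> \<Delta>" for \<alpha>
    using D.pact_complex_components[OF r fin\<Delta>, of Q] killQ that by simp
  have QW: "Q \<alpha> \<in> W" if "\<alpha> \<in> \<Delta>" for \<alpha>
    unfolding pactQ[OF that, symmetric] by (rule D.pact_in_subspace[OF W ad Z(1)])
  have "(\<Sum>\<alpha>\<in>\<Delta>. opscale (cnj \<alpha>) (Q \<alpha>)) \<in> W"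
    using QW by (intro O.subspace_sum[OF W] O.subspace_scale[OF W])
  moreover have "(\<Sum>\<alpha>\<in>\<Delta>. opscale (cnj \<alpha>) (Q \<alpha>)) =
    (\<lambda>v. (\<Sum>c\<in>\<Lambda>. cplx_scale (cnj c) (e c (Z v))) - Z (\<Sum>c\<in>\<Lambda>. cplx_scale (cnj c) (e c v)))"
  proof
    fix v
    have "(\<Sum>\<alpha>\<in>\<Delta>. opscale (cnj \<alpha>) (Q \<alpha>)) v
      = (\<Sum>c\<in>\<Lambda>. \<Sum>d\<in>\<Lambda>. cplx_scale (cnj c) (Y c d v)) - (\<Sum>c\<in>\<Lambda>. \<Sum>d\<in>\<Lambda>. cplx_scale (cnj d) (Y c d v))"
      unfolding group using pair[of "\<lambda>c d. opscale (cnj (c - d)) (Y c d)" v]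
      by (simp add: opscale_def cplx.scale_left_diff_distrib sum_subtractf)
    also have "(\<Sum>c\<in>\<Lambda>. \<Sum>d\<in>\<Lambda>. cplx_scale (cnj c) (Y c d v)) = (\<Sum>c\<in>\<Lambda>. cplx_scale (cnj c) (e c (Z v)))"
      by (simp add: Y_def Zv flip: cplx.scale_sum_right)
    also have "(\<Sum>c\<in>\<Lambda>. \<Sum>d\<in>\<Lambda>. cplx_scale (cnj d) (Y c d v)) = Z (\<Sum>c\<in>\<Lambda>. cplx_scale (cnj c) (e c v))"
    proof -
      have "(\<Sum>c\<in>\<Lambda>. \<Sum>d\<in>\<Lambda>. cplx_scale (cnj d) (Y c d v)) = (\<Sum>d\<in>\<Lambda>. \<Sum>c\<in>\<Lambda>. cplx_scale (cnj d) (Y c d v))"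
        by (rule sum.swap)
      also have "\<dots> = (\<Sum>d\<in>\<Lambda>. cplx_scale (cnj d) (Z (e d v)))"
        by (simp add: Y_def sum flip: cplx.scale_sum_right)
      finally show ?thesis by (simp add: linear_sum[OF Z(2)] Z(3))
    qed
    finally show "(\<Sum>\<alpha>\<in>\<Delta>. opscale (cnj \<alpha>) (Q \<alpha>)) v =
      (\<Sum>c\<in>\<Lambda>. cplx_scale (cnj c) (e c (Z v))) - Z (\<Sum>c\<in>\<Lambda>. cplx_scale (cnj c) (e c v))" .
  qed
  ultimately show ?thesis by simp
qed

text \<open>
  Cartan's argument: \<open>\<sigma>\<close> has the conjugate eigenvalues of \<open>X = \<rho> x\<close>, so the trace of \<open>X \<sigma>\<close> is the sum of the
  squared moduli of the eigenvalues; it vanishes because bracketing with \<open>\<sigma>\<close>, a polynomial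
  in \<open>ad X\<close>, preserves the complex span \<open>W\<close> of the operators \<open>\<rho> y\<close>.
\<close>

lemma isotropic_imp_nilpotent:
  fixes \<rho> :: "'g::real_vector \<Rightarrow> 'v::real_vector \<Rightarrow> 'v"
  assumes fd: "finite_dim (UNIV :: 'v set)" and P: "subspace P" and \<rho>: "bilinear \<rho>"
    and closed: "\<And>y z. y \<in> P \<Longrightarrow> z \<in> P \<Longrightarrow> br y z \<in> P"
    and hom: "\<And>y z v. y \<in> P \<Longrightarrow> z \<in> P \<Longrightarrow> \<rho> (br y z) v = \<rho> y (\<rho> z v) - \<rho> z (\<rho> y v)"
    and iso: "\<And>y z. y \<in> P \<Longrightarrow> z \<in> P \<Longrightarrow> trace_of (\<lambda>v. \<rho> y (\<rho> z v)) = 0"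
    and x: "x \<in> P" and t: "\<And>v. \<rho> t v = 0" "x - t \<in> span {br y z | y z. y \<in> P \<and> z \<in> P}"
  shows "\<exists>n. \<forall>v. (\<rho> x ^^ n) v = 0"
proof -
  note fdw = finite_dim_prod[OF fd]
  have lin: "linear (\<rho> y)" for y using \<rho> by (simp add: bilinear_def)
  define C where "C y = complexify (\<rho> y)" for y
  have linC: "linear (C y)" for y unfolding C_def by (rule linear_complexify[OF lin])
  have CC: "C y (C z v) = complexify (\<lambda>v. \<rho> y (\<rho> z v)) v" for y z v
    by (cases v) (simp add: C_def complexify_def)
  have Cadd: "C (y + z) v = C y v + C z v" and Cscale: "C (a *\<^sub>R y) v = a *\<^sub>R C y v" for y z v a
    by (cases v; simp add: C_def complexify_def bilinear_ladd[OF \<rho>] bilinear_lmul[OF \<rho>])+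
  have Cs: "C y (cplx_scale a v) = cplx_scale a (C y v)" for y a v
    unfolding C_def by (rule complexify_cplx_scale[OF lin])
  have Cbr: "C (br y z) v = C y (C z v) - C z (C y v)" if "y \<in> P" "z \<in> P" for y z v
    by (cases v) (simp add: C_def complexify_def hom[OF that])
  have C0: "C 0 v = 0" for v using Cscale[of 0 0 v] by simp
  obtain \<Lambda> m e where zero: "0 \<in> \<Lambda>" and spectral: "spectral_family (\<rho> x) \<Lambda> m e"
    using complexify_spectral_idempotents[OF fd lin[of x]] by blast
  note fin = spectral_familyD(1)[OF spectral] and e = spectral_familyD(2-4)[OF spectral, folded C_def]
    and sum = spectral_familyD(5)[OF spectral] and nil = spectral_familyD(7)[OF spectral, folded C_def]
  define \<sigma> where "\<sigma> v = (\<Sum>c\<in>\<Lambda>. cplx_scale (cnj c) (e c v))" for v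
  have lin\<sigma>: "linear \<sigma>" unfolding \<sigma>_def
    by (intro linear_compose_sum ballI linear_compose[OF e(1) linear_cplx_scale, unfolded o_def])
  \<comment> \<open>\<open>P\<close> is only a real subspace; a pair \<open>a\<close>,
    \<open>b\<close> stands for the operator of a + i b.\<close>
  define W where "W = {f. \<exists>a\<in>P. \<exists>b\<in>P. f = (\<lambda>v. C a v + cplx_scale \<i> (C b v))}"
  interpret O: vector_space "opscale :: complex \<Rightarrow> ('v \<times> 'v \<Rightarrow> 'v \<times> 'v) \<Rightarrow> _" by (rule vector_space_opscale)
  have Wi: "(\<lambda>v. C a v + cplx_scale \<i> (C b v)) \<in> W" if "a \<in> P" "b \<in> P" for a b
    using that by (auto simp: W_def)
  have Wsub: "O.subspace W"
  proof (rule O.subspaceI)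
    show "0 \<in> W" using Wi[OF subspace_0[OF P] subspace_0[OF P]] by (simp add: C0 zero_fun_def)
    show "f + g \<in> W" if fg: "f \<in> W" "g \<in> W" for f g
    proof -
      obtain a b where f: "a \<in> P" "b \<in> P" "f = (\<lambda>v. C a v + cplx_scale \<i> (C b v))" using fg unfolding W_def by blast
      obtain a' b' where g: "a' \<in> P" "b' \<in> P" "g = (\<lambda>v. C a' v + cplx_scale \<i> (C b' v))" using fg unfolding W_def by blast
      have "f + g = (\<lambda>v. C (a + a') v + cplx_scale \<i> (C (b + b') v))"
        by (simp add: f g fun_eq_iff Cadd cplx.scale_right_distrib algebra_simps)
      then show ?thesis using Wi subspace_add[OF P] f g by simp
    qed
    show "opscale k f \<in> W" if "f \<in> W" for k f
    proof -
      obtain a b where f: "a \<in> P" "b \<in> P" "f = (\<lambda>v. C a v + cplx_scale \<i> (C b v))" using \<open>f \<in> W\<close> unfolding W_def by blast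
      have "opscale k f = (\<lambda>v. C (Re k *\<^sub>R a + (- Im k) *\<^sub>R b) v + cplx_scale \<i> (C (Im k *\<^sub>R a + Re k *\<^sub>R b) v))"
        by (simp add: f fun_eq_iff opscale_def Cadd Cscale cplx_scale_def prod_eq_iff algebra_simps del: scaleR_minus_left)
          (simp add: algebra_simps)
      then show ?thesis using Wi f by (simp add: subspace_add[OF P] subspace_scale[OF P] del: scaleR_minus_left)
    qed
  qed
  have Wad: "(\<lambda>v. C x (f v) - f (C x v)) \<in> W" if "f \<in> W" for f
  proof -
    obtain a b where f: "a \<in> P" "b \<in> P" "f = (\<lambda>v. C a v + cplx_scale \<i> (C b v))" using \<open>f \<in> W\<close> unfolding W_def by blast
    have "(\<lambda>v. C x (f v) - f (C x v)) = (\<lambda>v. C (br x a) v + cplx_scale \<i> (C (br x b) v))"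
      by (simp add: f fun_eq_iff Cbr[OF x] linear_add[OF linC] Cs cplx.scale_right_diff_distrib algebra_simps)
    then show ?thesis using Wi closed x f by simp
  qed
  have CW: "C z \<in> W" if "z \<in> P" for z
    using Wi[OF that subspace_0[OF P]] by (simp add: C0)
  have comm: "(\<lambda>v. \<sigma> (C z v) - C z (\<sigma> v)) \<in> W" if "z \<in> P" for z
    unfolding \<sigma>_def
    by (rule commutator_cnj_spectral_mem[OF lin[of x] spectral Wsub Wad[unfolded C_def] CW[OF that] linC Cs])
      (auto simp: C_def)
  have trW: "trace_of (\<lambda>v. C y (f v)) = 0" if y: "y \<in> P" and f: "f \<in> W" for y f
  proof -
    obtain a b where ab: "a \<in> P" "b \<in> P" "f = (\<lambda>v. C a v + cplx_scale \<i> (C b v))" using f unfolding W_def by blast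
    have l: "linear (\<lambda>v. \<rho> y (\<rho> z v))" for z using linear_compose[OF lin[of z] lin[of y]] by (simp add: o_def)
    have "(\<lambda>v. C y (f v)) = (\<lambda>v. complexify (\<lambda>v. \<rho> y (\<rho> a v)) v + cplx_scale \<i> (complexify (\<lambda>v. \<rho> y (\<rho> b v)) v))"
      by (simp add: ab fun_eq_iff linear_add[OF linC] Cs CC)
    then have "trace_of (\<lambda>v. C y (f v)) = trace_of (complexify (\<lambda>v. \<rho> y (\<rho> a v)))
        + trace_of (\<lambda>v. cplx_scale \<i> (complexify (\<lambda>v. \<rho> y (\<rho> b v)) v))"
      using trace_add[OF fdw linear_complexify[OF l] linear_compose[OF linear_complexify[OF l] linear_cplx_scale, unfolded o_def]] by simp
    then show ?thesis using trace_complexify[OF fd l] iso[OF y] ab by simp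
  qed
  define \<tau> where "\<tau> y = trace_of (\<lambda>v. C y (\<sigma> v))" for y
  have lC\<sigma>: "linear (\<lambda>v. C y (\<sigma> v))" for y using linear_compose[OF lin\<sigma> linC] by (simp add: o_def)
  have \<tau>_add: "\<tau> (y + z) = \<tau> y + \<tau> z" for y z
    unfolding \<tau>_def Cadd by (rule trace_add[OF fdw lC\<sigma> lC\<sigma>])
  have \<tau>_scale: "\<tau> (a *\<^sub>R y) = a * \<tau> y" for a y
    unfolding \<tau>_def Cscale by (rule trace_scale[OF fdw])
  \<comment> \<open>The trace of [Y, Z] \<sigma> is that of Y [Z, \<sigma>], where the second factor
    lies in \<open>W\<close> and is therefore trace-orthogonal to Y.\<close>
  have \<tau>_br: "\<tau> (br y z) = 0" if "y \<in> P" "z \<in> P" for y z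
  proof -
    have l: "linear (\<lambda>v. C y (C z (\<sigma> v)))" "linear (\<lambda>v. C z (C y (\<sigma> v)))" "linear (\<lambda>v. C y (\<sigma> (C z v)))" "linear (\<lambda>v. C y (C z (\<sigma> v)))"
      using linear_compose[OF lC\<sigma> linC] linear_compose[OF linC lC\<sigma>] by (simp_all add: o_def)
    have "\<tau> (br y z) = trace_of (\<lambda>v. C y (C z (\<sigma> v))) - trace_of (\<lambda>v. C z (C y (\<sigma> v)))"
      unfolding \<tau>_def Cbr[OF that] by (rule trace_diff[OF fdw l(1,2)])
    also have "trace_of (\<lambda>v. C z (C y (\<sigma> v))) = trace_of (\<lambda>v. C y (\<sigma> (C z v)))"
      by (rule trace_comm[OF fdw linC lC\<sigma>])
    also have "trace_of (\<lambda>v. C y (C z (\<sigma> v))) - trace_of (\<lambda>v. C y (\<sigma> (C z v))) = - trace_of (\<lambda>v. C y (\<sigma> (C z v) - C z (\<sigma> v)))"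
      using trace_diff[OF fdw l(3,4)] by (simp add: linear_diff[OF linC])
    also have "\<dots> = 0" using trW[OF that(1) comm[OF that(2)]] by simp
    finally show ?thesis .
  qed
  have "\<tau> (x - t) = 0" using t(2)
  proof (induction rule: span_induct_alt)
    case base
    then show ?case using \<tau>_scale[of 0 0] by simp
  next
    case (step c u w)
    then show ?case using \<tau>_br by (auto simp: \<tau>_add \<tau>_scale)
  qed
  moreover have "\<tau> t = 0"
  proof -
    have "C t v = 0" for v by (cases v) (simp add: C_def complexify_def t(1) zero_prod_def)
    then show ?thesis unfolding \<tau>_def by (simp add: trace_zero[OF fdw])
  qed
  ultimately have "\<tau> x = 0" using \<tau>_add[of "x - t" t] by simp
  then have "(\<Sum>c\<in>\<Lambda>. (cmod c)\<^sup>2 * dim (range (e c))) = 0"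
    using trace_complexify_cnj_spectral[OF fd lin[of x] spectral]
    by (simp add: \<tau>_def \<sigma>_def C_def)
  \<comment> \<open>All summands are nonnegative, so they vanish one by one: every
    \<open>e c\<close> with \<open>c \<noteq> 0\<close> is zero, and \<open>e 0\<close> is the
    identity.\<close>
  then have z: "(cmod c)\<^sup>2 * dim (range (e c)) = 0" if "c \<in> \<Lambda>" for c
    using that fin by (subst (asm) sum_nonneg_eq_0_iff) auto
  have e0: "e c v = 0" if "c \<in> \<Lambda>" "c \<noteq> 0" for c v
  proof -
    have "subspace (range (e c))" using e(1) by (simp add: linear_subspace_image)
    moreover have "dim (range (e c)) = 0" using z that by auto
    ultimately have "{0} = range (e c)"
      by (intro subspace_dim_equal_fd[OF fdw subspace_single_0]) (use subspace_0 in auto)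
    then show ?thesis by blast
  qed
  have "v = e 0 v" for v
  proof -
    have "(\<Sum>c\<in>\<Lambda>. e c v) = (\<Sum>c\<in>\<Lambda>. if c = 0 then e 0 v else 0)"
      using e0 by (intro sum.cong) auto
    then show ?thesis using fin zero sum[of v] by simp
  qed
  then have Xm: "(C x ^^ m) v = 0" for v using nil[OF zero, of v] by simp
  have "(\<rho> x ^^ m) v = 0" for v
  proof -
    have "(C x ^^ k) (v, 0) = ((\<rho> x ^^ k) v, 0)" for k
      by (induction k) (simp_all add: C_def complexify_def linear_0[OF lin])
    then show ?thesis using Xm[of "(v, 0)"] by (simp add: zero_prod_def)
  qed
  then show ?thesis by blast
qed

section \<open>Engel's theorem\<close>

context lie_algebra
begin

lemma br_simps:
  "br (x + y) z = br x z + br y z" "br z (x + y) = br z x + br z y"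
  "br (c *\<^sub>R x) y = c *\<^sub>R br x y" "br x (c *\<^sub>R y) = c *\<^sub>R br x y"
  "br 0 x = 0" "br x 0 = 0" "br (- x) y = - br x y" "br x (- y) = - br x y"
  "br (x - y) z = br x z - br y z" "br z (x - y) = br z x - br z y"
  using bilinear_br
  by (auto simp: bilinear_ladd bilinear_radd bilinear_lmul bilinear_rmul bilinear_lzero bilinear_rzero
      bilinear_lneg bilinear_rneg bilinear_lsub bilinear_rsub)

lemma br_anti: "br x y = - br y x"
proof -
  have "br (x + y) (x + y) = br x y + br y x"
    unfolding br_simps by (simp add: br_self)
  then show ?thesis by (simp add: br_self eq_neg_iff_add_eq_0)
qed

lemma jacobi_left: "br (br x y) z = br x (br y z) - br y (br x z)"
  using jacobi[of x y z] br_anti[of "br x y" z] br_anti[of z x]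
  by (simp add: br_simps algebra_simps)

lemma linear_br: "linear (br x)" "linear (\<lambda>x. br x y)"
  using bilinear_br by (auto simp: bilinear_def)

text \<open>
  A maximal proper subalgebra \<open>M\<close> of \<open>Q\<close> containing the kernel of \<open>\<rho>\<close> acts nilpotently on \<open>Q / M\<close>, hence
  is normalised by some \<open>y \<notin> M\<close>, and \<open>y\<close> acts on the space of null vectors of \<open>M\<close>.
\<close>

lemma engel_null_vector:
  fixes \<rho> :: "'a \<Rightarrow> 'a \<Rightarrow> 'a"
  assumes fd: "finite_dim (UNIV :: 'a set)"
    and Q: "lie_subalgebra br Q" and \<rho>: "bilinear \<rho>"
    and hom: "\<And>y z v. y \<in> Q \<Longrightarrow> z \<in> Q \<Longrightarrow> v \<in> W \<Longrightarrow> \<rho> (br y z) v = \<rho> y (\<rho> z v) - \<rho> z (\<rho> y v)"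
    and W: "subspace W" "W \<noteq> {0}" and stable: "\<And>x w. x \<in> Q \<Longrightarrow> w \<in> W \<Longrightarrow> \<rho> x w \<in> W"
    and nil: "\<And>x. x \<in> Q \<Longrightarrow> \<exists>n. \<forall>w\<in>W. (\<rho> x ^^ n) w = 0"
  shows "\<exists>w\<in>W. w \<noteq> 0 \<and> (\<forall>x\<in>Q. \<rho> x w = 0)"
  using assms(2-)
proof (induction "dim Q" arbitrary: Q \<rho> W rule: less_induct)
  case less
  note Q = less.prems(1) and \<rho> = less.prems(2) and hom = less.prems(3) and W = less.prems(4,5)
    and stable = less.prems(6) and nil = less.prems(7)
  have subQ: "subspace Q" and brQ: "\<And>x y. x \<in> Q \<Longrightarrow> y \<in> Q \<Longrightarrow> br x y \<in> Q"
    using Q by (auto simp: lie_subalgebra_def)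
  note r_add = bilinear_radd[OF \<rho>] and l_add = bilinear_ladd[OF \<rho>] and r_sc = bilinear_rmul[OF \<rho>] and l_sc = bilinear_lmul[OF \<rho>]
    and r_0 = bilinear_rzero[OF \<rho>] and l_0 = bilinear_lzero[OF \<rho>]
  define N where "N = {x \<in> Q. \<forall>w\<in>W. \<rho> x w = 0}"
  have subN: "subspace N" unfolding subspace_def N_def
    using subQ by (auto simp: subspace_add subspace_scale subspace_0 l_add l_sc l_0)
  have algN: "lie_subalgebra br N"
    unfolding lie_subalgebra_def using subN brQ hom stable by (auto simp: N_def r_0)
  show ?case
  proof (cases "N = Q")
    case True
    obtain w where "w \<in> W" "w \<noteq> 0" using W subspace_0[OF W(1)] by auto
    then show ?thesis using True N_def by blast
  next
    case False
    then have NQ: "N \<subset> Q" by (auto simp: N_def)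
    \<comment> \<open>\<open>N\<close> is kept inside \<open>M\<close> because nilpotency of
      \<open>br x\<close> is obtained only modulo the kernel of \<open>\<rho>\<close>: high powers
      of \<open>br x\<close> land in \<open>N\<close>, hence in \<open>M\<close>.\<close>
    let ?P = "\<lambda>M. lie_subalgebra br M \<and> N \<subseteq> M \<and> M \<subset> Q"
    obtain M where M: "?P M" and max: "\<And>M'. ?P M' \<Longrightarrow> dim M' \<le> dim M"
      using exists_max_dim_fd[OF fd, of ?P N] algN NQ by blast
    have subM: "subspace M" and brM: "\<And>x y. x \<in> M \<Longrightarrow> y \<in> M \<Longrightarrow> br x y \<in> M"
      using M by (auto simp: lie_subalgebra_def)
    have dimM: "dim M < dim Q" using subspace_dim_less_fd[OF fd subM subQ] M by blast
    obtain q where q: "linear q" "\<forall>x\<in>M. q x = 0" "\<forall>x. x - q x \<in> M"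
      using projection_along[OF subM] by blast
    have q0: "x \<in> M" if "q x = 0" for x using q(3) that by (metis diff_0_right)
    have q_br: "q (br x (q y)) = q (br x y)" if "x \<in> M" for x y
    proof -
      have "br x (y - q y) \<in> M" using brM that q by blast
      then have "q (br x y - br x (q y)) = 0" using q br_simps by simp
      then show ?thesis using q by (simp add: linear_diff)
    qed
    \<comment> \<open>The action of \<open>M\<close> on \<open>Q / M\<close>, carried by the image
      of \<open>Q\<close> under \<open>q\<close>.\<close>
    define \<rho>' where "\<rho>' x y = q (br x y)" for x y
    have qQ: "q y \<in> Q" if "y \<in> Q" for y
    proof -
      have "y - q y \<in> Q" using q M by blast
      from subspace_diff[OF subQ that this] show ?thesis by simp
    qed
    have "\<exists>w\<in>q ` Q. w \<noteq> 0 \<and> (\<forall>x\<in>M. \<rho>' x w = 0)"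
    proof (rule less.hyps[OF dimM])
      show "lie_subalgebra br M" using M by blast
      show "bilinear \<rho>'" unfolding bilinear_def \<rho>'_def
        using linear_compose[OF linear_br(1) q(1)] linear_compose[OF linear_br(2) q(1)] by (simp add: o_def)
      show "subspace (q ` Q)" using q subQ by (simp add: linear_subspace_image)
      obtain y where "y \<in> Q" "y \<notin> M" using M by blast
      then show "q ` Q \<noteq> {0}" using q0 by blast
      show "\<rho>' (br y z) v = \<rho>' y (\<rho>' z v) - \<rho>' z (\<rho>' y v)" if "y \<in> M" "z \<in> M" for y z v
        using that by (simp add: \<rho>'_def q_br jacobi_left linear_diff[OF q(1)])
      show "\<rho>' x w \<in> q ` Q" if "x \<in> M" "w \<in> q ` Q" for x w
        using that brQ qQ M by (auto simp: \<rho>'_def)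
      show "\<exists>n. \<forall>w\<in>q ` Q. (\<rho>' x ^^ n) w = 0" if x: "x \<in> M" for x
      proof -
        have xQ: "x \<in> Q" using x M by blast
        obtain n where n: "\<forall>w\<in>W. (\<rho> x ^^ n) w = 0" using nil[OF xQ] by blast
        have adQ: "(br x ^^ k) y \<in> Q" if "y \<in> Q" for k y by (induction k) (use that brQ xQ in auto)
        define X where "X = \<rho> x"
        have rec: "\<rho> (br x y) w = X (\<rho> y w) - \<rho> y (X w)" if "y \<in> Q" "w \<in> W" for y w
          using hom[OF xQ that] by (simp add: X_def)
        have nilad: "\<rho> ((br x ^^ (n + n)) y) w = 0" if y: "y \<in> Q" and w: "w \<in> W" for y w
        proof -
          \<comment> \<open>\<open>\<rho>\<close> respects brackets only on \<open>W\<close>, so all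
            maps are cut off to 0 outside \<open>W\<close>. Bracketing with \<open>x\<close> then
            becomes the difference of the commuting operators \<open>L\<close> and \<open>R\<close>
            as an identity of functions.\<close>
          define L where "L f = (\<lambda>v. if v \<in> W then X (f v) else 0)" for f :: "'a \<Rightarrow> 'a"
          define R where "R f = (\<lambda>v. if v \<in> W then f (X v) else 0)" for f :: "'a \<Rightarrow> 'a"
          define F where "F y = (\<lambda>v. if v \<in> W then \<rho> y v else 0)" for y
          have XW: "X v \<in> W" if "v \<in> W" for v using that stable xQ by (simp add: X_def)
          have Fk: "((\<lambda>f. L f - R f) ^^ k) (F y) = F ((br x ^^ k) y)" for k
            by (induction k) (auto simp: F_def L_def R_def fun_eq_iff rec adQ[OF y] XW)
          have Lk: "(L ^^ k) (F y) = (\<lambda>v. if v \<in> W then (X ^^ k) (\<rho> y v) else 0)" for k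
            by (induction k) (auto simp: F_def L_def fun_eq_iff)
          have Rk: "(R ^^ k) (F y) = (\<lambda>v. if v \<in> W then \<rho> y ((X ^^ k) v) else 0)" for k
            by (induction k) (auto simp: F_def R_def fun_eq_iff XW funpow_swap1)
          have L0: "(L ^^ n) (F y) = 0" using n stable y unfolding Lk by (auto simp: X_def fun_eq_iff)
          have R0: "(R ^^ n) (F y) = 0" using n unfolding Rk by (auto simp: X_def fun_eq_iff r_0)
          have "((\<lambda>f. L f - R f) ^^ (n + n)) (F y) = 0"
            by (rule power_diff_commuting_nilpotent[OF _ _ _ L0 R0])
              (auto simp: L_def R_def fun_eq_iff X_def r_add XW[unfolded X_def])
          then have "F ((br x ^^ (n + n)) y) = 0" using Fk by simp
          then have "F ((br x ^^ (n + n)) y) w = 0" by (simp only: zero_fun_apply)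
          then show ?thesis using w by (simp add: F_def)
        qed
        have "(\<rho>' x ^^ Suc k) y = q ((br x ^^ Suc k) y)" for k y
          by (induction k) (simp_all add: \<rho>'_def q_br[OF x])
        moreover have "q ((br x ^^ Suc (n + n)) y) = 0" if "y \<in> Q" for y
        proof -
          have "br x y \<in> Q" using brQ xQ that by blast
          then have "(br x ^^ (n + n)) (br x y) \<in> N"
            using nilad adQ by (simp add: N_def)
          then show ?thesis using M q(2) by (auto simp: funpow_swap1)
        qed
        ultimately show ?thesis using qQ by (intro exI[of _ "Suc (n + n)"]) auto
      qed
    qed
    then obtain y where y: "y \<in> Q" "q y \<noteq> 0" "\<And>x. x \<in> M \<Longrightarrow> \<rho>' x (q y) = 0" by blast
    have yM: "y \<notin> M" using y q by auto
    have brMy: "br x y \<in> M" if "x \<in> M" for x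
      using y(3)[OF that] q0 q_br[OF that] by (simp add: \<rho>'_def)
    define M' where "M' = {m + c *\<^sub>R y | m c. m \<in> M}"
    have M'eq: "M' = {m + z | m z. m \<in> M \<and> z \<in> span {y}}" by (auto simp: M'_def span_singleton)
    have subM': "subspace M'" unfolding M'eq using subM by (intro subspace_sums) auto
    have "br u v \<in> M'" if "u \<in> M'" "v \<in> M'" for u v
    proof -
      obtain m c where u: "m \<in> M" "u = m + c *\<^sub>R y" using \<open>u \<in> M'\<close> M'_def by blast
      obtain m' c' where v: "m' \<in> M" "v = m' + c' *\<^sub>R y" using \<open>v \<in> M'\<close> M'_def by blast
      have "br u v = br m m' + (c' *\<^sub>R br m y - c *\<^sub>R br m' y) + 0 *\<^sub>R y"
        using br_anti[of y m'] by (simp add: u v br_simps br_self)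
      moreover have "br m m' + (c' *\<^sub>R br m y - c *\<^sub>R br m' y) \<in> M"
        using u v brM brMy subM by (intro subspace_add subspace_diff subspace_scale) auto
      ultimately show ?thesis unfolding M'_def by blast
    qed
    then have algM': "lie_subalgebra br M'" using subM' by (simp add: lie_subalgebra_def)
    have MM': "M \<subseteq> M'"
    proof
      fix m assume "m \<in> M"
      then have "m + 0 *\<^sub>R y \<in> M'" unfolding M'_def by blast
      then show "m \<in> M'" by simp
    qed
    have "0 + 1 *\<^sub>R y \<in> M'" unfolding M'_def using subspace_0[OF subM] by blast
    then have "y \<in> M'" by simp
    then have "M \<subset> M'" using MM' yM by blast
    then have "dim M < dim M'" using subspace_dim_less_fd[OF fd subM subM'] by blast
    moreover have "M' \<subseteq> Q" using M y(1) subQ by (auto simp: M'_def intro!: subspace_add subspace_scale)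
    ultimately have M'Q: "M' = Q" using max[of M'] algM' M MM' by fastforce
    define W' where "W' = {w \<in> W. \<forall>x\<in>M. \<rho> x w = 0}"
    have "\<exists>w\<in>W. w \<noteq> 0 \<and> (\<forall>x\<in>M. \<rho> x w = 0)"
    proof (rule less.hyps[OF dimM _ \<rho> _ W])
      show "lie_subalgebra br M" using M by blast
      show "\<rho> (br y z) v = \<rho> y (\<rho> z v) - \<rho> z (\<rho> y v)" if "y \<in> M" "z \<in> M" "v \<in> W" for y z v
        using hom that M by blast
      show "\<rho> x w \<in> W" if "x \<in> M" "w \<in> W" for x w using stable that M by blast
      show "\<exists>n. \<forall>w\<in>W. (\<rho> x ^^ n) w = 0" if "x \<in> M" for x using nil[of x] that M by blast
    qed
    then obtain w where w: "w \<in> W'" "w \<noteq> 0" by (auto simp: W'_def)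
    have yW': "\<rho> y v \<in> W'" if "v \<in> W'" for v
    proof -
      have "\<rho> m (\<rho> y v) = 0" if "m \<in> M" for m
      proof -
        have "\<rho> (br m y) v = \<rho> m (\<rho> y v) - \<rho> y (\<rho> m v)" using hom that M y \<open>v \<in> W'\<close> by (auto simp: W'_def)
        then show ?thesis using brMy[OF that] \<open>v \<in> W'\<close> that by (simp add: W'_def r_0)
      qed
      then show ?thesis using that stable y by (simp add: W'_def)
    qed
    obtain n where n: "\<forall>w\<in>W. (\<rho> y ^^ n) w = 0" using nil y by blast
    \<comment> \<open>The last nonzero vector in the orbit of \<open>w\<close> under
      \<open>\<rho> y\<close> is killed by \<open>y\<close> and, staying in \<open>W'\<close>, by
      \<open>M\<close>; together these make up \<open>Q\<close>.\<close>
    define k where "k = (LEAST k. (\<rho> y ^^ k) w = 0)"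
    have kw: "(\<rho> y ^^ k) w = 0" unfolding k_def by (rule LeastI[of _ n]) (use n w W'_def in auto)
    have "k \<noteq> 0" using kw w by (metis funpow_0)
    then obtain j where j: "k = Suc j" by (meson not0_implies_Suc)
    have jw: "(\<rho> y ^^ j) w \<noteq> 0" using not_less_Least[of j "\<lambda>k. (\<rho> y ^^ k) w = 0"] j k_def by auto
    have jW': "(\<rho> y ^^ i) w \<in> W'" for i by (induction i) (use w yW' in auto)
    let ?v = "(\<rho> y ^^ j) w"
    have "\<rho> x ?v = 0" if "x \<in> Q" for x
    proof -
      obtain m c where "m \<in> M" "x = m + c *\<^sub>R y" using \<open>x \<in> Q\<close> unfolding M'Q[symmetric] M'_def by blast
      then show ?thesis using jW'[of j] kw j by (simp add: W'_def l_add l_sc)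
    qed
    then show ?thesis using jw jW'[of j] by (auto simp: W'_def)
  qed
qed

text \<open>Cartan's argument makes every element of \<open>P\<close> act nilpotently, and Engel's
  theorem modulo the null vectors \<open>U\<close> yields \<open>v\<close> outside \<open>U\<close>
  that \<open>P\<close> maps into \<open>U\<close>. Products of two elements then kill
  \<open>v\<close>, hence so do brackets, and by perfectness all of \<open>P\<close>, a
  contradiction. Perfectness is asked modulo elements acting as zero, which suits representations
  that factor through the quotient by the radical.\<close>

lemma perfect_isotropic_acts_trivially:
  fixes \<rho> :: "'a \<Rightarrow> 'a \<Rightarrow> 'a"
  assumes fd: "finite_dim (UNIV :: 'a set)"
    and P: "lie_subalgebra br P" and \<rho>: "bilinear \<rho>"
    and hom: "\<And>y z v. y \<in> P \<Longrightarrow> z \<in> P \<Longrightarrow> \<rho> (br y z) v = \<rho> y (\<rho> z v) - \<rho> z (\<rho> y v)"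
    and iso: "\<And>y z. y \<in> P \<Longrightarrow> z \<in> P \<Longrightarrow> trace_of (\<lambda>v. \<rho> y (\<rho> z v)) = 0"
    and perfect: "\<And>x. x \<in> P \<Longrightarrow> \<exists>t. (\<forall>v. \<rho> t v = 0) \<and> x - t \<in> span {br y z | y z. y \<in> P \<and> z \<in> P}"
    and x: "x \<in> P"
  shows "\<rho> x v = 0"
proof -
  have subP: "subspace P" and brP: "\<And>x y. x \<in> P \<Longrightarrow> y \<in> P \<Longrightarrow> br x y \<in> P"
    using P by (auto simp: lie_subalgebra_def)
  have nil: "\<exists>n. \<forall>v. (\<rho> x ^^ n) v = 0" if "x \<in> P" for x
  proof -
    obtain t where "\<forall>v. \<rho> t v = 0" "x - t \<in> span {br y z | y z. y \<in> P \<and> z \<in> P}"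
      using perfect[OF \<open>x \<in> P\<close>] by blast
    then show ?thesis using isotropic_imp_nilpotent[OF fd subP \<rho> brP hom iso that] by blast
  qed
  define U where "U = {v. \<forall>x\<in>P. \<rho> x v = 0}"
  note r_add = bilinear_radd[OF \<rho>] and r_sc = bilinear_rmul[OF \<rho>] and r_0 = bilinear_rzero[OF \<rho>]
    and r_diff = bilinear_rsub[OF \<rho>] and l_diff = bilinear_lsub[OF \<rho>]
  have subU: "subspace U" unfolding subspace_def U_def by (auto simp: r_add r_sc r_0)
  have "U = UNIV"
  proof (rule ccontr)
    assume "U \<noteq> UNIV"
    then obtain u where u: "u \<notin> U" by blast
    obtain q where q: "linear q" "\<forall>x\<in>U. q x = 0" "\<forall>x. x - q x \<in> U"
      using projection_along[OF subU] by blast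
    have q0: "x \<in> U" if "q x = 0" for x using q(3) that by (metis diff_0_right)
    define \<rho>' where "\<rho>' x y = q (\<rho> x y)" for x y
    have \<rho>q: "\<rho> x (q y) = \<rho> x y" if "x \<in> P" for x y
    proof -
      have "\<rho> x (y - q y) = 0" using q(3) that U_def by blast
      then show ?thesis by (simp add: r_diff)
    qed
    have "\<exists>w\<in>range q. w \<noteq> 0 \<and> (\<forall>x\<in>P. \<rho>' x w = 0)"
    proof (rule engel_null_vector[OF fd P])
      show "bilinear \<rho>'" unfolding bilinear_def \<rho>'_def
        using \<rho> linear_compose[OF _ q(1)] by (auto simp: o_def bilinear_def)
      show "subspace (range q)" using q by (simp add: linear_subspace_image)
      show "range q \<noteq> {0}" using q0 u by blast
      show "\<rho>' x w \<in> range q" for x w by (simp add: \<rho>'_def)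
      show "\<rho>' (br y z) v = \<rho>' y (\<rho>' z v) - \<rho>' z (\<rho>' y v)" if "y \<in> P" "z \<in> P" for y z v
        using that by (simp add: \<rho>'_def \<rho>q hom linear_diff[OF q(1)])
      show "\<exists>n. \<forall>w\<in>range q. (\<rho>' x ^^ n) w = 0" if x: "x \<in> P" for x
      proof -
        obtain n where n: "\<forall>v. (\<rho> x ^^ n) v = 0" using nil[OF x] by blast
        have "(\<rho>' x ^^ Suc k) y = q ((\<rho> x ^^ Suc k) y)" for k y
          by (induction k) (simp_all add: \<rho>'_def \<rho>q[OF x])
        then have "(\<rho>' x ^^ Suc n) y = 0" for y using n by (simp add: r_0 linear_0[OF q(1)])
        then show ?thesis by blast
      qed
    qed
    then obtain v where v: "q v \<noteq> 0" "\<And>x. x \<in> P \<Longrightarrow> q (\<rho> x (q v)) = 0" by (auto simp: \<rho>'_def)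
    have vU: "\<rho> x v \<in> U" if "x \<in> P" for x using v(2)[OF that] q0 \<rho>q[OF that] by simp
    have "\<rho> x v = 0" if "x \<in> P" for x
    proof -
      obtain t where t: "\<forall>v. \<rho> t v = 0" "x - t \<in> span {br y z | y z. y \<in> P \<and> z \<in> P}"
        using perfect[OF \<open>x \<in> P\<close>] by blast
      have "\<rho> (x - t) v = 0"
      proof (rule linear_eq_0_on_span[OF _ _ t(2)])
        show "linear (\<lambda>x. \<rho> x v)" using \<rho> by (simp add: bilinear_def)
        show "\<rho> z v = 0" if "z \<in> {br y z | y z. y \<in> P \<and> z \<in> P}" for z
          using that hom vU by (auto simp: U_def)
      qed
      then show ?thesis using t by (simp add: l_diff)
    qed
    then have "v \<in> U" by (simp add: U_def)
    then show False using v(1) q(2) by blast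
  qed
  then show ?thesis using x U_def by blast
qed

end

section \<open>The Killing form and Casimir families\<close>

context lie_algebra
begin

lemma derived_series_subspace: "subspace L \<Longrightarrow> subspace (derived_series br L n)"
  by (cases n) auto

lemma derived_series_mono: "A \<subseteq> B \<Longrightarrow> derived_series br A n \<subseteq> derived_series br B n"
proof (induction n)
  case (Suc n)
  then show ?case by (simp only: derived_series.simps(2)) (rule span_mono, blast)
qed simp

lemma derived_series_add: "derived_series br L (m + n) = derived_series br (derived_series br L m) n"
  by (induction n) simp_all

lemma derived_series_Suc_subset:
  assumes "lie_subalgebra br L"
  shows "derived_series br L (Suc n) \<subseteq> derived_series br L n"
proof (induction n)
  case 0
  have "span {br x y | x y. x \<in> L \<and> y \<in> L} \<subseteq> L"
    using assms by (intro span_minimal) (auto simp: lie_subalgebra_def)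
  then show ?case by simp
next
  case (Suc n)
  show ?case
    by (subst derived_series.simps(2), subst (3) derived_series.simps(2), rule span_mono) (use Suc in blast)
qed

lemma derived_series_ideal:
  assumes L: "lie_subalgebra br L" and I: "lie_ideal br L I"
  shows "lie_ideal br L (derived_series br I n)"
proof (induction n)
  case 0
  then show ?case using I by simp
next
  case (Suc n)
  let ?D = "derived_series br I n" and ?S = "derived_series br I (Suc n)"
  have D: "?D \<subseteq> L" "\<And>x y. x \<in> L \<Longrightarrow> y \<in> ?D \<Longrightarrow> br x y \<in> ?D" using Suc by (auto simp: lie_ideal_def)
  have sub: "subspace ?S" by simp
  have subL: "subspace L" using L by (simp add: lie_subalgebra_def)
  have mem: "br y z \<in> ?S" if "y \<in> ?D" "z \<in> ?D" for y z
    using that by (auto intro: span_base)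
  have "?S \<subseteq> L"
    unfolding derived_series.simps(2) by (rule span_minimal[OF _ subL]) (use D in blast)
  moreover have "br x u \<in> ?S" if x: "x \<in> L" and "u \<in> ?S" for x u
    using that(2) unfolding derived_series.simps(2)[of br I n]
  proof (induction rule: span_induct_alt)
    case base
    then show ?case by (simp add: br_simps span_zero)
  next
    case (step c u v)
    obtain y z where yz: "y \<in> ?D" "z \<in> ?D" "u = br y z" using step by blast
    have "br x u = br (br x y) z + br y (br x z)" using jacobi_left[of x y z] yz by simp
    moreover have "br (br x y) z \<in> ?S" "br y (br x z) \<in> ?S" using mem D(2) x yz by blast+
    ultimately have "br x u \<in> ?S" using subspace_add[OF sub] by simp
    then show ?case using step by (simp add: br_simps span_add span_scale)
  qed
  ultimately show ?case unfolding lie_ideal_def using sub by blast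
qed

lemma lie_ideal_subalgebra: "lie_subalgebra br L \<Longrightarrow> lie_ideal br L I \<Longrightarrow> lie_subalgebra br I"
  unfolding lie_ideal_def lie_subalgebra_def by blast

lemma lie_subalgebra_UNIV: "lie_subalgebra br UNIV"
  by (simp add: lie_subalgebra_def)

lemma solvable_if_derived_subset:
  assumes I: "subspace I" and sub: "derived_series br I m \<subseteq> R" and R: "lie_solvable br R"
  shows "lie_solvable br I"
proof -
  obtain n where n: "derived_series br R n = {0}" using R by (auto simp: lie_solvable_def)
  have "derived_series br I (m + n) \<subseteq> {0}"
    unfolding derived_series_add using derived_series_mono[OF sub, of n] n by simp
  moreover have "0 \<in> derived_series br I (m + n)" using derived_series_subspace[OF I] subspace_0 by blast
  ultimately show ?thesis unfolding lie_solvable_def by blast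
qed

lemma solvable_subset: "subspace I \<Longrightarrow> I \<subseteq> R \<Longrightarrow> lie_solvable br R \<Longrightarrow> lie_solvable br I"
  using solvable_if_derived_subset[of I 0 R] by simp

text \<open>The module is the space of the algebra itself. The modules in question are subquotients
  of it, namely the quotient by the radical and \<open>K / K'\<close>; each is realised on a
  complement and the action is extended by zero, so traces are those of the subquotient.\<close>

definition representation_of :: "('a \<Rightarrow> 'a \<Rightarrow> 'a) \<Rightarrow> bool" where
  "representation_of \<rho> \<longleftrightarrow> bilinear \<rho> \<and> (\<forall>x y v. \<rho> (br x y) v = \<rho> x (\<rho> y v) - \<rho> y (\<rho> x v))"

definition trace_form :: "('a \<Rightarrow> 'a \<Rightarrow> 'a) \<Rightarrow> 'a \<Rightarrow> 'a \<Rightarrow> real" where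
  "trace_form \<rho> x y = trace_of (\<lambda>v. \<rho> x (\<rho> y v))"

end

locale fd_lie_algebra = lie_algebra br for br :: "'a::real_vector \<Rightarrow> 'a \<Rightarrow> 'a" +
  assumes fd: "finite_dim (UNIV :: 'a set)"
begin

abbreviation rad :: "'a set" where "rad \<equiv> lie_radical br UNIV"

lemma rad_radical: "is_lie_radical br UNIV rad"
  by (rule lie_radical_is_radical[OF lie_algebra_axioms fd lie_subalgebra_UNIV])

lemma rad_subspace: "subspace rad"
  and rad_ideal: "lie_ideal br UNIV rad"
  and rad_solvable: "lie_solvable br rad"
  and rad_maximal: "lie_ideal br UNIV I \<Longrightarrow> lie_solvable br I \<Longrightarrow> I \<subseteq> rad"
  using rad_radical unfolding is_lie_radical_def lie_ideal_def by blast+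

lemma br_rad_right: "t \<in> rad \<Longrightarrow> br x t \<in> rad"
  using rad_ideal by (auto simp: lie_ideal_def)

lemma br_rad_left: "t \<in> rad \<Longrightarrow> br t x \<in> rad"
  using br_rad_right[of t x] br_anti[of t x] rad_subspace by (simp add: subspace_neg)

lemma
  assumes "representation_of \<rho>"
  shows trace_form_bilinear: "bilinear (trace_form \<rho>)"
    and trace_form_sym: "trace_form \<rho> x y = trace_form \<rho> y x"
    and trace_form_inv: "trace_form \<rho> (br x y) z = trace_form \<rho> x (br y z)"
proof -
  have \<rho>: "bilinear \<rho>" and hom: "\<And>x y v. \<rho> (br x y) v = \<rho> x (\<rho> y v) - \<rho> y (\<rho> x v)"
    using assms by (auto simp: representation_of_def)
  have lin: "linear (\<rho> x)" for x using \<rho> by (simp add: bilinear_def)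
  have lin2: "linear (\<lambda>v. \<rho> x (\<rho> y v))" for x y using linear_compose[OF lin lin] by (simp add: o_def)
  have lin3: "linear (\<lambda>v. \<rho> x (\<rho> y (\<rho> z v)))" for x y z using linear_compose[OF lin2 lin] by (simp add: o_def)
  show "bilinear (trace_form \<rho>)" unfolding bilinear_def trace_form_def
    by (auto intro!: linearI simp: bilinear_ladd[OF \<rho>] bilinear_radd[OF \<rho>] bilinear_lmul[OF \<rho>] bilinear_rmul[OF \<rho>]
        trace_add[OF fd lin2 lin2] trace_scale[OF fd])
  show "trace_form \<rho> x y = trace_form \<rho> y x"
    unfolding trace_form_def by (rule trace_comm[OF fd lin lin])
  have "trace_form \<rho> (br x y) z = trace_of (\<lambda>v. \<rho> x (\<rho> y (\<rho> z v))) - trace_of (\<lambda>v. \<rho> y (\<rho> x (\<rho> z v)))"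
    unfolding trace_form_def hom by (rule trace_diff[OF fd lin3 lin3])
  also have "trace_of (\<lambda>v. \<rho> y (\<rho> x (\<rho> z v))) = trace_of (\<lambda>v. \<rho> x (\<rho> z (\<rho> y v)))"
    by (rule trace_comm[OF fd lin lin2])
  also have "trace_of (\<lambda>v. \<rho> x (\<rho> y (\<rho> z v))) - trace_of (\<lambda>v. \<rho> x (\<rho> z (\<rho> y v))) = trace_form \<rho> x (br y z)"
    unfolding trace_form_def hom linear_diff[OF lin] by (rule trace_diff[OF fd lin3 lin3, symmetric])
  finally show "trace_form \<rho> (br x y) z = trace_form \<rho> x (br y z)" .
qed

text \<open>
  A projection along the radical; operators on the quotient by the radical are represented as
  \<open>quot \<circ> T\<close>, which avoids a quotient type.
\<close>

definition quot :: "'a \<Rightarrow> 'a" where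
  "quot = (SOME q. linear q \<and> (\<forall>x\<in>rad. q x = 0) \<and> (\<forall>x. x - q x \<in> rad))"

lemma linear_quot: "linear quot"
  and quot_rad: "x \<in> rad \<Longrightarrow> quot x = 0"
  and diff_quot: "x - quot x \<in> rad"
  using someI_ex[OF projection_along[OF rad_subspace]] unfolding quot_def[symmetric] by blast+

lemma quot_eq_0_iff: "quot x = 0 \<longleftrightarrow> x \<in> rad"
  using quot_rad diff_quot[of x] by auto

lemma quot_quot: "quot (quot x) = quot x"
  using quot_rad[OF diff_quot[of x]] linear_diff[OF linear_quot] by simp

lemma quot_br_quot: "quot (br x (quot y)) = quot (br x y)"
  using quot_rad[OF br_rad_right[OF diff_quot], of x y] by (simp add: br_simps linear_diff[OF linear_quot])

definition ad_quot :: "'a \<Rightarrow> 'a \<Rightarrow> 'a" where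
  "ad_quot x y = quot (br x y)"

lemma representation_ad_quot: "representation_of ad_quot"
  unfolding representation_of_def
proof
  show "bilinear ad_quot" unfolding bilinear_def ad_quot_def
    using linear_compose[OF linear_br(1) linear_quot] linear_compose[OF linear_br(2) linear_quot] by (simp add: o_def)
  show "\<forall>x y v. ad_quot (br x y) v = ad_quot x (ad_quot y v) - ad_quot y (ad_quot x v)"
    by (simp add: ad_quot_def quot_br_quot jacobi_left linear_diff[OF linear_quot])
qed

text \<open>The Killing form of the quotient by the radical, pulled back. Its kernel is exactly the
  radical, by \<open>killing_rad\<close> and \<open>killing_nondegenerate\<close>.\<close>

definition killing :: "'a \<Rightarrow> 'a \<Rightarrow> real" where
  "killing = trace_form ad_quot"

lemmas killing_bilinear = trace_form_bilinear[OF representation_ad_quot, folded killing_def]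
  and killing_sym = trace_form_sym[OF representation_ad_quot, folded killing_def]
  and killing_inv = trace_form_inv[OF representation_ad_quot, folded killing_def]

lemma trace_form_rad:
  assumes "representation_of \<rho>" and "\<And>t v. t \<in> rad \<Longrightarrow> \<rho> t v = 0" and "t \<in> rad"
  shows "trace_form \<rho> t x = 0" "trace_form \<rho> x t = 0"
proof -
  show "trace_form \<rho> t x = 0" using assms by (simp add: trace_form_def trace_zero[OF fd])
  then show "trace_form \<rho> x t = 0" using trace_form_sym[OF assms(1)] by simp
qed

lemma killing_rad: assumes "t \<in> rad" shows "killing t x = 0" "killing x t = 0"
  using trace_form_rad[OF representation_ad_quot _ assms] br_rad_left
  by (auto simp: killing_def ad_quot_def quot_eq_0_iff)

text \<open>Cartan's criterion. The derived series of \<open>J\<close> becomes stationary at a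
  perfect ideal \<open>P\<close>. Being isotropic, \<open>P\<close> acts trivially modulo the
  radical, so P = [P, P] lies in the radical and \<open>J\<close> is solvable.\<close>

lemma killing_isotropic_ideal:
  assumes J: "lie_ideal br UNIV J" and iso: "\<And>x y. x \<in> J \<Longrightarrow> y \<in> J \<Longrightarrow> killing x y = 0"
  shows "J \<subseteq> rad"
proof -
  have subJ: "subspace J" using J by (simp add: lie_ideal_def)
  have algJ: "lie_subalgebra br J" by (rule lie_ideal_subalgebra[OF lie_subalgebra_UNIV J])
  obtain n where n: "\<And>k. dim (derived_series br J n) \<le> dim (derived_series br J k)"
    using ex_min_if_finite ex_has_least_nat[of "\<lambda>_. True" 0 "\<lambda>n. dim (derived_series br J n)"] by auto
  define P where "P = derived_series br J n"
  have idP: "lie_ideal br UNIV P" unfolding P_def by (rule derived_series_ideal[OF lie_subalgebra_UNIV J])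
  have algP: "lie_subalgebra br P" by (rule lie_ideal_subalgebra[OF lie_subalgebra_UNIV idP])
  have "derived_series br J k \<subseteq> J" for k
    using derived_series_Suc_subset[OF algJ] by (induction k) auto
  then have PJ: "P \<subseteq> J" by (simp add: P_def)
  have "derived_series br J (Suc n) = P"
    unfolding P_def by (rule subspace_dim_equal_fd[OF fd derived_series_subspace[OF subJ] derived_series_subspace[OF subJ]
        derived_series_Suc_subset[OF algJ] n])
  then have perfect: "span {br y z | y z. y \<in> P \<and> z \<in> P} = P" by (simp add: P_def)
  have "ad_quot x v = 0" if "x \<in> P" for x v
  proof (rule perfect_isotropic_acts_trivially[where \<rho> = ad_quot, OF fd algP _ _ _ _ that])
    show "bilinear ad_quot" using representation_ad_quot by (simp add: representation_of_def)
    show "ad_quot (br y z) v = ad_quot y (ad_quot z v) - ad_quot z (ad_quot y v)" for y z v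
      using representation_ad_quot by (simp add: representation_of_def)
    show "trace_of (\<lambda>v. ad_quot y (ad_quot z v)) = 0" if "y \<in> P" "z \<in> P" for y z
      using iso that PJ unfolding killing_def trace_form_def by blast
    show "\<exists>t. (\<forall>v. ad_quot t v = 0) \<and> x - t \<in> span {br y z | y z. y \<in> P \<and> z \<in> P}" if "x \<in> P" for x
      by (rule exI[of _ 0]) (simp add: perfect that ad_quot_def br_simps linear_0[OF linear_quot])
  qed
  then have "br x v \<in> rad" if "x \<in> P" for x v using that by (simp add: ad_quot_def quot_eq_0_iff)
  then have "span {br y z | y z. y \<in> P \<and> z \<in> P} \<subseteq> rad" by (intro span_minimal rad_subspace) blast
  then have "derived_series br J n \<subseteq> rad" unfolding perfect by (simp only: P_def)
  then show ?thesis using solvable_if_derived_subset[OF subJ _ rad_solvable] rad_maximal[OF J] by blast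
qed

section \<open>Orthogonal ideals, dual families and Casimir operators\<close>

definition perp :: "'a set \<Rightarrow> 'a set" where
  "perp J = {x. \<forall>y\<in>J. killing x y = 0}"

lemma perp_ideal:
  assumes J: "lie_ideal br UNIV J"
  shows "lie_ideal br UNIV (perp J)"
  unfolding lie_ideal_def
proof (intro conjI ballI)
  note b = killing_bilinear
  show "subspace (perp J)" unfolding subspace_def perp_def
    by (auto simp: bilinear_ladd[OF b] bilinear_lmul[OF b] bilinear_lzero[OF b])
  show "br x y \<in> perp J" if "y \<in> perp J" for x y
  proof -
    have "killing (br x y) z = 0" if "z \<in> J" for z
    proof -
      have "br x z \<in> J" using J that by (simp add: lie_ideal_def)
      then have "killing y (br x z) = 0" using \<open>y \<in> perp J\<close> by (simp add: perp_def)
      then have "killing (br y x) z = 0" by (simp add: killing_inv)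
      then show ?thesis using br_anti[of x y] by (simp add: bilinear_lneg[OF b])
    qed
    then show ?thesis by (simp add: perp_def)
  qed
qed simp

lemma ideal_inter_perp:
  assumes J: "lie_ideal br UNIV J"
  shows "J \<inter> perp J \<subseteq> rad"
proof (rule killing_isotropic_ideal)
  show "lie_ideal br UNIV (J \<inter> perp J)"
    using J perp_ideal[OF J] by (auto simp: lie_ideal_def subspace_inter)
qed (auto simp: perp_def)

text \<open>The elements \<open>e\<close> and \<open>f e\<close> represent dual bases of
  \<open>J\<close> modulo the radical.\<close>

definition dual_family :: "('a \<Rightarrow> 'a \<Rightarrow> real) \<Rightarrow> 'a set \<Rightarrow> 'a set \<Rightarrow> ('a \<Rightarrow> 'a) \<Rightarrow> bool" where
  "dual_family \<beta> J E f \<longleftrightarrow> finite E \<and> E \<subseteq> J \<and> f ` E \<subseteq> J \<and> (\<forall>d\<in>E. \<forall>e\<in>E. \<beta> d (f e) = (if d = e then 1 else 0))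
    \<and> (\<forall>y\<in>J. y - (\<Sum>e\<in>E. \<beta> y (f e) *\<^sub>R e) \<in> rad) \<and> (\<forall>y\<in>J. y - (\<Sum>e\<in>E. \<beta> e y *\<^sub>R f e) \<in> rad)"

text \<open>The image \<open>M\<close> of \<open>J\<close> under \<open>quot\<close> is a complement
  of the radical in \<open>J\<close>. There \<open>\<beta>\<close> is nondegenerate and has ordinary
  dual bases, whose expansions hold on all of \<open>J\<close> up to the radical.\<close>

lemma dual_family_mod_rad:
  assumes b: "bilinear (\<beta> :: 'a \<Rightarrow> 'a \<Rightarrow> real)" and b0: "\<And>t x. t \<in> rad \<Longrightarrow> \<beta> t x = 0" "\<And>t x. t \<in> rad \<Longrightarrow> \<beta> x t = 0"
    and J: "subspace J" "rad \<subseteq> J"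
    and nondeg: "\<And>y. y \<in> J \<Longrightarrow> (\<And>x. x \<in> J \<Longrightarrow> \<beta> x y = 0) \<Longrightarrow> y \<in> rad"
  shows "\<exists>E f. dual_family \<beta> J E f"
proof -
  define M where "M = quot ` J"
  have subM: "subspace M" unfolding M_def using J linear_quot by (simp add: linear_subspace_image)
  have MJ: "M \<subseteq> J"
  proof
    fix y assume "y \<in> M"
    then obtain z where z: "z \<in> J" "y = quot z" by (auto simp: M_def)
    have "z - quot z \<in> J" using diff_quot J by blast
    from subspace_diff[OF J(1) z(1) this] show "y \<in> J" using z by simp
  qed
  have bq: "\<beta> (quot x) y = \<beta> x y" "\<beta> y (quot x) = \<beta> y x" for x y
    using b0[OF diff_quot[of x], of y] by (simp_all add: bilinear_lsub[OF b] bilinear_rsub[OF b])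
  have "y = 0" if "y \<in> M" "\<And>x. x \<in> M \<Longrightarrow> \<beta> x y = 0" for y
  proof -
    have "\<beta> x y = 0" if "x \<in> J" for x using \<open>\<And>x. x \<in> M \<Longrightarrow> \<beta> x y = 0\<close>[of "quot x"] that bq M_def by auto
    then have "y \<in> rad" using nondeg that(1) MJ by blast
    then have "quot y = 0" by (rule quot_rad)
    then show ?thesis using that(1) quot_quot by (auto simp: M_def)
  qed
  then obtain E f where Ef: "finite E" "E \<subseteq> M" "f ` E \<subseteq> M"
    "\<forall>d\<in>E. \<forall>e\<in>E. \<beta> d (f e) = (if d = e then 1 else 0)"
    "\<forall>y\<in>M. y = (\<Sum>e\<in>E. \<beta> y (f e) *\<^sub>R e)" "\<forall>y\<in>M. y = (\<Sum>e\<in>E. \<beta> e y *\<^sub>R f e)"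
    using dual_basis_fd[OF fd subM b] by blast
  have "y - (\<Sum>e\<in>E. \<beta> y (f e) *\<^sub>R e) \<in> rad" "y - (\<Sum>e\<in>E. \<beta> e y *\<^sub>R f e) \<in> rad" if "y \<in> J" for y
  proof -
    have "quot y \<in> M" using that M_def by blast
    then have "quot y = (\<Sum>e\<in>E. \<beta> (quot y) (f e) *\<^sub>R e)" "quot y = (\<Sum>e\<in>E. \<beta> e (quot y) *\<^sub>R f e)"
      using Ef by blast+
    then show "y - (\<Sum>e\<in>E. \<beta> y (f e) *\<^sub>R e) \<in> rad" "y - (\<Sum>e\<in>E. \<beta> e y *\<^sub>R f e) \<in> rad"
      using diff_quot[of y] unfolding bq by metis+
  qed
  then have "dual_family \<beta> J E f" using Ef MJ unfolding dual_family_def by blast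
  then show ?thesis by blast
qed

text \<open>The tensor \<open>\<Sum>e\<in>E. e \<otimes> f e\<close> is invariant modulo the radical.\<close>

definition invariant_family :: "'a set \<Rightarrow> ('a \<Rightarrow> 'a) \<Rightarrow> bool" where
  "invariant_family E f \<longleftrightarrow> finite E \<and>
    (\<forall>x (b::'a\<Rightarrow>'a\<Rightarrow>'a). bilinear b \<longrightarrow> (\<forall>t\<in>rad. \<forall>y. b t y = 0 \<and> b y t = 0) \<longrightarrow>
      (\<Sum>e\<in>E. b (br x e) (f e)) + (\<Sum>e\<in>E. b e (br x (f e))) = 0)"

text \<open>Expand both kinds of brackets in the family. After a swap of indices the coefficients
  are \<open>\<beta> (br x e) (f d)\<close> and \<open>\<beta> e (br x (f d))\<close>, which
  invariance of \<open>\<beta>\<close> makes opposite.\<close>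

lemma dual_family_invariant:
  assumes b: "bilinear (\<beta> :: 'a \<Rightarrow> 'a \<Rightarrow> real)" and inv: "\<And>x y z. \<beta> (br x y) z = \<beta> x (br y z)"
    and J: "lie_ideal br UNIV J"
    and dual: "dual_family \<beta> J E f"
  shows "invariant_family E f"
  unfolding invariant_family_def
proof (intro conjI allI impI)
  have E: "finite E" "E \<subseteq> J" "f ` E \<subseteq> J"
    and ex: "\<And>y. y \<in> J \<Longrightarrow> y - (\<Sum>e\<in>E. \<beta> y (f e) *\<^sub>R e) \<in> rad" "\<And>y. y \<in> J \<Longrightarrow> y - (\<Sum>e\<in>E. \<beta> e y *\<^sub>R f e) \<in> rad"
    using dual by (auto simp: dual_family_def)
  show "finite E" by (rule E)
  fix x and c :: "'a \<Rightarrow> 'a \<Rightarrow> 'a"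
  assume c: "bilinear c" and c0: "\<forall>t\<in>rad. \<forall>y. c t y = 0 \<and> c y t = 0"
  have linc: "linear (\<lambda>u. c u y)" "linear (c y)" for y using c by (auto simp: bilinear_def)
  have brJ: "br x y \<in> J" if "y \<in> J" for y using J that by (simp add: lie_ideal_def)
  have 1: "c (br x e) (f e) = (\<Sum>d\<in>E. \<beta> (br x e) (f d) *\<^sub>R c d (f e))" if "e \<in> E" for e
  proof -
    have "br x e - (\<Sum>d\<in>E. \<beta> (br x e) (f d) *\<^sub>R d) \<in> rad" using ex(1) brJ E that by blast
    then have "c (br x e - (\<Sum>d\<in>E. \<beta> (br x e) (f d) *\<^sub>R d)) (f e) = 0" using c0 by blast
    then show ?thesis by (simp add: linear_diff[OF linc(1)] linear_sum[OF linc(1)] linear_scale[OF linc(1)])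
  qed
  have 2: "c e (br x (f e)) = (\<Sum>d\<in>E. \<beta> d (br x (f e)) *\<^sub>R c e (f d))" if "e \<in> E" for e
  proof -
    have "br x (f e) - (\<Sum>d\<in>E. \<beta> d (br x (f e)) *\<^sub>R f d) \<in> rad" using ex(2) brJ E that by blast
    then have "c e (br x (f e) - (\<Sum>d\<in>E. \<beta> d (br x (f e)) *\<^sub>R f d)) = 0" using c0 by blast
    then show ?thesis by (simp add: linear_diff[OF linc(2)] linear_sum[OF linc(2)] linear_scale[OF linc(2)])
  qed
  have "(\<Sum>e\<in>E. c (br x e) (f e)) = (\<Sum>e\<in>E. \<Sum>d\<in>E. \<beta> (br x e) (f d) *\<^sub>R c d (f e))"
    using 1 by (intro sum.cong) auto
  moreover have "(\<Sum>e\<in>E. c e (br x (f e))) = (\<Sum>e\<in>E. \<Sum>d\<in>E. \<beta> d (br x (f e)) *\<^sub>R c e (f d))"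
    using 2 by (intro sum.cong) auto
  moreover have "\<dots> = (\<Sum>e\<in>E. \<Sum>d\<in>E. \<beta> e (br x (f d)) *\<^sub>R c d (f e))" by (rule sum.swap)
  moreover have "\<beta> (br x e) (f d) = - \<beta> e (br x (f d))" for d e
    using inv[of e x "f d"] br_anti[of x e] by (simp add: bilinear_lneg[OF b])
  ultimately show "(\<Sum>e\<in>E. c (br x e) (f e)) + (\<Sum>e\<in>E. c e (br x (f e))) = 0"
    by (simp add: sum_negf)
qed

lemma UNIV_ideal: "lie_ideal br UNIV UNIV"
  by (simp add: lie_ideal_def)

lemma killing_nondegenerate:
  assumes J: "lie_ideal br UNIV J" and "y \<in> J" and "\<And>x. x \<in> J \<Longrightarrow> killing x y = 0"
  shows "y \<in> rad"
  using ideal_inter_perp[OF J] assms killing_sym[of y] by (auto simp: perp_def)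

lemma killing_dual_family:
  assumes J: "lie_ideal br UNIV J" "rad \<subseteq> J"
  shows "\<exists>E f. dual_family killing J E f"
proof (rule dual_family_mod_rad[OF killing_bilinear killing_rad(1) killing_rad(2) _ J(2)])
  show "subspace J" using J by (simp add: lie_ideal_def)
  show "y \<in> rad" if "y \<in> J" "\<And>x. x \<in> J \<Longrightarrow> killing x y = 0" for y
    using killing_nondegenerate[OF J(1)] that by blast
qed

lemma ideal_plus_perp:
  assumes J: "lie_ideal br UNIV J" "rad \<subseteq> J"
  shows "\<exists>y\<in>J. x - y \<in> perp J"
proof -
  obtain E f where "dual_family killing J E f" using killing_dual_family[OF J] by blast
  then have E: "finite E" "E \<subseteq> J" "f ` E \<subseteq> J" and dual: "\<forall>d\<in>E. \<forall>e\<in>E. killing d (f e) = (if d = e then 1 else 0)"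
    and ex: "\<forall>y\<in>J. y - (\<Sum>e\<in>E. killing e y *\<^sub>R f e) \<in> rad"
    by (simp_all add: dual_family_def)
  have subJ: "subspace J" using J by (simp add: lie_ideal_def)
  note b = killing_bilinear
  have lin: "linear (killing y)" "linear (\<lambda>y. killing y z)" for y z using b by (auto simp: bilinear_def)
  \<comment> \<open>The orthogonal projection of \<open>x\<close> to \<open>J\<close>: it has the
    same pairings with the \<open>f d\<close> as \<open>x\<close>.\<close>
  define y where "y = (\<Sum>e\<in>E. killing x (f e) *\<^sub>R e)"
  have yJ: "y \<in> J" unfolding y_def using E subJ by (auto intro!: subspace_sum subspace_scale)
  have kf: "killing (x - y) (f d) = 0" if "d \<in> E" for d
  proof -
    have "killing y (f d) = (\<Sum>e\<in>E. killing x (f e) * killing e (f d))"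
      unfolding y_def by (simp add: linear_sum[OF lin(2)] linear_scale[OF lin(2)])
    also have "\<dots> = (\<Sum>e\<in>E. if e = d then killing x (f e) else 0)"
      using dual that by (intro sum.cong) auto
    finally show ?thesis using that E by (simp add: linear_diff[OF lin(2)])
  qed
  have "killing (x - y) z = 0" if "z \<in> J" for z
  proof -
    have "killing (x - y) (z - (\<Sum>e\<in>E. killing e z *\<^sub>R f e)) = 0" using ex that killing_rad by blast
    then show ?thesis using kf by (simp add: linear_diff[OF lin(1)] linear_sum[OF lin(1)] linear_scale[OF lin(1)])
  qed
  then show ?thesis using yJ by (auto simp: perp_def)
qed

text \<open>By invariance, an element orthogonal to [g, g] + rad has all its brackets in the kernel
  of the Killing form, that is, in the radical. So the orthogonal ideal is solvable and lies in the
  radical, and [g, g] + rad is everything.\<close>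

lemma perfect_mod_rad: "\<exists>t\<in>rad. x - t \<in> span {br y z | y z. True}"
proof -
  let ?D = "span {br y z | y z. True}"
  define J where "J = {a + t | a t. a \<in> ?D \<and> t \<in> rad}"
  have subJ: "subspace J" unfolding J_def using rad_subspace by (intro subspace_sums) auto
  have DJ: "a \<in> J" if "a \<in> ?D" for a
  proof -
    have "a + 0 \<in> J" unfolding J_def using that subspace_0[OF rad_subspace] by blast
    then show ?thesis by simp
  qed
  have brJ: "br y z \<in> J" for y z by (rule DJ) (auto intro: span_base)
  have idJ: "lie_ideal br UNIV J" using subJ brJ by (simp add: lie_ideal_def)
  have radJ: "rad \<subseteq> J"
  proof
    fix t assume "t \<in> rad"
    then have "0 + t \<in> J" unfolding J_def using span_zero by blast
    then show "t \<in> J" by simp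
  qed
  have perpbr: "br u v \<in> rad" if "u \<in> perp J" for u v
  proof (rule killing_nondegenerate[OF UNIV_ideal])
    fix z
    have "killing (br u v) z = 0" using that brJ by (simp add: killing_inv perp_def)
    then show "killing z (br u v) = 0" using killing_sym by simp
  qed simp
  have "perp J \<subseteq> rad"
  proof (rule rad_maximal[OF perp_ideal[OF idJ]])
    have "derived_series br (perp J) 1 \<subseteq> rad"
      unfolding One_nat_def derived_series.simps by (rule span_minimal[OF _ rad_subspace]) (use perpbr in blast)
    moreover have "subspace (perp J)" using perp_ideal[OF idJ] by (simp add: lie_ideal_def)
    ultimately show "lie_solvable br (perp J)" using solvable_if_derived_subset[OF _ _ rad_solvable] by blast
  qed
  then obtain y where y: "y \<in> J" "x - y \<in> rad" using ideal_plus_perp[OF idJ radJ, of x] by blast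
  then obtain a t where at: "a \<in> ?D" "t \<in> rad" "y = a + t" by (auto simp: J_def)
  have "t + (x - y) \<in> rad" by (rule subspace_add[OF rad_subspace at(2) y(2)])
  moreover have "x - (t + (x - y)) = a" using at by simp
  ultimately show ?thesis using at by metis
qed

text \<open>Computing the trace \<open>killing x y\<close> in the dual family and moving brackets by
  invariance gives \<open>killing (\<Omega> x) y\<close>, with \<Omega> the Casimir operator. Hence
  \<open>\<Omega> x - x\<close> is orthogonal to everything.\<close>

lemma killing_casimir:
  "\<exists>E f. invariant_family E f \<and> (\<forall>x. (\<Sum>e\<in>E. br e (br (f e) x)) - x \<in> rad)"
proof -
  obtain E f where dual: "dual_family killing UNIV E f" using killing_dual_family[OF UNIV_ideal] by blast
  then have ex: "y - (\<Sum>e\<in>E. killing y (f e) *\<^sub>R e) \<in> rad" for y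
    by (simp add: dual_family_def)
  note b = killing_bilinear
  have lin: "linear (killing y)" "linear (\<lambda>y. killing y z)" for y z using b by (auto simp: bilinear_def)
  have inv: "invariant_family E f"
    by (rule dual_family_invariant[OF b killing_inv UNIV_ideal dual])
  have "(\<Sum>e\<in>E. br e (br (f e) x)) - x \<in> rad" for x
  proof (rule killing_nondegenerate[OF UNIV_ideal])
    fix y
    have "ad_quot x (ad_quot y v) = (\<Sum>e\<in>E. killing (br x (br y v)) (f e) *\<^sub>R quot e)" for v
    proof -
      let ?z = "br x (br y v)"
      have "quot (?z - (\<Sum>e\<in>E. killing ?z (f e) *\<^sub>R e)) = 0" using ex quot_rad by blast
      then show ?thesis
        by (simp add: ad_quot_def quot_br_quot linear_diff[OF linear_quot] linear_sum[OF linear_quot] linear_scale[OF linear_quot])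
    qed
    then have "killing x y = (\<Sum>e\<in>E. killing (br x (br y (quot e))) (f e))"
      unfolding killing_def[of] trace_form_def[of ad_quot x y]
      by (rule trace_finite_rank[OF fd]) (use linear_compose[OF linear_compose[OF linear_br(1) linear_br(1)] lin(2)] in \<open>simp add: o_def killing_def\<close>)
    also have "\<dots> = (\<Sum>e\<in>E. killing (br e (br (f e) x)) y)"
    proof (rule sum.cong[OF refl])
      fix e assume "e \<in> E"
      have "killing (br x (br y (quot e))) (f e) = killing (br x (br y e)) (f e)"
        using killing_rad(1)[OF br_rad_right[OF br_rad_right[OF diff_quot]], of x y e "f e"]
        by (simp add: br_simps bilinear_lsub[OF b])
      also have "\<dots> = - killing (br (br y e) x) (f e)"
        using br_anti[of x "br y e"] by (simp add: bilinear_lneg[OF b])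
      also have "\<dots> = - killing (br y e) (br x (f e))" by (simp add: killing_inv)
      also have "\<dots> = killing (br y e) (br (f e) x)"
        using br_anti[of x "f e"] by (simp add: bilinear_rneg[OF b])
      also have "\<dots> = killing y (br e (br (f e) x))" by (simp add: killing_inv)
      finally show "killing (br x (br y (quot e))) (f e) = killing (br e (br (f e) x)) y" using killing_sym by simp
    qed
    finally have "killing ((\<Sum>e\<in>E. br e (br (f e) x)) - x) y = 0"
      by (simp add: linear_diff[OF lin(2)] linear_sum[OF lin(2)])
    then show "killing y ((\<Sum>e\<in>E. br e (br (f e) x)) - x) = 0" using killing_sym by simp
  qed simp
  then show ?thesis using inv by blast
qed

text \<open>The trace form of \<open>\<rho>\<close> may have a kernel \<open>S0\<close> larger than
  the radical, but it is nondegenerate modulo the radical on the Killing-orthogonal ideal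
  \<open>S1\<close>. The Casimir operator of a dual family of \<open>S1\<close> has trace
  \<open>card E\<close>. If \<open>E\<close> were empty the trace form would vanish, and Cartan's
  argument would make \<open>\<rho>\<close> zero.\<close>

lemma representation_casimir:
  assumes rep: "representation_of \<rho>" and rad0: "\<And>t v. t \<in> rad \<Longrightarrow> \<rho> t v = 0" and nz: "\<rho> x0 v0 \<noteq> 0"
  shows "\<exists>E f. invariant_family E f \<and> trace_of (\<lambda>v. \<Sum>e\<in>E. \<rho> e (\<rho> (f e) v)) \<noteq> 0"
proof -
  let ?B = "trace_form \<rho>"
  have \<rho>: "bilinear \<rho>" and hom: "\<And>x y v. \<rho> (br x y) v = \<rho> x (\<rho> y v) - \<rho> y (\<rho> x v)"
    using rep by (auto simp: representation_of_def)
  have lin: "linear (\<rho> x)" for x using \<rho> by (simp add: bilinear_def)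
  have lin2: "linear (\<lambda>v. \<rho> x (\<rho> y v))" for x y using linear_compose[OF lin lin] by (simp add: o_def)
  note b = trace_form_bilinear[OF rep] and sym = trace_form_sym[OF rep] and inv = trace_form_inv[OF rep]
  have B0: "?B t x = 0" "?B x t = 0" if "t \<in> rad" for t x
    by (rule trace_form_rad[OF rep _ that], erule rad0)+
  define S0 where "S0 = {x. \<forall>y. ?B x y = 0}"
  have idS0: "lie_ideal br UNIV S0"
    unfolding lie_ideal_def
  proof (intro conjI ballI)
    show "subspace S0" unfolding subspace_def S0_def
      by (auto simp: bilinear_ladd[OF b] bilinear_lmul[OF b] bilinear_lzero[OF b])
    show "br x y \<in> S0" if "y \<in> S0" for x y
      using that br_anti[of x y] inv by (simp add: S0_def bilinear_lneg[OF b])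
  qed simp
  have radS0: "rad \<subseteq> S0" using B0 by (auto simp: S0_def)
  define S1 where "S1 = perp S0"
  have idS1: "lie_ideal br UNIV S1" unfolding S1_def by (rule perp_ideal[OF idS0])
  have radS1: "rad \<subseteq> S1" using killing_rad by (auto simp: S1_def perp_def)
  have nondeg: "y \<in> rad" if y: "y \<in> S1" and B: "\<And>x. x \<in> S1 \<Longrightarrow> ?B x y = 0" for y
  proof -
    have "?B x y = 0" for x
    proof -
      obtain z where "z \<in> S0" "x - z \<in> S1" using ideal_plus_perp[OF idS0 radS0, of x] by (auto simp: S1_def)
      then have "?B z y = 0" "?B (x - z) y = 0" using B by (auto simp: S0_def)
      then show ?thesis by (simp add: bilinear_lsub[OF b])
    qed
    then have "y \<in> S0" using sym by (auto simp: S0_def)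
    then show ?thesis using y ideal_inter_perp[OF idS0] by (auto simp: S1_def)
  qed
  have subS1: "subspace S1" using idS1 by (simp add: lie_ideal_def)
  have "\<exists>E f. dual_family ?B S1 E f"
    by (rule dual_family_mod_rad[OF b B0(1) B0(2) subS1 radS1 nondeg])
  then obtain E f where df: "dual_family ?B S1 E f" by blast
  then have E: "finite E" and dual: "\<forall>d\<in>E. \<forall>e\<in>E. ?B d (f e) = (if d = e then 1 else 0)"
    and ex: "\<And>y. y\<in>S1 \<Longrightarrow> y - (\<Sum>e\<in>E. ?B y (f e) *\<^sub>R e) \<in> rad"
    by (auto simp: dual_family_def)
  have "invariant_family E f"
    by (rule dual_family_invariant[OF b inv idS1 df])
  moreover have "trace_of (\<lambda>v. \<Sum>e\<in>E. \<rho> e (\<rho> (f e) v)) = card E"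
  proof -
    have "trace_of (\<lambda>v. \<Sum>e\<in>E. \<rho> e (\<rho> (f e) v)) = (\<Sum>e\<in>E. ?B e (f e))"
      unfolding trace_form_def by (rule trace_sum[OF fd lin2])
    also have "\<dots> = (\<Sum>e\<in>E. 1)" using dual by (intro sum.cong) auto
    finally show ?thesis by simp
  qed
  moreover have "E \<noteq> {}"
  proof
    assume "E = {}"
    then have "S1 \<subseteq> rad" using ex by auto
    have B00: "?B x y = 0" for x y
    proof -
      obtain z where "z \<in> S0" "x - z \<in> S1" using ideal_plus_perp[OF idS0 radS0, of x] by (auto simp: S1_def)
      then have "?B z y = 0" "?B (x - z) y = 0" using \<open>S1 \<subseteq> rad\<close> B0(1) by (auto simp: S0_def)
      then show ?thesis by (simp add: bilinear_lsub[OF b])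
    qed
    have "\<rho> x0 v0 = 0"
    proof (rule perfect_isotropic_acts_trivially[OF fd lie_subalgebra_UNIV \<rho> hom])
      show "trace_of (\<lambda>v. \<rho> y (\<rho> z v)) = 0" for y z using B00 unfolding trace_form_def by blast
      show "\<exists>t. (\<forall>v. \<rho> t v = 0) \<and> x - t \<in> span {br y z | y z. y \<in> UNIV \<and> z \<in> UNIV}" for x
        using perfect_mod_rad[of x] rad0 by auto
    qed simp
    then show False using nz by simp
  qed
  ultimately show ?thesis using E by (metis card_eq_0_iff of_nat_eq_0_iff)
qed

end

section \<open>Splitting one layer of the radical\<close>

text \<open>\<open>rad\<close> stays the radical of the whole algebra throughout the descent; only
  \<open>H\<close> and \<open>H \<inter> rad\<close> shrink. As H + rad is everything,
  \<open>H / K\<close> is the whole algebra modulo \<open>rad\<close>, and this semisimple quotient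
  acts on the abelian \<open>K / K'\<close>.\<close>

locale radical_layer = fd_lie_algebra br for br :: "'a::real_vector \<Rightarrow> 'a \<Rightarrow> 'a" +
  fixes H K' :: "'a set"
  assumes H: "lie_subalgebra br H" and H_rad: "\<exists>y\<in>H. x - y \<in> rad"
    and K'_subspace: "subspace K'" and K'_sub: "K' \<subseteq> H \<inter> rad"
    and K'_stable: "x \<in> H \<Longrightarrow> v \<in> K' \<Longrightarrow> br x v \<in> K'"
    and K_abelian: "v \<in> H \<inter> rad \<Longrightarrow> w \<in> H \<inter> rad \<Longrightarrow> br v w \<in> K'"
begin

abbreviation "K \<equiv> H \<inter> rad"

lemma H_subspace: "subspace H" and br_H: "x \<in> H \<Longrightarrow> y \<in> H \<Longrightarrow> br x y \<in> H"
  using H by (auto simp: lie_subalgebra_def)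

lemma K_subspace: "subspace K"
  using H_subspace rad_subspace by (rule subspace_inter)

lemma br_K: "x \<in> H \<Longrightarrow> v \<in> K \<Longrightarrow> br x v \<in> K" "x \<in> H \<Longrightarrow> v \<in> K \<Longrightarrow> br v x \<in> K"
  using br_H br_rad_right br_rad_left by blast+

lemma K'_stable_left: "x \<in> H \<Longrightarrow> v \<in> K' \<Longrightarrow> br v x \<in> K'"
  using K'_stable[of x v] br_anti[of v x] subspace_neg[OF K'_subspace] by simp

text \<open>
  \<open>splitting c p\<close>: modulo \<open>K'\<close>, the map \<open>p\<close> is a derivation \<open>H \<rightarrow> K / K'\<close> that is multiplication by \<open>c\<close> on \<open>K / K'\<close>.
\<close>

definition splitting :: "real \<Rightarrow> ('a \<Rightarrow> 'a) \<Rightarrow> bool" where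
  "splitting c p \<longleftrightarrow> linear p \<and> (\<forall>x\<in>H. p x \<in> K) \<and> (\<forall>v\<in>K. p v - c *\<^sub>R v \<in> K') \<and>
     (\<forall>x\<in>H. \<forall>y\<in>H. p (br x y) - (br x (p y) + br (p x) y) \<in> K')"

text \<open>All three claims use that \<open>K'\<close> is stable and \<open>p\<close> is the
  identity on \<open>K\<close> modulo \<open>K'\<close>. In particular \<open>p (p y)\<close> and
  \<open>p y\<close> agree modulo \<open>K'\<close>, so \<open>y - p y\<close> is in the kernel and
  differs from \<open>y\<close> only by an element of the radical.\<close>

lemma splitting_kernel:
  assumes p: "splitting 1 p" and H': "H' = {x \<in> H. p x \<in> K'}"
  shows "lie_subalgebra br H'" "H' \<inter> rad = K'" "\<exists>y\<in>H'. x - y \<in> rad"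
proof -
  have lin: "linear p" and pK: "\<And>x. x \<in> H \<Longrightarrow> p x \<in> K" and pid: "\<And>v. v \<in> K \<Longrightarrow> p v - v \<in> K'"
    and der: "\<And>x y. x \<in> H \<Longrightarrow> y \<in> H \<Longrightarrow> p (br x y) - (br x (p y) + br (p x) y) \<in> K'"
    using p by (auto simp: splitting_def)
  have sub: "subspace H'" unfolding H' subspace_def
    using H_subspace K'_subspace by (auto simp: linear_add[OF lin] linear_scale[OF lin] linear_0[OF lin] subspace_add subspace_scale subspace_0)
  have "br x y \<in> H'" if xy: "x \<in> H'" "y \<in> H'" for x y
  proof -
    have x: "x \<in> H" "p x \<in> K'" and y: "y \<in> H" "p y \<in> K'" using xy by (auto simp: H')
    have "br x (p y) + br (p x) y \<in> K'"
      using x y by (intro subspace_add K'_subspace K'_stable K'_stable_left)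
    then have "(p (br x y) - (br x (p y) + br (p x) y)) + (br x (p y) + br (p x) y) \<in> K'"
      using subspace_add[OF K'_subspace der[OF x(1) y(1)]] by blast
    then show ?thesis using br_H x y by (simp add: H')
  qed
  then show "lie_subalgebra br H'" using sub by (simp add: lie_subalgebra_def)
  show "H' \<inter> rad = K'"
  proof
    show "H' \<inter> rad \<subseteq> K'"
    proof
      fix v assume v: "v \<in> H' \<inter> rad"
      then have "p v - v \<in> K'" "p v \<in> K'" using pid by (auto simp: H')
      then have "p v - (p v - v) \<in> K'" using subspace_diff[OF K'_subspace] by blast
      then show "v \<in> K'" by simp
    qed
    show "K' \<subseteq> H' \<inter> rad"
    proof
      fix v assume v: "v \<in> K'"
      then have "p v - v \<in> K'" using pid K'_sub by blast
      then have "(p v - v) + v \<in> K'" using subspace_add[OF K'_subspace] v by blast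
      then show "v \<in> H' \<inter> rad" using v K'_sub by (auto simp: H')
    qed
  qed
  obtain y where y: "y \<in> H" "x - y \<in> rad" using H_rad by blast
  have "p (p y) - p y \<in> K'" using pid[OF pK[OF y(1)]] .
  then have "- (p (p y) - p y) \<in> K'" by (rule subspace_neg[OF K'_subspace])
  then have "p (y - p y) \<in> K'" by (simp add: linear_diff[OF lin])
  moreover have "y - p y \<in> H" using pK[OF y(1)] y by (auto intro: subspace_diff[OF H_subspace])
  ultimately have "y - p y \<in> H'" by (simp add: H')
  moreover have "(x - y) + p y \<in> rad" using y pK[OF y(1)] by (intro subspace_add[OF rad_subspace]) auto
  then have "x - (y - p y) \<in> rad" by (simp add: algebra_simps)
  ultimately show "\<exists>y\<in>H'. x - y \<in> rad" by blast
qed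

text \<open>Casimir families consist of elements of the whole algebra, whereas \<open>H\<close> acts
  on the layer; \<open>toH\<close> moves each element into \<open>H\<close> modulo
  \<open>rad\<close>. It is merely linear and respects brackets with \<open>H\<close> up to
  \<open>K\<close>.\<close>

definition toH :: "'a \<Rightarrow> 'a" where
  "toH = (SOME \<eta>. linear \<eta> \<and> (\<forall>x. \<eta> x \<in> H) \<and> (\<forall>x. x - \<eta> x \<in> rad) \<and> (\<forall>x\<in>H. \<eta> x = x))"

lemma linear_toH: "linear toH" and toH_H: "toH x \<in> H" and diff_toH: "x - toH x \<in> rad" and toH_id: "x \<in> H \<Longrightarrow> toH x = x"
  using someI_ex[OF projection_onto_mod[OF H_subspace rad_subspace H_rad]] unfolding toH_def[symmetric] by blast+

lemma toH_rad: "t \<in> rad \<Longrightarrow> toH t \<in> K"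
  using toH_H[of t] subspace_diff[OF rad_subspace _ diff_toH[of t], of t] by simp

lemma diff_toH': "toH x - x \<in> rad"
  using subspace_neg[OF rad_subspace diff_toH[of x]] by simp

lemma toH_br: assumes "x \<in> H" shows "toH (br x y) - br x (toH y) \<in> K"
proof -
  have "toH (br x y) - br x y \<in> rad" by (rule diff_toH')
  moreover have "br x (y - toH y) \<in> rad" by (rule br_rad_right[OF diff_toH])
  ultimately have "(toH (br x y) - br x y) + br x (y - toH y) \<in> rad" by (rule subspace_add[OF rad_subspace])
  then have "toH (br x y) - br x (toH y) \<in> rad" by (simp add: br_simps)
  moreover have "toH (br x y) - br x (toH y) \<in> H"
    by (intro subspace_diff H_subspace toH_H br_H assms)
  ultimately show ?thesis by blast
qed

text \<open>A bilinear map that kills \<open>K\<close> on either side does not see the errors of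
  \<open>toH\<close>; composed with \<open>toH\<close> it kills the radical, so the invariance of
  the family applies.\<close>

lemma invariant_family_H:
  assumes inv: "invariant_family E f" and b: "bilinear (b :: 'a \<Rightarrow> 'a \<Rightarrow> 'a)"
    and b0: "\<And>v y. v \<in> K \<Longrightarrow> y \<in> H \<Longrightarrow> b v y = 0" "\<And>v y. v \<in> K \<Longrightarrow> y \<in> H \<Longrightarrow> b y v = 0"
    and x: "x \<in> H"
  shows "(\<Sum>e\<in>E. b (br x (toH e)) (toH (f e))) + (\<Sum>e\<in>E. b (toH e) (br x (toH (f e)))) = 0"
proof -
  have linb: "linear (b y)" "linear (\<lambda>x. b x y)" for y using b by (auto simp: bilinear_def)
  define c where "c y z = b (toH y) (toH z)" for y z
  have "bilinear c" unfolding bilinear_def c_def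
    using linear_compose[OF linear_toH linb(1)] linear_compose[OF linear_toH linb(2)] by (simp add: o_def)
  moreover have "c t y = 0" "c y t = 0" if "t \<in> rad" for t y
    using b0 toH_rad[OF that] toH_H by (auto simp: c_def)
  ultimately have "(\<Sum>e\<in>E. c (br x e) (f e)) + (\<Sum>e\<in>E. c e (br x (f e))) = 0"
    using inv unfolding invariant_family_def by blast
  moreover have "b (toH (br x e)) (toH y) = b (br x (toH e)) (toH y)" for e y
    using b0(1)[OF toH_br[OF x, of e] toH_H[of y]] by (simp add: linear_diff[OF linb(2)])
  moreover have "b (toH y) (toH (br x e)) = b (toH y) (br x (toH e))" for e y
    using b0(2)[OF toH_br[OF x, of e] toH_H[of y]] by (simp add: linear_diff[OF linb(1)])
  ultimately show ?thesis by (simp add: c_def)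
qed

text \<open>The adjoint Casimir \<open>\<Omega>\<close> is the identity modulo the radical but zero
  on \<open>K\<close> modulo \<open>K'\<close>, as \<open>H\<close> acts trivially there. So
  \<open>x - \<Omega> x\<close> maps \<open>H\<close> into \<open>K\<close> and is the identity on
  \<open>K / K'\<close>. The derivation rule says that \<open>\<Omega>\<close> commutes with
  brackets modulo \<open>K'\<close>, its remaining term lying in \<open>K'\<close>.\<close>

lemma splitting_exists_trivial:
  assumes triv: "\<And>x v. x \<in> H \<Longrightarrow> v \<in> K \<Longrightarrow> br x v \<in> K'"
  shows "\<exists>p. splitting 1 p"
proof -
  obtain E f where inv: "invariant_family E f" and cas: "\<And>x. (\<Sum>e\<in>E. br e (br (f e) x)) - x \<in> rad"
    using killing_casimir by blast
  define \<Omega> where "\<Omega> x = (\<Sum>e\<in>E. br (toH e) (br (toH (f e)) x))" for x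
  have triv': "br v x \<in> K'" if "x \<in> H" "v \<in> K" for x v
    using triv[OF that] br_anti[of v x] subspace_neg[OF K'_subspace] by simp
  have lin\<Omega>: "linear \<Omega>" unfolding \<Omega>_def
    using linear_compose[OF linear_br(1) linear_br(1)] by (intro linear_compose_sum) (simp add: o_def)
  have \<Omega>H: "\<Omega> x \<in> H" if "x \<in> H" for x
    unfolding \<Omega>_def by (intro subspace_sum H_subspace br_H toH_H that)
  have \<Omega>rad: "\<Omega> x - x \<in> rad" for x
  proof -
    have "br (toH e) (br (toH g) x) - br e (br g x) \<in> rad" for e g
    proof -
      have "br (toH e) (br (toH g) x) - br e (br g x) = br (toH e - e) (br (toH g) x) + br e (br (toH g - g) x)"
        by (simp add: br_simps)
      also have "\<dots> \<in> rad"
        by (intro subspace_add rad_subspace br_rad_left br_rad_right diff_toH')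
      finally show ?thesis .
    qed
    then have "(\<Sum>e\<in>E. br (toH e) (br (toH (f e)) x) - br e (br (f e) x)) \<in> rad"
      by (intro subspace_sum rad_subspace)
    then have "(\<Omega> x - (\<Sum>e\<in>E. br e (br (f e) x))) + ((\<Sum>e\<in>E. br e (br (f e) x)) - x) \<in> rad"
      using cas unfolding \<Omega>_def sum_subtractf by (intro subspace_add rad_subspace)
    then show ?thesis by simp
  qed
  obtain q where q: "linear q" "\<forall>x\<in>K'. q x = 0" "\<forall>x. x - q x \<in> K'"
    using projection_along[OF K'_subspace] by blast
  have q0: "x \<in> K'" if "q x = 0" for x using q(3) that by (metis diff_0_right)
  have comm: "br x (\<Omega> y) - \<Omega> (br x y) \<in> K'" if x: "x \<in> H" and y: "y \<in> H" for x y
  proof -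
    define b where "b a c = q (br a (br c y))" for a c
    have "bilinear b" unfolding bilinear_def b_def
      using linear_compose[OF linear_compose[OF linear_br(2) linear_br(1)] q(1)] linear_compose[OF linear_br(2) q(1)]
      by (simp add: o_def)
    moreover have "b v z = 0" "b z v = 0" if "v \<in> K" "z \<in> H" for v z
      using q(2) triv' K'_stable that y br_H by (auto simp: b_def)
    ultimately have "(\<Sum>e\<in>E. b (br x (toH e)) (toH (f e))) + (\<Sum>e\<in>E. b (toH e) (br x (toH (f e)))) = 0"
      using invariant_family_H[OF inv _ _ _ x] by blast
    moreover have "br x (\<Omega> y) - \<Omega> (br x y) =
      (\<Sum>e\<in>E. br (br x (toH e)) (br (toH (f e)) y)) + (\<Sum>e\<in>E. br (toH e) (br (br x (toH (f e))) y))"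
    proof -
      have "br x (br a (br c y)) - br a (br c (br x y)) = br (br x a) (br c y) + br a (br (br x c) y)" for a c
        by (simp add: jacobi_left br_simps)
      then show ?thesis
        by (simp add: \<Omega>_def linear_sum[OF linear_br(1)] flip: sum.distrib sum_subtractf)
    qed
    ultimately have "q (br x (\<Omega> y) - \<Omega> (br x y)) = 0"
      by (simp add: b_def linear_add[OF q(1)] linear_sum[OF q(1)])
    then show ?thesis by (rule q0)
  qed
  have "splitting 1 (\<lambda>x. x - \<Omega> x)" unfolding splitting_def scaleR_one
  proof (intro conjI ballI)
    show "linear (\<lambda>x. x - \<Omega> x)" using linear_compose_sub[OF linear_id lin\<Omega>] by (simp add: id_def)
    show pK: "x - \<Omega> x \<in> K" if "x \<in> H" for x
      using subspace_neg[OF rad_subspace \<Omega>rad[of x]] subspace_diff[OF H_subspace that \<Omega>H[OF that]] by simp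
    show "v - \<Omega> v - v \<in> K'" if "v \<in> K" for v
    proof -
      have "br (toH e) (br (toH g) v) \<in> K'" for e g
        by (intro K'_stable triv toH_H that)
      then have "\<Omega> v \<in> K'" unfolding \<Omega>_def by (intro subspace_sum K'_subspace)
      then show ?thesis by (simp add: subspace_neg[OF K'_subspace])
    qed
    show "br x y - \<Omega> (br x y) - (br x (y - \<Omega> y) + br (x - \<Omega> x) y) \<in> K'" if "x \<in> H" "y \<in> H" for x y
    proof -
      have "br (x - \<Omega> x) y \<in> K'" by (rule triv'[OF that(2) pK[OF that(1)]])
      then have "(br x (\<Omega> y) - \<Omega> (br x y)) - br (x - \<Omega> x) y \<in> K'"
        using comm[OF that] subspace_diff[OF K'_subspace] by blast
      then show ?thesis by (simp add: br_simps algebra_simps)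
    qed
  qed
  then show ?thesis by blast
qed

text \<open>
  The obstruction \<open>\<omega>\<close> is a 2-cocycle with values in \<open>K / K'\<close>. By invariance of the family, \<open>\<theta>\<close> satisfies
  \<open>d \<theta> = - \<Omega> \<omega>\<close>, and the Casimir operator \<open>\<Omega>\<close> is invertible because \<open>K / K'\<close> is irreducible and
  its trace is nonzero.
\<close>

lemma splitting_exists_irreducible:
  assumes irred: "\<And>L. subspace L \<Longrightarrow> K' \<subseteq> L \<Longrightarrow> L \<subseteq> K \<Longrightarrow> (\<And>x v. x \<in> H \<Longrightarrow> v \<in> L \<Longrightarrow> br x v \<in> L) \<Longrightarrow> L = K' \<or> L = K"
    and nontriv: "x0 \<in> H" "v0 \<in> K" "br x0 v0 \<notin> K'"
  shows "\<exists>p. splitting 1 p"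
proof -
  obtain q where q: "linear q" "\<forall>x\<in>K'. q x = 0" "\<forall>x. x - q x \<in> K'"
    using projection_along[OF K'_subspace] by blast
  obtain p0 where p0: "linear p0" "\<forall>x\<in>K. p0 x = x" "\<forall>x. p0 x \<in> K"
    using projection_onto[OF K_subspace] by blast
  \<comment> \<open>The range of \<open>u\<close> is a complement of \<open>K'\<close> in
    \<open>K\<close> and stands for \<open>K / K'\<close>; off \<open>K\<close> the map is merely
    some linear extension.\<close>
  define u where "u = (\<lambda>x. q (p0 x))"
  have linu: "linear u" using linear_compose[OF p0(1) q(1)] by (simp add: u_def o_def)
  have u0: "u v = 0" if "v \<in> K'" for v
  proof -
    have "p0 v = v" using p0(2) that K'_sub by blast
    then show ?thesis using q(2) that by (simp add: u_def)
  qed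
  have diff_u: "v - u v \<in> K'" if "v \<in> K" for v using that p0 q by (auto simp: u_def)
  have uK: "u v \<in> K" for v
  proof -
    have "p0 v - q (p0 v) \<in> K" using q K'_sub by blast
    then have "p0 v - (p0 v - q (p0 v)) \<in> K" using p0 subspace_diff[OF K_subspace] by blast
    then show ?thesis by (simp add: u_def)
  qed
  have uu: "u (u v) = u v" for v
  proof -
    have "u (u v) = q (p0 (q (p0 v)))" by (simp add: u_def)
    also have "p0 (q (p0 v)) = q (p0 v)" using uK[of v] p0 by (simp add: u_def)
    also have "q (q (p0 v)) = q (p0 v)" using q by (metis eq_iff_diff_eq_0 linear_diff)
    finally show ?thesis by (simp add: u_def)
  qed
  have u_br: "u (br x (u v)) = u (br x v)" if "x \<in> H" "v \<in> K" for x v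
    using u0[OF K'_stable[OF that(1) diff_u[OF that(2)]]] by (simp add: br_simps linear_diff[OF linu])
  \<comment> \<open>\<open>K\<close> acts as zero on \<open>K / K'\<close>, so the action of
    \<open>H\<close> passes to \<open>H / K\<close>. Composing with \<open>toH\<close> makes it a
    representation of the whole algebra that kills the radical, as
    \<open>representation_casimir\<close> requires.\<close>
  define \<rho> where "\<rho> x v = u (br (toH x) (u v))" for x v
  have \<rho>K: "\<rho> x v = u (br (toH x) v)" if "v \<in> K" for x v
    using u_br[OF toH_H that] by (simp add: \<rho>_def)
  have \<rho>u: "\<rho> x (u v) = \<rho> x v" "u (\<rho> x v) = \<rho> x v" for x v by (simp_all add: \<rho>_def uu)
  have \<rho>inK: "\<rho> x v \<in> K" for x v by (simp add: \<rho>_def uK del: Int_iff)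
  have bil\<rho>: "bilinear \<rho>" unfolding bilinear_def \<rho>_def
    using linear_compose[OF linear_compose[OF linu linear_br(1)] linu] linear_compose[OF linear_compose[OF linear_toH linear_br(2)] linu]
    by (simp add: o_def)
  have hom: "\<rho> (br x y) v = \<rho> x (\<rho> y v) - \<rho> y (\<rho> x v)" for x y v
  proof -
    have 1: "\<rho> a (\<rho> c v) = u (br (toH a) (br (toH c) (u v)))" for a c
      unfolding \<rho>K[OF \<rho>inK] unfolding \<rho>_def by (rule u_br[OF toH_H br_K(1)[OF toH_H uK]])
    have "toH (br x y) - br (toH x) (toH y) \<in> K"
    proof -
      have "(toH (br x y) - br x y) + (br (x - toH x) y + br (toH x) (y - toH y)) \<in> rad"
        by (intro subspace_add rad_subspace br_rad_left br_rad_right diff_toH diff_toH')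
      then have "toH (br x y) - br (toH x) (toH y) \<in> rad" by (simp add: br_simps)
      moreover have "toH (br x y) - br (toH x) (toH y) \<in> H" by (intro subspace_diff H_subspace toH_H br_H)
      ultimately show ?thesis by blast
    qed
    then have "u (br (toH (br x y) - br (toH x) (toH y)) (u v)) = 0"
      by (intro u0 K_abelian uK)
    then have "\<rho> (br x y) v = u (br (br (toH x) (toH y)) (u v))"
      by (simp add: \<rho>_def br_simps linear_diff[OF linu])
    then show ?thesis by (simp add: 1 jacobi_left linear_diff[OF linu])
  qed
  have rep: "representation_of \<rho>" using bil\<rho> hom by (simp add: representation_of_def)
  have \<rho>rad: "\<rho> t v = 0" if "t \<in> rad" for t v
    unfolding \<rho>_def by (intro u0 K_abelian uK toH_rad that)
  have "\<rho> x0 v0 \<noteq> 0"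
  proof
    assume "\<rho> x0 v0 = 0"
    then have "u (br x0 v0) = 0" using \<rho>K[OF nontriv(2)] toH_id[OF nontriv(1)] by simp
    then have "br x0 v0 \<in> K'" using diff_u[OF br_K(1)[OF nontriv(1,2)]] by simp
    then show False using nontriv by blast
  qed
  then obtain E f where inv: "invariant_family E f" and tr: "trace_of (\<lambda>v. \<Sum>e\<in>E. \<rho> e (\<rho> (f e) v)) \<noteq> 0"
    using representation_casimir[OF rep \<rho>rad] by blast
  have lin\<rho>: "linear (\<rho> x)" "linear (\<lambda>x. \<rho> x v)" for x v using bil\<rho> by (auto simp: bilinear_def)
  define \<Omega> where "\<Omega> v = (\<Sum>e\<in>E. \<rho> e (\<rho> (f e) v))" for v
  have lin\<Omega>: "linear \<Omega>" unfolding \<Omega>_def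
    using linear_compose[OF lin\<rho>(1) lin\<rho>(1)] by (intro linear_compose_sum) (simp add: o_def)
  have comm: "\<rho> x (\<Omega> v) = \<Omega> (\<rho> x v)" for x v
  proof -
    have "bilinear (\<lambda>a c. \<rho> a (\<rho> c v))" unfolding bilinear_def
      using lin\<rho>(2) linear_compose[OF lin\<rho>(2) lin\<rho>(1)] by (simp add: o_def)
    moreover have "\<rho> t (\<rho> y v) = 0 \<and> \<rho> y (\<rho> t v) = 0" if "t \<in> rad" for t y
      by (simp add: \<rho>rad[OF that] linear_0[OF lin\<rho>(1)])
    ultimately have "(\<Sum>e\<in>E. \<rho> (br x e) (\<rho> (f e) v)) + (\<Sum>e\<in>E. \<rho> e (\<rho> (br x (f e)) v)) = 0"
      using inv unfolding invariant_family_def by blast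
    then have "(\<Sum>e\<in>E. \<rho> x (\<rho> e (\<rho> (f e) v)) - \<rho> e (\<rho> (f e) (\<rho> x v))) = 0"
      by (simp add: hom linear_diff[OF lin\<rho>(1)] flip: sum.distrib)
    then show ?thesis by (simp add: \<Omega>_def linear_sum[OF lin\<rho>(1)] sum_subtractf)
  qed
  have \<Omega>u: "\<Omega> (u v) = \<Omega> v" for v by (simp add: \<Omega>_def \<rho>u)
  define M where "M = range u"
  have subM: "subspace M" unfolding M_def using linu by (simp add: linear_subspace_image)
  have uM: "u w = w" if "w \<in> M" for w using that uu by (auto simp: M_def)
  have MK: "M \<subseteq> K" using uK by (auto simp: M_def)
  have \<rho>M: "\<rho> x v \<in> M" for x v by (simp add: \<rho>_def M_def)
  have \<Omega>M: "\<Omega> v \<in> M" for v unfolding \<Omega>_def by (intro subspace_sum subM \<rho>M)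
  have inj: "w = 0" if w: "w \<in> M" "\<Omega> w = 0" for w
  proof -
    \<comment> \<open>The kernel of \<open>\<Omega>\<close> on \<open>K\<close> is a submodule
      containing \<open>K'\<close>. If it were \<open>K\<close>, then \<open>\<Omega>\<close> would
      be zero, against its trace; so it is \<open>K'\<close>, which meets \<open>M\<close> only in
      0.\<close>
    define L where "L = {v \<in> K. \<Omega> v = 0}"
    have "L = K' \<or> L = K"
    proof (rule irred)
      show "subspace L" unfolding subspace_def L_def
        using K_subspace by (auto simp: subspace_add subspace_scale subspace_0 linear_add[OF lin\<Omega>] linear_scale[OF lin\<Omega>] linear_0[OF lin\<Omega>] simp del: Int_iff)
      show "K' \<subseteq> L"
      proof
        fix v assume "v \<in> K'"
        then have "\<Omega> v = 0" using \<Omega>u[of v] u0 by (simp add: linear_0[OF lin\<Omega>])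
        then show "v \<in> L" using \<open>v \<in> K'\<close> K'_sub by (auto simp: L_def)
      qed
      show "L \<subseteq> K" by (auto simp: L_def)
      show "br x v \<in> L" if "x \<in> H" "v \<in> L" for x v
      proof -
        have v: "v \<in> K" "\<Omega> v = 0" using that by (auto simp: L_def)
        have "u (br x v) = \<rho> x v" using \<rho>K[OF v(1)] toH_id[OF that(1)] by simp
        then have "\<Omega> (br x v) = \<Omega> (\<rho> x v)" by (metis \<Omega>u)
        also have "\<dots> = 0" unfolding comm[symmetric] v(2) by (rule linear_0[OF lin\<rho>(1)])
        finally show ?thesis using br_K(1)[OF that(1) v(1)] by (simp add: L_def)
      qed
    qed
    moreover have "L \<noteq> K"
    proof
      assume "L = K"
      then have "\<Omega> (u v) = 0" for v using uK[of v] L_def by blast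
      then have "\<Omega> = (\<lambda>v. 0)" using \<Omega>u by auto
      moreover have "trace_of \<Omega> \<noteq> 0" using tr by (simp add: \<Omega>_def[abs_def])
      ultimately show False using trace_zero[OF fd] by simp
    qed
    ultimately have "w \<in> K'" using w MK by (auto simp: L_def)
    then show ?thesis using u0 uM[OF w(1)] by simp
  qed
  obtain \<Theta> where \<Theta>: "linear \<Theta>" "\<forall>x. \<Theta> x \<in> M" "\<forall>x\<in>M. \<Theta> (\<Omega> x) = x \<and> \<Omega> (\<Theta> x) = x"
    using linear_inj_on_surj_fd[OF fd subM lin\<Omega> _ inj] \<Omega>M by blast
  have \<Theta>comm: "\<Theta> (\<rho> x w) = \<rho> x (\<Theta> w)" if "w \<in> M" for x w
  proof -
    have "\<rho> x w = \<Omega> (\<rho> x (\<Theta> w))" using \<Theta>(3) that comm[of x "\<Theta> w"] by simp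
    then show ?thesis using \<Theta>(3) \<rho>M by simp
  qed
  \<comment> \<open>A linear projection to \<open>K / K'\<close> chosen without regard to brackets;
    \<open>\<omega>\<close> is its defect as a derivation.\<close>
  define c where "c x = u (p0 x)" for x
  have linc: "linear c" unfolding c_def using linear_compose[OF p0(1) linu] by (simp add: o_def)
  have cK: "c v = u v" if "v \<in> K" for v using that p0 by (simp add: c_def)
  have cM: "c x \<in> M" for x by (simp add: c_def M_def)
  define \<omega> where "\<omega> x y = c (br x y) - \<rho> x (c y) + \<rho> y (c x)" for x y
  have lin\<omega>: "linear (\<omega> x)" "linear (\<lambda>x. \<omega> x y)" for x y
    unfolding \<omega>_def
    using linear_compose[OF linear_br(1) linc] linear_compose[OF linear_br(2) linc] lin\<rho>(2)
      linear_compose[OF linc lin\<rho>(1)]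
    by (auto simp: o_def intro!: linear_compose_add linear_compose_sub)
  have \<omega>M: "\<omega> x y \<in> M" for x y unfolding \<omega>_def by (intro subspace_add subspace_diff subM cM \<rho>M)
  have \<omega>anti: "\<omega> y x = - \<omega> x y" for x y
    using br_anti[of y x] by (simp add: \<omega>_def linear_neg[OF linc])
  have \<omega>K: "\<omega> v y = 0" if "v \<in> K" "y \<in> H" for v y
  proof -
    have "\<rho> v (c y) = 0" using \<rho>rad that by blast
    moreover have "\<rho> y (c v) = u (br y v)" using that cK \<rho>u(1) \<rho>K toH_id by simp
    moreover have "c (br v y) = u (br v y)" using cK br_K(2) that by blast
    ultimately show ?thesis using br_anti[of v y] by (simp add: \<omega>_def linear_neg[OF linu])
  qed
  have cocycle: "\<omega> (br a x) y + \<omega> (br x y) a + \<omega> (br y a) x = \<rho> a (\<omega> x y) + \<rho> x (\<omega> y a) + \<rho> y (\<omega> a x)" for a x y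
  proof -
    have "br (br a x) y + br (br x y) a + br (br y a) x = 0"
    proof -
      have "br (br a x) y + br (br x y) a + br (br y a) x = - (br a (br x y) + br x (br y a) + br y (br a x))"
        using br_anti[of "br a x" y] br_anti[of "br x y" a] br_anti[of "br y a" x] by simp
      then show ?thesis unfolding jacobi by simp
    qed
    then have "c (br (br a x) y) + c (br (br x y) a) + c (br (br y a) x) = 0"
      using linear_0[OF linc] by (simp flip: linear_add[OF linc])
    then show ?thesis
      by (simp add: \<omega>_def hom linear_add[OF lin\<rho>(1)] linear_diff[OF lin\<rho>(1)] algebra_simps)
  qed
  define \<theta> where "\<theta> x = (\<Sum>e\<in>E. \<rho> (toH e) (\<omega> (toH (f e)) x))" for x
  have lin\<theta>: "linear \<theta>" unfolding \<theta>_def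
    using linear_compose[OF lin\<omega>(1) lin\<rho>(1)] by (intro linear_compose_sum) (simp add: o_def)
  have \<theta>M: "\<theta> x \<in> M" for x unfolding \<theta>_def by (intro subspace_sum subM \<rho>M)
  have \<rho>toH: "\<rho> (toH e) v = \<rho> e v" for e v by (simp add: \<rho>_def toH_id[OF toH_H])
  have d\<theta>: "\<theta> (br x y) - \<rho> x (\<theta> y) + \<rho> y (\<theta> x) = - \<Omega> (\<omega> x y)" if x: "x \<in> H" and y: "y \<in> H" for x y
  proof -
    \<comment> \<open>Moving \<open>\<rho> x\<close> past the action of \<open>toH e\<close> leaves
      a bracket of \<open>x\<close> with \<open>toH e\<close>, which the invariance of the family
      shifts to a bracket with \<open>toH (f e)\<close>.\<close>
    have I: "\<rho> x (\<theta> y) = (\<Sum>e\<in>E. \<rho> (toH e) (\<rho> x (\<omega> (toH (f e)) y) - \<omega> (br x (toH (f e))) y))"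
      if x: "x \<in> H" and y: "y \<in> H" for x y
    proof -
      have "bilinear (\<lambda>a d. \<rho> a (\<omega> d y))" unfolding bilinear_def
        using lin\<rho>(2) linear_compose[OF lin\<omega>(2) lin\<rho>(1)] by (simp add: o_def)
      moreover have "\<rho> v (\<omega> z y) = 0" "\<rho> z (\<omega> v y) = 0" if "v \<in> K" "z \<in> H" for v z
        using \<rho>rad \<omega>K that y by (simp_all add: linear_0[OF lin\<rho>(1)])
      ultimately have "(\<Sum>e\<in>E. \<rho> (br x (toH e)) (\<omega> (toH (f e)) y)) + (\<Sum>e\<in>E. \<rho> (toH e) (\<omega> (br x (toH (f e))) y)) = 0"
        using invariant_family_H[OF inv _ _ _ x] by blast
      then have "(\<Sum>e\<in>E. \<rho> (br x (toH e)) (\<omega> (toH (f e)) y)) = - (\<Sum>e\<in>E. \<rho> (toH e) (\<omega> (br x (toH (f e))) y))"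
        by (rule eq_neg_iff_add_eq_0[THEN iffD2])
      then show ?thesis
        by (simp add: \<theta>_def linear_sum[OF lin\<rho>(1)] linear_diff[OF lin\<rho>(1)] hom sum_subtractf algebra_simps)
    qed
    have "\<omega> (toH g) (br x y) - (\<rho> x (\<omega> (toH g) y) - \<omega> (br x (toH g)) y) + (\<rho> y (\<omega> (toH g) x) - \<omega> (br y (toH g)) x)
      = - \<rho> (toH g) (\<omega> x y)" for g
    proof -
      have "\<omega> (br x (toH g)) y = - \<omega> (br (toH g) x) y"
        using br_anti[of x "toH g"] by (simp add: linear_neg[OF lin\<omega>(2)])
      moreover have "\<rho> x (\<omega> (toH g) y) = - \<rho> x (\<omega> y (toH g))"
        using \<omega>anti[of "toH g" y] by (simp add: linear_neg[OF lin\<rho>(1)])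
      ultimately show ?thesis using cocycle[of "toH g" x y] \<omega>anti[of "toH g" "br x y"] by (simp add: algebra_simps)
    qed
    then have "\<rho> (toH e) (\<omega> (toH g) (br x y) - (\<rho> x (\<omega> (toH g) y) - \<omega> (br x (toH g)) y) + (\<rho> y (\<omega> (toH g) x) - \<omega> (br y (toH g)) x))
      = - \<rho> e (\<rho> g (\<omega> x y))" for e g
      by (simp add: linear_neg[OF lin\<rho>(1)] \<rho>toH)
    then have "(\<Sum>e\<in>E. \<rho> (toH e) (\<omega> (toH (f e)) (br x y)) - \<rho> (toH e) (\<rho> x (\<omega> (toH (f e)) y) - \<omega> (br x (toH (f e))) y)
       + \<rho> (toH e) (\<rho> y (\<omega> (toH (f e)) x) - \<omega> (br y (toH (f e))) x)) = - \<Omega> (\<omega> x y)"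
      by (simp only: linear_add[OF lin\<rho>(1), symmetric] linear_diff[OF lin\<rho>(1), symmetric] \<Omega>_def sum_negf)
    then show ?thesis unfolding I[OF x y] I[OF y x] unfolding \<theta>_def by (simp only: sum.distrib sum_subtractf)
  qed
  \<comment> \<open>\<open>\<Theta>\<close> inverts \<open>\<Omega>\<close> and commutes with the
    action, so the correction contributes \<open>- \<omega> x y\<close> to the defect and cancels
    that of \<open>c\<close>.\<close>
  define p where "p x = c x + \<Theta> (\<theta> x)" for x
  have linp: "linear p" unfolding p_def
    using linc linear_compose[OF lin\<theta> \<Theta>(1)] by (intro linear_compose_add) (simp_all add: o_def)
  have pM: "p x \<in> M" for x unfolding p_def using cM \<Theta>(2) subspace_add[OF subM] by blast
  have pK: "p x \<in> K" for x using pM MK by blast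
  have pu: "p v = u v" if "v \<in> K" for v
  proof -
    have "\<omega> (toH g) v = 0" for g using \<omega>K[OF that toH_H] \<omega>anti[of "toH g" v] by simp
    then have "\<theta> v = 0" by (simp add: \<theta>_def linear_0[OF lin\<rho>(1)])
    then show ?thesis using cK[OF that] by (simp add: p_def linear_0[OF \<Theta>(1)])
  qed
  have der: "p (br x y) = \<rho> x (p y) - \<rho> y (p x)" if "x \<in> H" "y \<in> H" for x y
  proof -
    have "\<Theta> (\<theta> (br x y)) - \<rho> x (\<Theta> (\<theta> y)) + \<rho> y (\<Theta> (\<theta> x)) = \<Theta> (\<theta> (br x y) - \<rho> x (\<theta> y) + \<rho> y (\<theta> x))"
      by (simp add: linear_add[OF \<Theta>(1)] linear_diff[OF \<Theta>(1)] \<Theta>comm \<theta>M)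
    also have "\<dots> = - \<omega> x y"
      unfolding d\<theta>[OF that] using \<Theta>(3) \<omega>M by (simp add: linear_neg[OF \<Theta>(1)])
    finally show ?thesis by (simp add: p_def \<omega>_def linear_add[OF lin\<rho>(1)] algebra_simps)
  qed
  have "splitting 1 p" unfolding splitting_def scaleR_one
  proof (intro conjI ballI)
    show "linear p" by (rule linp)
    show "p x \<in> K" for x by (rule pK)
    show "p v - v \<in> K'" if "v \<in> K" for v
      using subspace_neg[OF K'_subspace diff_u[OF that]] pu[OF that] by simp
    show "p (br x y) - (br x (p y) + br (p x) y) \<in> K'" if xy: "x \<in> H" "y \<in> H" for x y
    proof -
      have a: "\<rho> x (p y) = u (br x (p y))" if "x \<in> H" for x y using \<rho>K[OF pK] toH_id[OF that] by simp
      have d: "br x (p y) - u (br x (p y)) \<in> K'" if "x \<in> H" for x y by (rule diff_u[OF br_K(1)[OF that pK]])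
      have "(br y (p x) - u (br y (p x))) - (br x (p y) - u (br x (p y))) \<in> K'"
        by (intro subspace_diff K'_subspace d xy)
      then show ?thesis using br_anti[of "p x" y] by (simp add: der[OF xy] a xy algebra_simps)
    qed
  qed
  then show ?thesis by blast
qed

end

section \<open>Levi complements\<close>

context fd_lie_algebra
begin

text \<open>The second part keeps the descent going: a nonzero \<open>K\<close> equal to its derived
  algebra would have a constant derived series, against solvability.\<close>

lemma radical_layer_derived:
  assumes H: "lie_subalgebra br H" and sum: "\<And>x. \<exists>y\<in>H. x - y \<in> rad"
  shows "radical_layer br H (derived_series br (H \<inter> rad) 1)"
    and "H \<inter> rad \<noteq> {0} \<Longrightarrow> derived_series br (H \<inter> rad) 1 \<noteq> H \<inter> rad"
proof -
  let ?K = "H \<inter> rad"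
  have idK: "lie_ideal br H ?K"
    using H rad_subspace br_rad_right by (auto simp: lie_ideal_def lie_subalgebra_def subspace_inter)
  have algK: "lie_subalgebra br ?K" by (rule lie_ideal_subalgebra[OF H idK])
  have subK: "subspace ?K" using idK by (simp add: lie_ideal_def)
  have idK1: "lie_ideal br H (derived_series br ?K 1)" by (rule derived_series_ideal[OF H idK])
  show "radical_layer br H (derived_series br ?K 1)"
  proof
    show "\<exists>y\<in>H. x - y \<in> rad" for x by (rule sum)
    show "derived_series br ?K 1 \<subseteq> ?K" using derived_series_Suc_subset[OF algK, of 0] by simp
    show "br v w \<in> derived_series br ?K 1" if "v \<in> ?K" "w \<in> ?K" for v w
      using that by (auto intro!: span_base)
  qed (use H idK1 in \<open>auto simp: lie_ideal_def\<close>)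
  show "derived_series br ?K 1 \<noteq> ?K" if "?K \<noteq> {0}"
  proof
    assume eq: "derived_series br ?K 1 = ?K"
    have "derived_series br ?K n = ?K" for n
    proof (induction n)
      case (Suc n)
      then have "derived_series br ?K (Suc n) = derived_series br ?K 1" by simp
      then show ?case using eq by (simp only:)
    qed simp
    moreover have "lie_solvable br ?K" by (rule solvable_subset[OF subK _ rad_solvable]) simp
    ultimately show False using that by (auto simp: lie_solvable_def)
  qed
qed

text \<open>A largest proper stable subspace \<open>M\<close> between [K, K] and \<open>K\<close>
  makes \<open>K / M\<close> irreducible. If \<open>H\<close> acts trivially on
  \<open>K / M\<close>, the Casimir operator of that module is zero, so the adjoint Casimir takes
  over.\<close>

lemma radical_layer_split_exists:
  assumes H: "lie_subalgebra br H" and sum: "\<And>x. \<exists>y\<in>H. x - y \<in> rad" and nz: "H \<inter> rad \<noteq> {0}"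
  shows "\<exists>H'. lie_subalgebra br H' \<and> H' \<subseteq> H \<and> H' \<inter> rad \<subset> H \<inter> rad \<and> (\<forall>x. \<exists>y\<in>H'. x - y \<in> rad)"
proof -
  let ?K = "H \<inter> rad" and ?K1 = "derived_series br (H \<inter> rad) 1"
  interpret l: radical_layer br H ?K1 by (rule radical_layer_derived(1)[OF H sum])
  let ?P = "\<lambda>M. subspace M \<and> ?K1 \<subseteq> M \<and> M \<subset> ?K \<and> (\<forall>x\<in>H. \<forall>v\<in>M. br x v \<in> M)"
  have "?P ?K1"
    using l.K'_subspace l.K'_sub l.K'_stable radical_layer_derived(2)[OF H sum nz] by blast
  then obtain M where M: "?P M" and max: "\<And>N. ?P N \<Longrightarrow> dim N \<le> dim M"
    using exists_max_dim_fd[OF fd, of ?P ?K1] by blast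
  interpret m: radical_layer br H M
    by unfold_locales (use H sum M l.K_abelian in blast)+
  have "\<exists>p. m.splitting 1 p"
  proof (cases "\<forall>x\<in>H. \<forall>v\<in>?K. br x v \<in> M")
    case True
    then show ?thesis using m.splitting_exists_trivial by blast
  next
    case False
    then obtain x0 v0 where xv: "x0 \<in> H" "v0 \<in> ?K" "br x0 v0 \<notin> M" by blast
    show ?thesis
    proof (rule m.splitting_exists_irreducible[OF _ xv])
      fix L assume L: "subspace L" "M \<subseteq> L" "L \<subseteq> ?K" "\<And>x v. x \<in> H \<Longrightarrow> v \<in> L \<Longrightarrow> br x v \<in> L"
      show "L = M \<or> L = ?K"
      proof (cases "L = ?K")
        case False
        then have "dim L \<le> dim M" using max[of L] L M by blast
        then show ?thesis using subspace_dim_equal_fd[OF fd, of M L] M L by blast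
      qed simp
    qed
  qed
  then obtain p where p: "m.splitting 1 p" by blast
  show ?thesis
    using m.splitting_kernel[OF p refl] M by (intro exI[of _ "{x \<in> H. p x \<in> M}"]) auto
qed

text \<open>Stated for subalgebras \<open>H\<close> and with \<open>L\<close> inside
  \<open>H\<close>, because every stable \<open>H\<close> of the equivariant descent needs a
  complement within itself.\<close>

lemma levi_complement_exists:
  assumes "lie_subalgebra br H" and "\<And>x. \<exists>y\<in>H. x - y \<in> rad"
  shows "\<exists>L. lie_subalgebra br L \<and> L \<subseteq> H \<and> L \<inter> rad = {0} \<and> (\<forall>x. \<exists>y\<in>L. x - y \<in> rad)"
  using assms
proof (induction "dim (H \<inter> rad)" arbitrary: H rule: less_induct)
  case less
  show ?case
  proof (cases "H \<inter> rad = {0}")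
    case True
    then show ?thesis using less.prems by blast
  next
    case False
    then obtain H' where H': "lie_subalgebra br H'" "H' \<subseteq> H" "H' \<inter> rad \<subset> H \<inter> rad" "\<forall>x. \<exists>y\<in>H'. x - y \<in> rad"
      using radical_layer_split_exists[OF less.prems(1,2)] by blast
    have "dim (H' \<inter> rad) < dim (H \<inter> rad)"
      using H' less.prems(1) rad_subspace
      by (intro subspace_dim_less_fd[OF fd]) (auto simp: lie_subalgebra_def subspace_inter)
    then have "\<exists>L. lie_subalgebra br L \<and> L \<subseteq> H' \<and> L \<inter> rad = {0} \<and> (\<forall>x. \<exists>y\<in>L. x - y \<in> rad)"
      by (rule less.hyps[OF _ H'(1)]) (rule H'(4)[rule_format])
    then show ?thesis using H'(2) by (elim exE conjE) (intro exI conjI, assumption, rule subset_trans)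
  qed
qed

text \<open>If \<open>R\<close> is the radical of \<open>L\<close>, then R + rad is an ideal of L +
  rad, the whole algebra, and is solvable modulo \<open>rad\<close>. So \<open>R\<close> lies in
  \<open>L \<inter> rad\<close>, and \<open>L\<close> is semisimple.\<close>

lemma levi_subalgebraI:
  assumes L: "lie_subalgebra br L" and int: "L \<inter> rad = {0}" and sum: "\<And>x. \<exists>y\<in>L. x - y \<in> rad"
  shows "levi_subalgebra br L"
proof -
  define R where "R = lie_radical br L"
  have R: "lie_ideal br L R" "lie_solvable br R"
    using lie_radical_is_radical[OF lie_algebra_axioms fd L] by (auto simp: R_def is_lie_radical_def)
  have subR: "subspace R" and RL: "R \<subseteq> L" using R by (auto simp: lie_ideal_def)
  have brLR: "br x y \<in> R" if "x \<in> L" "y \<in> R" for x y using R(1) that by (simp add: lie_ideal_def)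
  define I where "I = {x + t | x t. x \<in> R \<and> t \<in> rad}"
  have subI: "subspace I" unfolding I_def by (intro subspace_sums subR rad_subspace)
  have idI: "lie_ideal br UNIV I" unfolding lie_ideal_def
  proof (intro conjI ballI subI)
    fix y u assume "u \<in> I"
    then obtain x t where xt: "x \<in> R" "t \<in> rad" "u = x + t" by (auto simp: I_def)
    obtain l where l: "l \<in> L" "y - l \<in> rad" using sum by blast
    have "br y u = br l x + (br (y - l) x + br y t)" by (simp add: xt br_simps)
    moreover have "br l x \<in> R" using brLR l xt by blast
    moreover have "br (y - l) x + br y t \<in> rad"
      using l xt by (intro subspace_add rad_subspace br_rad_left br_rad_right)
    ultimately show "br y u \<in> I" unfolding I_def by blast
  qed simp
  have "derived_series br I k \<subseteq> {x + t | x t. x \<in> derived_series br R k \<and> t \<in> rad}" for k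
  proof (induction k)
    case (Suc k)
    let ?T = "{x + t | x t. x \<in> derived_series br R (Suc k) \<and> t \<in> rad}"
    have "subspace ?T" by (intro subspace_sums derived_series_subspace subR rad_subspace)
    moreover have "br u v \<in> ?T" if uv: "u \<in> derived_series br I k" "v \<in> derived_series br I k" for u v
    proof -
      obtain x t where u: "u = x + t" "x \<in> derived_series br R k" "t \<in> rad" using Suc uv(1) by blast
      obtain y s where v: "v = y + s" "y \<in> derived_series br R k" "s \<in> rad" using Suc uv(2) by blast
      have "br x y \<in> derived_series br R (Suc k)" using u v by (auto intro: span_base)
      moreover have "br x s + br t v \<in> rad"
        using u v by (intro subspace_add rad_subspace br_rad_left br_rad_right)
      moreover have "br u v = br x y + (br x s + br t v)" by (simp add: u v br_simps)
      ultimately show ?thesis by blast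
    qed
    ultimately show ?case
      unfolding derived_series.simps(2)[of br I] by (intro span_minimal) blast+
  qed (simp add: I_def)
  moreover obtain n where "derived_series br R n = {0}" using R(2) by (auto simp: lie_solvable_def)
  ultimately have "derived_series br I n \<subseteq> rad" by fastforce
  then have "lie_solvable br I" by (rule solvable_if_derived_subset[OF subI _ rad_solvable])
  then have "I \<subseteq> rad" by (rule rad_maximal[OF idI])
  moreover have "R \<subseteq> I"
  proof
    fix x assume "x \<in> R"
    then have "x + 0 \<in> I" unfolding I_def using subspace_0[OF rad_subspace] by blast
    then show "x \<in> I" by simp
  qed
  ultimately have "R = {0}" using RL int subspace_0[OF subR] by blast
  moreover have "{x + y | x y. x \<in> L \<and> y \<in> rad} = UNIV"
  proof -
    have "z \<in> {x + y | x y. x \<in> L \<and> y \<in> rad}" for z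
    proof -
      obtain x where x: "x \<in> L" "z - x \<in> rad" using sum by blast
      then have "z = x + (z - x)" by simp
      then show ?thesis using x by blast
    qed
    then show ?thesis by blast
  qed
  ultimately show ?thesis using L int by (simp add: levi_subalgebra_def lie_semisimple_def R_def)
qed

section \<open>Stability of the radical under derivations\<close>

lemma derivation_leibniz:
  assumes \<delta>: "lie_derivation br \<delta>"
  shows "(\<delta> ^^ n) (br x y) = (\<Sum>i\<le>n. real (n choose i) *\<^sub>R br ((\<delta> ^^ i) x) ((\<delta> ^^ (n - i)) y))"
proof (induction n)
  case (Suc n)
  have lin: "linear \<delta>" and der: "\<And>x y. \<delta> (br x y) = br (\<delta> x) y + br x (\<delta> y)"
    using \<delta> by (auto simp: lie_derivation_def)
  define B where "B i j = br ((\<delta> ^^ i) x) ((\<delta> ^^ j) y)" for i j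
  define g where "g i = real (n choose i) *\<^sub>R B i (Suc n - i)" for i
  have "(\<delta> ^^ Suc n) (br x y) = (\<Sum>i\<le>n. real (n choose i) *\<^sub>R (B (Suc i) (n - i) + B i (Suc (n - i))))"
    using Suc by (simp add: linear_sum[OF lin] linear_scale[OF lin] der B_def)
  also have "\<dots> = (\<Sum>i\<le>n. real (n choose i) *\<^sub>R B (Suc i) (n - i)) + (\<Sum>i\<le>n. g i)"
    by (simp add: scaleR_add_right sum.distrib g_def Suc_diff_le)
  also have "(\<Sum>i\<le>n. g i) = (\<Sum>i\<le>Suc n. g i)" by (simp add: g_def)
  also have "\<dots> = B 0 (Suc n) + (\<Sum>i\<le>n. real (n choose Suc i) *\<^sub>R B (Suc i) (n - i))"
    by (subst sum.atMost_Suc_shift) (simp add: g_def)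
  also have "(\<Sum>i\<le>n. real (n choose i) *\<^sub>R B (Suc i) (n - i)) + (B 0 (Suc n) + (\<Sum>i\<le>n. real (n choose Suc i) *\<^sub>R B (Suc i) (n - i)))
    = (\<Sum>i\<le>Suc n. real (Suc n choose i) *\<^sub>R B i (Suc n - i))"
    by (subst sum.atMost_Suc_shift) (simp add: scaleR_add_left sum.distrib algebra_simps)
  finally show ?case by (simp add: B_def)
qed simp

text \<open>
  Take \<open>k\<close> maximal such that some power of \<open>\<delta>\<close> moves \<open>D k\<close> out of the radical, and \<open>m\<close> the least such power.
  Expanding \<open>\<delta> ^^ (2 * m)\<close> of a bracket shows that \<open>(\<delta> ^^ m) ` D k\<close> spans an abelian ideal modulo the radical.
\<close>

lemma derivation_preserves_rad:
  assumes \<delta>: "lie_derivation br \<delta>" and x: "x \<in> rad"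
  shows "\<delta> x \<in> rad"
proof (rule ccontr)
  assume nx: "\<delta> x \<notin> rad"
  have lin: "linear \<delta>" using \<delta> by (auto simp: lie_derivation_def)
  have lin_pow: "linear (\<delta> ^^ k)" for k
  proof (induction k)
    case (Suc k)
    then show ?case using linear_compose[OF Suc lin] by (simp add: o_def)
  qed (simp add: linear_id[unfolded id_def])
  define D where "D k = derived_series br rad k" for k
  define Q where "Q k \<longleftrightarrow> (\<exists>m. \<exists>x\<in>D k. (\<delta> ^^ m) x \<notin> rad)" for k
  obtain N where N: "D N = {0}" using rad_solvable by (auto simp: lie_solvable_def D_def)
  have "\<not> Q N" using linear_0[OF lin_pow] subspace_0[OF rad_subspace] by (simp add: Q_def N)
  moreover have "Q 0" unfolding Q_def D_def using x nx by (intro exI[of _ 1] bexI[of _ x]) auto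
  ultimately obtain k where k: "Q k" "\<not> Q (Suc k)" by (metis nat_induct)
  define m where "m = (LEAST m. \<exists>x\<in>D k. (\<delta> ^^ m) x \<notin> rad)"
  obtain z where z: "z \<in> D k" "(\<delta> ^^ m) z \<notin> rad"
    using LeastI_ex[of "\<lambda>m. \<exists>x\<in>D k. (\<delta> ^^ m) x \<notin> rad"] k(1) unfolding Q_def m_def by blast
  have small: "(\<delta> ^^ a) u \<in> rad" if "a < m" "u \<in> D k" for a u
    using not_less_Least[of a "\<lambda>m. \<exists>x\<in>D k. (\<delta> ^^ m) x \<notin> rad"] that unfolding m_def by blast
  have idD: "lie_ideal br UNIV (D k)" unfolding D_def
    by (rule derived_series_ideal[OF lie_subalgebra_UNIV rad_ideal])
  have subD: "subspace (D k)" using idD by (simp add: lie_ideal_def)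
  have brD: "br y u \<in> D k" if "u \<in> D k" for y u using idD that by (simp add: lie_ideal_def)
  define J where "J = {(\<delta> ^^ m) u + t | u t. u \<in> D k \<and> t \<in> rad}"
  have Jeq: "J = {v + t | v t. v \<in> (\<delta> ^^ m) ` D k \<and> t \<in> rad}" by (auto simp: J_def)
  have subJ: "subspace J" unfolding Jeq
    by (intro subspace_sums rad_subspace linear_subspace_image lin_pow subD)
  \<comment> \<open>Every Leibniz term except \<open>i = 0\<close> applies fewer than
    \<open>m\<close> powers of \<open>\<delta>\<close> to \<open>u\<close>, so it falls into the
    radical by minimality of \<open>m\<close>.\<close>
  have shift: "br y ((\<delta> ^^ m) u) - (\<delta> ^^ m) (br y u) \<in> rad" if u: "u \<in> D k" for y u
  proof -
    let ?g = "\<lambda>i. real (m choose i) *\<^sub>R br ((\<delta> ^^ i) y) ((\<delta> ^^ (m - i)) u)"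
    have "(\<delta> ^^ m) (br y u) = br y ((\<delta> ^^ m) u) + (\<Sum>i\<in>{..m} - {0}. ?g i)"
      unfolding derivation_leibniz[OF \<delta>] by (subst sum.remove[of _ 0]) auto
    moreover have "(\<Sum>i\<in>{..m} - {0}. ?g i) \<in> rad"
      using small[OF _ u] by (intro subspace_sum subspace_scale rad_subspace br_rad_right) auto
    then have "- (\<Sum>i\<in>{..m} - {0}. ?g i) \<in> rad" by (rule subspace_neg[OF rad_subspace])
    ultimately show ?thesis by simp
  qed
  have idJ: "lie_ideal br UNIV J" unfolding lie_ideal_def
  proof (intro conjI ballI subJ)
    fix y w assume "w \<in> J"
    then obtain u t where w: "u \<in> D k" "t \<in> rad" "w = (\<delta> ^^ m) u + t" by (auto simp: J_def)
    have "br y w = (\<delta> ^^ m) (br y u) + ((br y ((\<delta> ^^ m) u) - (\<delta> ^^ m) (br y u)) + br y t)"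
      by (simp add: w br_simps)
    moreover have "(br y ((\<delta> ^^ m) u) - (\<delta> ^^ m) (br y u)) + br y t \<in> rad"
      using shift w by (intro subspace_add rad_subspace br_rad_right)
    ultimately show "br y w \<in> J" unfolding J_def using brD[OF w(1)] by blast
  qed simp
  \<comment> \<open>Every term of order \<open>m + m\<close> except the middle one applies fewer
    than \<open>m\<close> powers of \<open>\<delta>\<close> to one of the factors. The whole sum
    lies in the radical because \<open>br u v\<close> is in \<open>D (Suc k)\<close>, so the middle
    term does too, and its binomial coefficient is invertible.\<close>
  have top: "br ((\<delta> ^^ m) u) ((\<delta> ^^ m) v) \<in> rad" if u: "u \<in> D k" and v: "v \<in> D k" for u v
  proof -
    let ?g = "\<lambda>i. real ((m + m) choose i) *\<^sub>R br ((\<delta> ^^ i) u) ((\<delta> ^^ (m + m - i)) v)"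
    have "br u v \<in> D (Suc k)" using u v by (auto simp: D_def intro: span_base)
    then have "(\<delta> ^^ (m + m)) (br u v) \<in> rad" using k(2) by (auto simp: Q_def)
    moreover have "(\<delta> ^^ (m + m)) (br u v) = ?g m + (\<Sum>i\<in>{..m+m} - {m}. ?g i)"
      unfolding derivation_leibniz[OF \<delta>] by (subst sum.remove[of _ m]) auto
    moreover have "(\<Sum>i\<in>{..m+m} - {m}. ?g i) \<in> rad"
    proof (intro subspace_sum rad_subspace)
      fix i assume i: "i \<in> {..m+m} - {m}"
      have "br ((\<delta> ^^ i) u) ((\<delta> ^^ (m + m - i)) v) \<in> rad"
      proof (cases "i < m")
        case True
        then show ?thesis using small[OF _ u] br_rad_left by blast
      next
        case False
        then have "m + m - i < m" using i by auto
        then show ?thesis using small[OF _ v] br_rad_right by blast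
      qed
      then show "?g i \<in> rad" by (rule subspace_scale[OF rad_subspace])
    qed
    ultimately have "?g m \<in> rad"
      using subspace_diff[OF rad_subspace, of "?g m + (\<Sum>i\<in>{..m+m} - {m}. ?g i)" "\<Sum>i\<in>{..m+m} - {m}. ?g i"] by simp
    then have "inverse (real ((m + m) choose m)) *\<^sub>R ?g m \<in> rad" by (rule subspace_scale[OF rad_subspace])
    then show ?thesis by simp
  qed
  have "br v w \<in> rad" if vw: "v \<in> J" "w \<in> J" for v w
  proof -
    obtain u t where v: "u \<in> D k" "t \<in> rad" "v = (\<delta> ^^ m) u + t" using vw by (auto simp: J_def)
    obtain u' t' where w: "u' \<in> D k" "t' \<in> rad" "w = (\<delta> ^^ m) u' + t'" using vw by (auto simp: J_def)
    have "br v w = br ((\<delta> ^^ m) u) ((\<delta> ^^ m) u') + (br ((\<delta> ^^ m) u) t' + br t w)"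
      by (simp add: v w br_simps)
    also have "\<dots> \<in> rad"
      by (intro subspace_add rad_subspace top[OF v(1) w(1)] br_rad_left[OF v(2)] br_rad_right[OF w(2)])
    finally show ?thesis .
  qed
  then have "derived_series br J 1 \<subseteq> rad"
    unfolding One_nat_def derived_series.simps by (intro span_minimal rad_subspace) blast
  then have "lie_solvable br J" by (rule solvable_if_derived_subset[OF subJ _ rad_solvable])
  then have "J \<subseteq> rad" by (rule rad_maximal[OF idJ])
  moreover have "(\<delta> ^^ m) z + 0 \<in> J" unfolding J_def using z(1) subspace_0[OF rad_subspace] by blast
  ultimately show False using z(2) by auto
qed

end

section \<open>Invariant splittings\<close>

lemma (in vector_space) representation_eigenbasis:
  assumes B: "independent B" "span B = UNIV"
    and T: "\<And>x y. T (x + y) = T x + T y" "\<And>c x. T (scale c x) = scale c (T x)"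
    and eig: "\<And>b. b \<in> B \<Longrightarrow> T b = scale (ev b) b" and b: "b \<in> B"
  shows "representation B (T v) b = ev b * representation B v b"
proof -
  have "v \<in> span B" using B by simp
  then show ?thesis
  proof (induction rule: span_induct_alt)
    case base
    have "T 0 = 0" using T(2)[of 0 0] by simp
    then show ?case by (simp add: representation_zero)
  next
    case (step c x y)
    have "representation B (T x) b = ev b * representation B x b"
      using step b B eig by (simp add: representation_scale representation_basis)
    then show ?case using step B by (simp add: T representation_add representation_scale algebra_simps)
  qed
qed

text \<open>There are no Jordan blocks: in an eigenbasis, an eigenvector for \<open>c\<close> has
  coordinates only where the eigenvalue is \<open>c\<close>, and there the coordinates of
  \<open>complexify \<delta> w - cplx_scale c w\<close> vanish.\<close>

lemma semisimple_endo_eigen: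
  assumes \<delta>: "semisimple_endo \<delta>"
    and w: "complexify \<delta> (complexify \<delta> w - cplx_scale c w) = cplx_scale c (complexify \<delta> w - cplx_scale c w)"
  shows "complexify \<delta> w = cplx_scale c w"
proof -
  let ?T = "complexify \<delta>"
  have lin: "linear \<delta>" using \<delta> by (simp add: semisimple_endo_def)
  obtain B where B: "\<not> cplx.dependent B" "cplx.span B = UNIV" "\<forall>b\<in>B. \<exists>c. ?T b = cplx_scale c b"
    using \<delta> unfolding semisimple_endo_def cplx_diagonalisable_def by blast
  then obtain ev where ev: "\<And>b. b \<in> B \<Longrightarrow> ?T b = cplx_scale (ev b) b" by metis
  let ?rep = "cplx.representation B"
  have rep: "?rep (?T v) b = ev b * ?rep v b" if "b \<in> B" for b v
    by (rule cplx.representation_eigenbasis[OF _ _ _ _ _ that])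
      (use B ev lin in \<open>simp_all add: linear_add[OF linear_complexify] complexify_cplx_scale cplx_dependent_def cplx_span_def\<close>)
  define z where "z = ?T w - cplx_scale c w"
  have Tz: "?T z = cplx_scale c z" using w by (simp add: z_def)
  have repz: "?rep z b = (ev b - c) * ?rep w b" if "b \<in> B" for b
    using rep[OF that, of w] B by (simp add: z_def cplx.representation_diff cplx.representation_scale algebra_simps)
  have "?rep z b = 0" for b
  proof (cases "b \<in> B")
    case True
    have "?rep z b = 0 \<or> ev b = c"
      using rep[OF True, of z] B by (auto simp: Tz cplx.representation_scale)
    then show ?thesis using repz[OF True] by (cases "ev b = c") simp_all
  next
    case False
    then show ?thesis using cplx.representation_ne_zero by blast
  qed
  then have "z = 0"
    using cplx.sum_nonzero_representation_eq[of B z] B by simp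
  then show ?thesis by (simp add: z_def)
qed

text \<open>If \<delta> b = c b, the double commutator at \<open>b\<close> reads (\<delta> - c)^2 (p
  b) = 0, so \<delta> - c already kills \<open>p b\<close>; and the eigenvectors span the
  complexification. This expresses semisimplicity of the commutator operator without diagonalising
  it on a space of maps.\<close>

lemma semisimple_endo_commutator:
  fixes \<delta> p :: "'a::real_vector \<Rightarrow> 'a"
  defines "T \<equiv> \<lambda>f x. \<delta> (f x) - f (\<delta> x)"
  assumes \<delta>: "semisimple_endo \<delta>" and p: "linear p" and TT: "T (T p) = (\<lambda>x. 0)"
  shows "T p = (\<lambda>x. 0)"
proof -
  have lin: "linear \<delta>" using \<delta> by (simp add: semisimple_endo_def)
  let ?d = "complexify \<delta>" and ?p = "complexify p"
  note ld = linear_complexify[OF lin] and lp = linear_complexify[OF p] and sd = complexify_cplx_scale[OF lin] and sp = complexify_cplx_scale[OF p]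
  obtain B where B: "\<not> cplx.dependent B" "cplx.span B = UNIV" "\<forall>b\<in>B. \<exists>c. ?d b = cplx_scale c b"
    using \<delta> unfolding semisimple_endo_def cplx_diagonalisable_def by blast
  have TT': "\<delta> (\<delta> (p x)) - \<delta> (p (\<delta> x)) - (\<delta> (p (\<delta> x)) - p (\<delta> (\<delta> x))) = 0" for x
    using fun_cong[OF TT, of x] by (simp add: T_def linear_diff[OF lin])
  have TTc: "?d (?d (?p v) - ?p (?d v)) = ?d (?p (?d v)) - ?p (?d (?d v))" for v
    using TT'[of "fst v"] TT'[of "snd v"]
    by (cases v) (simp add: complexify_def linear_diff[OF lin])
  have eig: "?d (?p b) = ?p (?d b)" if "b \<in> B" for b
  proof -
    obtain c where c: "?d b = cplx_scale c b" using B(3) \<open>b \<in> B\<close> by blast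
    have "?d (?p b) = cplx_scale c (?p b)"
    proof (rule semisimple_endo_eigen[OF \<delta>])
      show "?d (?d (?p b) - cplx_scale c (?p b)) = cplx_scale c (?d (?p b) - cplx_scale c (?p b))"
        using TTc[of b] by (simp add: c sp sd cplx.scale_right_diff_distrib)
    qed
    then show ?thesis by (simp add: c sp)
  qed
  have "?d (?p v) = ?p (?d v)" for v
  proof -
    have "v \<in> cplx.span B" using B by simp
    then show ?thesis
    proof (induction rule: cplx.span_induct_alt)
      case base
      then show ?case by (simp add: linear_0[OF ld] linear_0[OF lp])
    next
      case (step c x y)
      then show ?case using eig by (simp add: linear_add[OF ld] linear_add[OF lp] sd sp)
    qed
  qed
  from this[of "(_, 0)"] have "\<delta> (p x) = p (\<delta> x)" for x
    by (simp add: complexify_def)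
  then show ?thesis by (simp add: T_def)
qed

definition rscale :: "real \<Rightarrow> ('a::real_vector \<Rightarrow> 'a) \<Rightarrow> 'a \<Rightarrow> 'a" where
  "rscale c f = (\<lambda>x. c *\<^sub>R f x)"

lemma vector_space_rscale: "vector_space (rscale :: real \<Rightarrow> ('a::real_vector \<Rightarrow> 'a) \<Rightarrow> _)"
  by unfold_locales (auto simp: rscale_def fun_eq_iff algebra_simps)

lemma finite_span_linear_maps:
  assumes fd: "finite_dim (UNIV :: 'a::real_vector set)"
  shows "\<exists>S::('a \<Rightarrow> 'a) set. finite S \<and> (\<forall>f. linear f \<longrightarrow> f \<in> module.span rscale S)"
proof -
  interpret R: vector_space "rscale :: real \<Rightarrow> ('a \<Rightarrow> 'a) \<Rightarrow> _" by (rule vector_space_rscale)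
  obtain B \<phi> where B: "finite B" "\<And>b. linear (\<phi> b)" "\<And>v::'a. (\<Sum>b\<in>B. \<phi> b v *\<^sub>R b) = v"
    using basis_expansion_fd[OF fd subspace_UNIV] by blast
  \<comment> \<open>The matrix units of the basis.\<close>
  define S where "S = (\<lambda>(b, c). \<lambda>x. \<phi> b x *\<^sub>R c) ` (B \<times> B)"
  have "f \<in> R.span S" if f: "linear f" for f
  proof -
    have "f = (\<Sum>b\<in>B. \<Sum>c\<in>B. rscale (\<phi> c (f b)) (\<lambda>x. \<phi> b x *\<^sub>R c))"
    proof
      fix x
      have "f x = f (\<Sum>b\<in>B. \<phi> b x *\<^sub>R b)" by (simp only: B(3))
      also have "\<dots> = (\<Sum>b\<in>B. \<phi> b x *\<^sub>R f b)" by (simp only: linear_sum[OF f] linear_scale[OF f])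
      also have "\<dots> = (\<Sum>b\<in>B. \<phi> b x *\<^sub>R (\<Sum>c\<in>B. \<phi> c (f b) *\<^sub>R c))" by (simp only: B(3))
      also have "\<dots> = (\<Sum>b\<in>B. \<Sum>c\<in>B. rscale (\<phi> c (f b)) (\<lambda>x. \<phi> b x *\<^sub>R c)) x"
        by (simp add: sum_fun_apply rscale_def scaleR_sum_right mult.commute del: B(3))
      finally show "f x = (\<Sum>b\<in>B. \<Sum>c\<in>B. rscale (\<phi> c (f b)) (\<lambda>x. \<phi> b x *\<^sub>R c)) x" .
    qed
    also have "\<dots> \<in> R.span S"
      by (intro R.span_sum R.span_scale R.span_base) (auto simp: S_def)
    finally show ?thesis .
  qed
  moreover have "finite S" using B by (simp add: S_def)
  ultimately show ?thesis by blast
qed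

text \<open>
  Strip from an annihilating polynomial \<open>X ^ k * g\<close> of \<open>p\<close> the factor \<open>X ^ k\<close>: by semisimplicity of \<open>T\<close>,
  \<open>T ^ k (g T p) = 0\<close> forces \<open>T (g T p) = 0\<close>.
\<close>

lemma commutator_kernel_poly:
  fixes \<delta> p :: "'a::real_vector \<Rightarrow> 'a"
  defines "T \<equiv> \<lambda>f x. \<delta> (f x) - f (\<delta> x)"
  assumes fd: "finite_dim (UNIV :: 'a set)" and \<delta>: "semisimple_endo \<delta>" and p: "linear p"
  shows "\<exists>g. coeff g 0 = 1 \<and> T (vs_endomorphism.pact rscale T g p) = 0"
proof -
  have lin: "linear \<delta>" using \<delta> by (simp add: semisimple_endo_def)
  interpret R: vector_space "rscale :: real \<Rightarrow> ('a \<Rightarrow> 'a) \<Rightarrow> _" by (rule vector_space_rscale)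
  interpret E: vs_endomorphism rscale T
    by unfold_locales (simp_all add: T_def rscale_def fun_eq_iff linear_add[OF lin] linear_scale[OF lin] algebra_simps)
  have linT: "linear (T f)" if "linear f" for f
    unfolding T_def using that linear_compose[OF that lin] linear_compose[OF lin that]
    by (intro linear_compose_sub) (simp_all add: o_def)
  have linTk: "linear ((T ^^ i) p)" for i by (induction i) (simp_all add: p linT)
  obtain S :: "('a \<Rightarrow> 'a) set" where S: "finite S" "\<forall>f. linear f \<longrightarrow> f \<in> R.span S"
    using finite_span_linear_maps[OF fd] by blast
  have "(T ^^ i) p \<in> R.span S" for i using S(2) linTk by simp
  from E.exists_annihilating_poly[OF S(1) this] obtain h where h: "h \<noteq> 0" "E.pact h p = 0"
    by (elim exE conjE)
  define k where "k = order 0 h"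
  obtain g where g: "h = [:- 0, 1:] ^ k * g" "\<not> [:- 0, 1:] dvd g"
    using order_decomp[OF h(1), of 0] unfolding k_def by blast
  have g0: "coeff g 0 \<noteq> 0" using g(2) by (metis poly_0_coeff_0 poly_eq_0_iff_dvd)
  have lin0: "linear (E.pact g p)"
  proof -
    have "R.subspace {f. linear f}"
      by (rule R.subspaceI) (auto simp: rscale_def zero_fun_def plus_fun_def linear_compose_add linear_compose_scale_right linear_zero)
    then show ?thesis using E.pact_in_subspace[of "{f. linear f}" p g] linT p by blast
  qed
  have "(T ^^ k) (E.pact g p) = 0"
    using h(2) unfolding g(1) E.pact_mult E.pact_linear_factor_power by simp
  then have "T (E.pact g p) = 0"
  proof (induction k)
    case (Suc k)
    show ?case
    proof (cases k)
      case (Suc j)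
      have "linear ((T ^^ j) (E.pact g p))" by (induction j) (simp_all add: lin0 linT)
      moreover have "T (T ((T ^^ j) (E.pact g p))) = (\<lambda>x. 0)" using Suc.prems Suc by (simp add: zero_fun_def)
      ultimately have "T ((T ^^ j) (E.pact g p)) = (\<lambda>x. 0)"
        unfolding T_def by (rule semisimple_endo_commutator[OF \<delta>])
      then show ?thesis using Suc.IH Suc by (simp add: zero_fun_def)
    qed (use Suc.prems in simp)
  qed simp
  \<comment> \<open>The constant term is normalised to 1 because it is the factor by which
    \<open>pact\<close> multiplies the scalar of a splitting.\<close>
  then have "T (E.pact (smult (1 / coeff g 0) g) p) = 0"
    by (simp add: E.pact_smult E.T_scale)
  then show ?thesis using g0 by (intro exI[of _ "smult (1 / coeff g 0) g"]) simp
qed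

section \<open>Polynomials in the commutator operator acting on splittings\<close>

context radical_layer
begin

lemma splitting_lincomb:
  assumes "splitting c p" "splitting d q"
  shows "splitting (a * c + b * d) (\<lambda>x. a *\<^sub>R p x + b *\<^sub>R q x)"
  unfolding splitting_def
proof (intro conjI ballI)
  show "linear (\<lambda>x. a *\<^sub>R p x + b *\<^sub>R q x)"
    using assms by (simp add: splitting_def linear_compose_add linear_compose_scale_right)
  note comb = subspace_add[OF K'_subspace subspace_scale[OF K'_subspace] subspace_scale[OF K'_subspace], of _ _ a b]
  show "a *\<^sub>R p x + b *\<^sub>R q x \<in> K" if "x \<in> H" for x
    using assms that by (intro subspace_add[OF K_subspace] subspace_scale[OF K_subspace]) (auto simp: splitting_def)
  show "a *\<^sub>R p v + b *\<^sub>R q v - (a * c + b * d) *\<^sub>R v \<in> K'" if v: "v \<in> K" for v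
  proof -
    have "p v - c *\<^sub>R v \<in> K'" "q v - d *\<^sub>R v \<in> K'" using assms v unfolding splitting_def by blast+
    from comb[OF this] show ?thesis by (simp add: algebra_simps)
  qed
  show "a *\<^sub>R p (br x y) + b *\<^sub>R q (br x y) - (br x (a *\<^sub>R p y + b *\<^sub>R q y) + br (a *\<^sub>R p x + b *\<^sub>R q x) y) \<in> K'"
    if xy: "x \<in> H" "y \<in> H" for x y
  proof -
    have "p (br x y) - (br x (p y) + br (p x) y) \<in> K'" "q (br x y) - (br x (q y) + br (q x) y) \<in> K'"
      using assms xy unfolding splitting_def by blast+
    from comb[OF this] show ?thesis by (simp add: br_simps algebra_simps)
  qed
qed

text \<open>Apply \<open>\<delta>\<close> to the congruences for \<open>p\<close> and subtract those
  congruences at arguments moved by \<open>\<delta>\<close>; everything stays in the stable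
  \<open>K'\<close>. On \<open>K\<close> the two multiples of \<open>\<delta> v\<close> cancel,
  which leaves the scalar 0.\<close>

lemma splitting_commutator:
  assumes \<delta>: "lie_derivation br \<delta>" and H: "\<And>x. x \<in> H \<Longrightarrow> \<delta> x \<in> H"
    and K: "\<And>x. x \<in> K \<Longrightarrow> \<delta> x \<in> K" and K': "\<And>x. x \<in> K' \<Longrightarrow> \<delta> x \<in> K'"
    and p: "splitting c p"
  shows "splitting 0 (\<lambda>x. \<delta> (p x) - p (\<delta> x))"
  unfolding splitting_def
proof (intro conjI ballI)
  have lin: "linear \<delta>" and der: "\<And>x y. \<delta> (br x y) = br (\<delta> x) y + br x (\<delta> y)"
    using \<delta> by (auto simp: lie_derivation_def)
  have linp: "linear p" and pK: "\<And>x. x \<in> H \<Longrightarrow> p x \<in> K" and pid: "\<And>v. v \<in> K \<Longrightarrow> p v - c *\<^sub>R v \<in> K'"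
    and pder: "\<And>x y. x \<in> H \<Longrightarrow> y \<in> H \<Longrightarrow> p (br x y) - (br x (p y) + br (p x) y) \<in> K'"
    using p unfolding splitting_def by blast+
  show "linear (\<lambda>x. \<delta> (p x) - p (\<delta> x))"
    using linear_compose[OF linp lin] linear_compose[OF lin linp] by (intro linear_compose_sub) (simp_all add: o_def)
  show "\<delta> (p x) - p (\<delta> x) \<in> K" if "x \<in> H" for x
    using that by (intro subspace_diff[OF K_subspace] pK K H)
  show "\<delta> (p v) - p (\<delta> v) - 0 *\<^sub>R v \<in> K'" if v: "v \<in> K" for v
  proof -
    have "\<delta> (p v - c *\<^sub>R v) - (p (\<delta> v) - c *\<^sub>R \<delta> v) \<in> K'"
      using v by (intro subspace_diff[OF K'_subspace] K' pid K)
    then show ?thesis by (simp add: linear_diff[OF lin] linear_scale[OF lin])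
  qed
  show "\<delta> (p (br x y)) - p (\<delta> (br x y)) - (br x (\<delta> (p y) - p (\<delta> y)) + br (\<delta> (p x) - p (\<delta> x)) y) \<in> K'"
    if xy: "x \<in> H" "y \<in> H" for x y
  proof -
    have "\<delta> (p (br x y) - (br x (p y) + br (p x) y)) - (p (br (\<delta> x) y) - (br (\<delta> x) (p y) + br (p (\<delta> x)) y))
      - (p (br x (\<delta> y)) - (br x (p (\<delta> y)) + br (p x) (\<delta> y))) \<in> K'"
      using xy by (intro subspace_diff[OF K'_subspace] K' pder H)
    then show ?thesis
      by (simp add: der linear_diff[OF lin] linear_add[OF lin] linear_add[OF linp] br_simps algebra_simps)
  qed
qed

text \<open>All terms beyond the constant one pass through \<open>T\<close>, whose values are
  splittings with scalar 0.\<close>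

lemma splitting_pact:
  assumes \<delta>: "semisimple_endo \<delta>" "lie_derivation br \<delta>" and H: "\<And>x. x \<in> H \<Longrightarrow> \<delta> x \<in> H"
    and K: "\<And>x. x \<in> K \<Longrightarrow> \<delta> x \<in> K" and K': "\<And>x. x \<in> K' \<Longrightarrow> \<delta> x \<in> K'"
    and p: "splitting c p" and T: "T = (\<lambda>f x. \<delta> (f x) - f (\<delta> x))"
  shows "splitting (coeff g 0 * c) (vs_endomorphism.pact rscale T g p)"
proof -
  have lin: "linear \<delta>" using \<delta> by (simp add: semisimple_endo_def)
  interpret R: vector_space "rscale :: real \<Rightarrow> ('a \<Rightarrow> 'a) \<Rightarrow> _" by (rule vector_space_rscale)
  interpret E: vs_endomorphism rscale T
    by unfold_locales (simp_all add: T rscale_def fun_eq_iff linear_add[OF lin] linear_scale[OF lin] algebra_simps)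
  show ?thesis
  proof (induction g)
    case 0
    then show ?case using splitting_lincomb[OF p p, of 0 0] by (simp add: zero_fun_def)
  next
    case (pCons a g)
    have "splitting 0 (T (E.pact g p))"
      unfolding T by (rule splitting_commutator[OF \<delta>(2) H K K' pCons.IH[unfolded T]])
    from splitting_lincomb[OF p this, of a 1]
    have "splitting (a * c) (\<lambda>x. a *\<^sub>R p x + T (E.pact g p) x)" by simp
    moreover have "E.pact (pCons a g) p = (\<lambda>x. a *\<^sub>R p x + T (E.pact g p) x)"
    proof
      fix x
      have "rscale a p x = a *\<^sub>R p x" by (simp add: rscale_def)
      then show "E.pact (pCons a g) p x = a *\<^sub>R p x + T (E.pact g p) x" by simp
    qed
    ultimately show ?case by simp
  qed
qed

text \<open>One derivation at a time. Applying a polynomial in \<open>T\<close> keeps what was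
  gained: as the derivations commute, \<open>T\<close> preserves the space of maps that commute with
  an earlier \<open>\<delta> k\<close>.\<close>

lemma invariant_splitting_exists:
  fixes \<delta> :: "'h \<Rightarrow> 'a \<Rightarrow> 'a"
  assumes fin: "finite F" and ss: "\<And>h. semisimple_endo (\<delta> h)" and der: "\<And>h. lie_derivation br (\<delta> h)"
    and comm: "\<And>g h x. \<delta> g (\<delta> h x) = \<delta> h (\<delta> g x)"
    and H: "\<And>h x. x \<in> H \<Longrightarrow> \<delta> h x \<in> H"
    and K: "\<And>h x. x \<in> K \<Longrightarrow> \<delta> h x \<in> K" and K': "\<And>h x. x \<in> K' \<Longrightarrow> \<delta> h x \<in> K'"
    and p: "splitting 1 p"
  shows "\<exists>p. splitting 1 p \<and> (\<forall>h\<in>F. \<forall>x. \<delta> h (p x) = p (\<delta> h x))"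
  using fin
proof (induction F rule: finite_induct)
  case empty
  then show ?case using p by blast
next
  case (insert h F)
  then obtain p where p: "splitting 1 p" "\<forall>g\<in>F. \<forall>x. \<delta> g (p x) = p (\<delta> g x)" by blast
  define T where "T = (\<lambda>f x. \<delta> h (f x) - f (\<delta> h x))"
  have lin: "linear (\<delta> g)" for g using ss by (simp add: semisimple_endo_def)
  interpret R: vector_space "rscale :: real \<Rightarrow> ('a \<Rightarrow> 'a) \<Rightarrow> _" by (rule vector_space_rscale)
  interpret E: vs_endomorphism rscale T
    by unfold_locales (simp_all add: T_def rscale_def fun_eq_iff linear_add[OF lin] linear_scale[OF lin] algebra_simps)
  have linp: "linear p" using p by (simp add: splitting_def)
  obtain g where g: "coeff g 0 = 1" "T (E.pact g p) = 0"
    using commutator_kernel_poly[OF fd ss linp] unfolding T_def by blast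
  define p' where "p' = E.pact g p"
  have "splitting 1 p'"
    using splitting_pact[OF ss der H K K' p(1) T_def, of g] g(1)
    by (simp add: p'_def)
  moreover have "\<delta> h (p' x) = p' (\<delta> h x)" for x
    using fun_cong[OF g(2), of x] by (simp add: p'_def T_def)
  moreover have "\<delta> k (p' x) = p' (\<delta> k x)" if "k \<in> F" for k x
  proof -
    let ?L = "{f. \<forall>x. \<delta> k (f x) = f (\<delta> k x)}"
    have "R.subspace ?L"
      by (rule R.subspaceI) (simp_all add: rscale_def linear_0[OF lin] linear_add[OF lin] linear_scale[OF lin])
    moreover have "T f \<in> ?L" if "f \<in> ?L" for f
      using that comm[of k h] by (simp add: T_def linear_diff[OF lin])
    ultimately have "p' \<in> ?L" unfolding p'_def using p(2) that by (intro E.pact_in_subspace[of ?L]) auto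
    then show ?thesis by simp
  qed
  ultimately show ?case by blast
qed

end

context fd_lie_algebra
begin

text \<open>Project \<open>H\<close> to \<open>K\<close> along \<open>L\<close>. For x = a + s and y
  = b + t with a, b in \<open>L\<close> and s, t in \<open>K\<close>, the bracket of a and b stays
  in \<open>L\<close>, and the defect of the derivation rule is \<open>- br s t\<close>, which lies
  in \<open>K'\<close>.\<close>

lemma levi_projection_splitting:
  assumes layer: "radical_layer br H K'" and L: "lie_subalgebra br L" "L \<subseteq> H" "L \<inter> rad = {0}" "\<And>x. \<exists>y\<in>L. x - y \<in> rad"
  shows "\<exists>p. radical_layer.splitting br H K' 1 p"
proof -
  interpret l: radical_layer br H K' by (rule layer)
  have subL: "subspace L" using L by (simp add: lie_subalgebra_def)
  have "l.K \<inter> L = {0}" using L subspace_0[OF subL] subspace_0[OF l.K_subspace] by blast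
  then obtain p where p: "linear p" "\<forall>x\<in>l.K. p x = x" "\<forall>x\<in>L. p x = 0" "\<forall>x. p x \<in> l.K"
    using projection_onto_along[OF l.K_subspace subL] by blast
  have "p (br x y) - (br x (p y) + br (p x) y) \<in> K'" if x: "x \<in> H" and y: "y \<in> H" for x y
  proof -
    have dec: "\<exists>a\<in>L. x - a \<in> l.K" if "x \<in> H" for x
    proof -
      obtain a where "a \<in> L" "x - a \<in> rad" using L(4) by blast
      then show ?thesis using that L(2) subspace_diff[OF l.H_subspace] by blast
    qed
    obtain a where a: "a \<in> L" "x - a \<in> l.K" using dec[OF x] by blast
    obtain b where b: "b \<in> L" "y - b \<in> l.K" using dec[OF y] by blast
    define s t where "s = x - a" and "t = y - b"
    have st: "s \<in> l.K" "t \<in> l.K" "x = a + s" "y = b + t" using a b by (simp_all add: s_def t_def)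
    have px: "p x = s" "p y = t" using p a b st by (simp_all add: linear_add[OF p(1)] del: Int_iff)
    have aH: "a \<in> H" "b \<in> H" using a b L by auto
    have "br a b \<in> L" using L(1) a b by (simp add: lie_subalgebra_def)
    moreover have "br a t \<in> l.K" "br s b \<in> l.K" "br s t \<in> l.K"
      using l.br_K aH st by blast+
    ultimately have "p (br x y) = br a t + br s b + br s t"
      using p unfolding st br_simps linear_add[OF p(1)] by (simp del: Int_iff)
    then have "p (br x y) - (br x (p y) + br (p x) y) = - br s t"
      unfolding px unfolding st by (simp add: br_simps)
    then show ?thesis using subspace_neg[OF l.K'_subspace l.K_abelian[OF st(1,2)]] by simp
  qed
  then have "l.splitting 1 p" unfolding l.splitting_def
    using p subspace_0[OF l.K'_subspace] by simp
  then show ?thesis by blast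
qed

text \<open>The kernel of an equivariant splitting is again stable, so the descent repeats with it.
  The complement that supplies the initial splitting is chosen anew at each stage and may be
  unstable. The hypothesis \<open>span\<close> serves to pass from finitely many derivations,
  corrected one by one, to all of them.\<close>

lemma invariant_levi_complement:
  fixes \<delta> :: "'h \<Rightarrow> 'a \<Rightarrow> 'a"
  assumes fin: "finite F" and ss: "\<And>h. semisimple_endo (\<delta> h)" and der: "\<And>h. lie_derivation br (\<delta> h)"
    and comm: "\<And>g h x. \<delta> g (\<delta> h x) = \<delta> h (\<delta> g x)"
    and span: "\<And>p h x. linear p \<Longrightarrow> (\<And>g x. g \<in> F \<Longrightarrow> \<delta> g (p x) = p (\<delta> g x)) \<Longrightarrow> \<delta> h (p x) = p (\<delta> h x)"
    and "lie_subalgebra br H" "\<And>x. \<exists>y\<in>H. x - y \<in> rad" "\<And>h x. x \<in> H \<Longrightarrow> \<delta> h x \<in> H"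
  shows "\<exists>L. lie_subalgebra br L \<and> L \<inter> rad = {0} \<and> (\<forall>x. \<exists>y\<in>L. x - y \<in> rad) \<and> (\<forall>h. \<forall>x\<in>L. \<delta> h x \<in> L)"
  using assms(6-8)
proof (induction "dim (H \<inter> rad)" arbitrary: H rule: less_induct)
  case less
  note H = less.prems(1) and sum = less.prems(2) and stable = less.prems(3)
  let ?K = "H \<inter> rad" and ?K1 = "derived_series br (H \<inter> rad) 1"
  show ?case
  proof (cases "?K = {0}")
    case True
    then show ?thesis using less.prems by blast
  next
    case False
    interpret l: radical_layer br H ?K1 by (rule radical_layer_derived(1)[OF H sum])
    have lin: "linear (\<delta> h)" for h using ss by (simp add: semisimple_endo_def)
    have K: "\<delta> h x \<in> ?K" if "x \<in> ?K" for h x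
      using that stable derivation_preserves_rad[OF der] by blast
    have K1: "\<delta> h x \<in> ?K1" if "x \<in> ?K1" for h x
      using that unfolding One_nat_def derived_series.simps
    proof (induction rule: span_induct_alt)
      case base
      then show ?case by (simp add: linear_0[OF lin] span_zero)
    next
      case (step c u v)
      obtain a b where ab: "a \<in> ?K" "b \<in> ?K" "u = br a b" using step by blast
      have "\<delta> h u = br (\<delta> h a) b + br a (\<delta> h b)" using der ab by (simp add: lie_derivation_def)
      moreover have "br (\<delta> h a) b \<in> span {br x y |x y. x \<in> ?K \<and> y \<in> ?K}" "br a (\<delta> h b) \<in> span {br x y |x y. x \<in> ?K \<and> y \<in> ?K}"
        using K ab by (blast intro: span_base)+
      ultimately have "\<delta> h u \<in> span {br x y |x y. x \<in> ?K \<and> y \<in> ?K}" using span_add by simp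
      then show ?case using step(2) by (simp add: linear_add[OF lin] linear_scale[OF lin] span_add span_scale)
    qed
    obtain L where L: "lie_subalgebra br L" "L \<subseteq> H" "L \<inter> rad = {0}" "\<forall>x. \<exists>y\<in>L. x - y \<in> rad"
      using levi_complement_exists[OF H sum] by blast
    obtain p0 where "l.splitting 1 p0"
      using levi_projection_splitting[OF l.radical_layer_axioms L(1-3)] L(4) by blast
    then obtain p where p: "l.splitting 1 p" "\<forall>h\<in>F. \<forall>x. \<delta> h (p x) = p (\<delta> h x)"
      using l.invariant_splitting_exists[where \<delta> = \<delta>, OF fin ss der comm stable K K1] by blast
    have pcomm: "\<delta> h (p x) = p (\<delta> h x)" for h x
    proof (rule span[of p])
      show "linear p" using p(1) by (simp only: l.splitting_def)
      show "\<delta> g (p x) = p (\<delta> g x)" if "g \<in> F" for g x using p(2) that by blast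
    qed
    define H' where "H' = {x \<in> H. p x \<in> ?K1}"
    note ker = l.splitting_kernel[OF p(1) H'_def]
    have "H' \<inter> rad \<subset> ?K"
      using ker(2) l.K'_sub radical_layer_derived(2)[OF H sum False] by blast
    moreover have "subspace (H' \<inter> rad)" using ker(2) l.K'_subspace by simp
    ultimately have "dim (H' \<inter> rad) < dim ?K"
      using subspace_dim_less_fd[OF fd _ l.K_subspace] by blast
    moreover have "\<delta> h x \<in> H'" if "x \<in> H'" for h x
    proof -
      have "p (\<delta> h x) \<in> ?K1" using that K1[of "p x" h] pcomm[of h x] by (simp add: H'_def del: derived_series.simps One_nat_def)
      then show ?thesis using that stable by (simp add: H'_def)
    qed
    ultimately show ?thesis using less.hyps[OF _ ker(1,3)] by blast
  qed
qed

end

theorem theorem1p1: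
  fixes brg :: "'g::real_vector \<Rightarrow> 'g \<Rightarrow> 'g"
    and bra :: "'a::real_vector \<Rightarrow> 'a \<Rightarrow> 'a"
    and \<delta> :: "'a \<Rightarrow> 'g \<Rightarrow> 'g"
  assumes "lie_algebra brg" and "finite_dim (UNIV :: 'g set)"
    and "lie_algebra bra" and "finite_dim (UNIV :: 'a set)" and "lie_abelian bra"
    and "lie_hom_into_derivations bra brg \<delta>"
    and "\<And>H. semisimple_endo (\<delta> H)"
  shows "\<exists>L. levi_subalgebra brg L \<and> (\<forall>H. \<delta> H ` L \<subseteq> L)"
proof -
  interpret lie_algebra brg by fact
  interpret fd_lie_algebra brg by unfold_locales fact
  obtain F :: "'a set" where F: "finite F" "span F = UNIV" using fd_basis[OF assms(4)] by blast
  have der: "\<And>h. lie_derivation brg (\<delta> h)" and lin\<delta>: "\<And>x. linear (\<lambda>h. \<delta> h x)"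
    and hom: "\<And>h k x. \<delta> (bra h k) x = \<delta> h (\<delta> k x) - \<delta> k (\<delta> h x)"
    using assms(6) by (auto simp: lie_hom_into_derivations_def)
  have comm: "\<delta> h (\<delta> k x) = \<delta> k (\<delta> h x)" for h k x
    using hom[of h k x] assms(5) linear_0[OF lin\<delta>[of x]] by (simp add: lie_abelian_def)
  \<comment> \<open>For fixed \<open>p\<close> and \<open>x\<close> the commutator is linear in
    \<open>h\<close>, so commuting with the derivations from a finite spanning set suffices.\<close>
  have span: "\<delta> h (p x) = p (\<delta> h x)" if p: "linear p" "\<And>g x. g \<in> F \<Longrightarrow> \<delta> g (p x) = p (\<delta> g x)" for p h x
  proof -
    have "linear (\<lambda>h. \<delta> h (p x) - p (\<delta> h x))"
      using linear_compose[OF lin\<delta> p(1)] by (intro linear_compose_sub lin\<delta>) (simp add: o_def)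
    moreover have "h \<in> span F" using F by simp
    ultimately have "\<delta> h (p x) - p (\<delta> h x) = 0"
      using linear_eq_0_on_span[of "\<lambda>h. \<delta> h (p x) - p (\<delta> h x)" F h] p(2) by simp
    then show ?thesis by simp
  qed
  have whole: "\<exists>y\<in>UNIV. x - y \<in> rad" for x
    using subspace_0[OF rad_subspace] by (intro bexI[of _ x]) auto
  have "\<exists>L. lie_subalgebra brg L \<and> L \<inter> rad = {0} \<and> (\<forall>x. \<exists>y\<in>L. x - y \<in> rad) \<and> (\<forall>h. \<forall>x\<in>L. \<delta> h x \<in> L)"
  proof (rule invariant_levi_complement[where \<delta> = \<delta> and H = UNIV, OF F(1) assms(7) der comm _ lie_subalgebra_UNIV])
    show "\<delta> h (p x) = p (\<delta> h x)" if "linear p" "\<And>g x. g \<in> F \<Longrightarrow> \<delta> g (p x) = p (\<delta> g x)" for p h x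
      using that by (rule span)
    show "\<exists>y\<in>UNIV. x - y \<in> rad" for x by (rule whole)
  qed simp_all
  then obtain L where L: "lie_subalgebra brg L \<and> L \<inter> rad = {0} \<and> (\<forall>x. \<exists>y\<in>L. x - y \<in> rad) \<and> (\<forall>h. \<forall>x\<in>L. \<delta> h x \<in> L)"
    by (elim exE)
  then have "levi_subalgebra brg L" by (intro levi_subalgebraI) simp_all
  then show ?thesis using L by (intro exI[of _ L]) auto
qed

end
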